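(* Let $\mathbb{K}$ be a field of characteristic zero, let $S=\mathfrak{sl}(2,\mathbb{K})$, and let $L = S\oplus_{\pi}\mathcal{R}$ be a semi-direct sum in which the radical $\mathcal{R}$ is a solvable Lie algebra of finite dimension $d\geq 1$ and $\pi$ is an irreducible representation of $S$ in $\mathcal{R}$. Then the number $\mathcal{N}$ of invariants of $L$ is given by (a) $\mathcal{N}=2$ for $d=1$; (b) $\mathcal{N}=1$ for $d=2$ and $\mathcal{N}=2$ for $d=3$; (c) $\mathcal{N}=d-3$ for $d\geq 4$.
   Context: Semi-direct sum: $L = S \oplus_{\pi} \mathcal{R}$ means that $L$ is the vector space direct sum of the subalgebra $S$ and the solvable ideal $\mathcal{R}$ (the radical), with $[s,v]=\pi(s)v$ for $s\in S$, $v\in\mathcal{R}$. For $d=1$ the representation $\pi$ is the one-dimensional trivial representation, which is allowed here. Invariants: let $e_1,\dots,e_n$ be a basis of a Lie algebra $L$ with structure constants $c_{ij}^k$ (so $[e_i,e_j]=\sum_k c_{ij}^k e_k$) and let $x_1,\dots,x_n$ be the corresponding coordinates on the dual space $L^*$ ($x_k(f)=f(e_k)$). An invariant of $L$ (an invariant of the coadjoint representation) is a function $F$ of $x_1,\dots,x_n$ satisfying $\sum_{j,k} c_{ij}^k x_k \,\partial F/\partial x_j = 0$ for $i=1,\dots,n$. Here functions are analytic functions on nonempty connected open subsets of $L^*$ when $\mathbb{K}=\mathbb{R}$ or $\mathbb{C}$; for general $\mathbb{K}$ they are understood formally, as formal power series over $\mathbb{K}$ around a point of $L^*$. Invariants $F_1,\dots,F_k$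 with common domain (or common base point) are functionally independent if their Jacobian matrix $(\partial F_a/\partial x_j)$ has rank $k$ (generically). The number of invariants of $L$ is the largest $k$ for which there exist $k$ functionally independent invariants. It is a well-known fact, used by the paper, that this number equals $\dim L - \operatorname{rank}\left(\sum_k c_{ij}^k x_k\right)_{i,j}$, the rank being taken over $\mathbb{K}(x_1,\dots,x_n)$. *)

theory Defs
  imports "HOL-Analysis.Analysis" "HOL-Computational_Algebra.Fraction_Field"
begin

section \<open>Formal power series in finitely many variables\<close>

text \<open>The variables are indexed by the finite type \<open>'n\<close>; a multi-index is a function
  \<open>'n \<Rightarrow> nat\<close>. The integral domain instance is what makes the field of fractions, and
  hence the rank of a matrix of power series, available.\<close>

typedef ('a, 'n) mfps = "UNIV :: (('n \<Rightarrow> nat) \<Rightarrow> 'a) set"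
  morphisms mcoeff Abs_mfps
  by simp

lemma mcoeff_Abs [simp]: "mcoeff (Abs_mfps f) = f"
  by (simp add: Abs_mfps_inverse)

lemma mfps_eqI: "(\<And>m. mcoeff F m = mcoeff G m) \<Longrightarrow> F = G"
  by (metis mcoeff_inverse ext)

definition msplits :: "('n \<Rightarrow> nat) \<Rightarrow> (('n \<Rightarrow> nat) \<times> ('n \<Rightarrow> nat)) set" where
  "msplits m = {(a, b). \<forall>i. a i + b i = m i}"

lemma finite_msplits: "finite (msplits (m :: 'n::finite \<Rightarrow> nat))"
proof -
  have "finite (\<Pi>\<^sub>E i\<in>(UNIV :: 'n set). {..m i})"
    by (intro finite_PiE) auto
  then have fin: "finite {a :: 'n \<Rightarrow> nat. \<forall>i. a i \<le> m i}"
    by (simp add: PiE_UNIV_domain Pi_def)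
  have "msplits m \<subseteq> {a. \<forall>i. a i \<le> m i} \<times> {a. \<forall>i. a i \<le> m i}"
    unfolding msplits_def by auto (metis le_add1, metis le_add2)
  then show ?thesis
    using fin finite_subset by blast
qed

instantiation mfps :: (comm_ring_1, finite) comm_ring_1
begin

definition zero_mfps :: "('a, 'b) mfps" where
  "0 = Abs_mfps (\<lambda>m. 0)"

definition one_mfps :: "('a, 'b) mfps" where
  "1 = Abs_mfps (\<lambda>m. if m = (\<lambda>i. 0) then 1 else 0)"

definition plus_mfps :: "('a, 'b) mfps \<Rightarrow> ('a, 'b) mfps \<Rightarrow> ('a, 'b) mfps" where
  "F + G = Abs_mfps (\<lambda>m. mcoeff F m + mcoeff G m)"

definition uminus_mfps :: "('a, 'b) mfps \<Rightarrow> ('a, 'b) mfps" where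
  "- F = Abs_mfps (\<lambda>m. - mcoeff F m)"

definition minus_mfps :: "('a, 'b) mfps \<Rightarrow> ('a, 'b) mfps \<Rightarrow> ('a, 'b) mfps" where
  "F - G = Abs_mfps (\<lambda>m. mcoeff F m - mcoeff G m)"

definition times_mfps :: "('a, 'b) mfps \<Rightarrow> ('a, 'b) mfps \<Rightarrow> ('a, 'b) mfps" where
  "F * G = Abs_mfps (\<lambda>m. \<Sum>(a, b)\<in>msplits m. mcoeff F a * mcoeff G b)"

instance
proof
  fix F G H :: "('a, 'b) mfps"
  show "F + G + H = F + (G + H)"
    by (simp add: plus_mfps_def add.assoc)
  show "F + G = G + F"
    by (simp add: plus_mfps_def add.commute)
  show "0 + F = F" "- F + F = 0" "F - G = F + - G"
    by (simp_all add: plus_mfps_def zero_mfps_def uminus_mfps_def minus_mfps_def mcoeff_inverse)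
  show "(F + G) * H = F * H + G * H"
    by (rule mfps_eqI)
      (simp add: plus_mfps_def times_mfps_def distrib_right sum.distrib case_prod_unfold)
  show "F * G = G * F"
  proof (rule mfps_eqI)
    fix m
    have "(\<Sum>(a, b)\<in>msplits m. mcoeff F a * mcoeff G b)
        = (\<Sum>(a, b)\<in>msplits m. mcoeff G a * mcoeff F b)"
      by (rule sum.reindex_bij_witness[where i = prod.swap and j = prod.swap])
        (auto simp: msplits_def add.commute mult.commute)
    then show "mcoeff (F * G) m = mcoeff (G * F) m"
      by (simp add: times_mfps_def)
  qed
  show "1 * F = F"
  proof (rule mfps_eqI)
    fix m
    have "(\<Sum>(a, b)\<in>msplits m. (if a = (\<lambda>i. 0) then 1 else 0) * mcoeff F b)
        = (\<Sum>(a, b)\<in>{((\<lambda>i::'b. 0::nat), m)}. mcoeff F b)"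
      by (rule sum.mono_neutral_cong_right[OF finite_msplits])
        (auto simp: msplits_def fun_eq_iff split: if_splits)
    then show "mcoeff (1 * F) m = mcoeff F m"
      by (simp add: times_mfps_def one_mfps_def)
  qed
  show "F * G * H = F * (G * H)"
  proof (rule mfps_eqI)
    fix m
    have "mcoeff (F * G * H) m = (\<Sum>(s, c)\<in>msplits m. \<Sum>(a, b)\<in>msplits s.
        mcoeff F a * mcoeff G b * mcoeff H c)"
      by (simp add: times_mfps_def sum_distrib_right case_prod_unfold)
    also have "\<dots> = (\<Sum>((s, c), (a, b))\<in>Sigma (msplits m) (\<lambda>(s, c). msplits s).
        mcoeff F a * mcoeff G b * mcoeff H c)"
      by (subst sum.Sigma[symmetric]) (auto simp: finite_msplits case_prod_unfold)
    also have "\<dots> = (\<Sum>((a, t), (b, c))\<in>Sigma (msplits m) (\<lambda>(a, t). msplits t).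
        mcoeff F a * (mcoeff G b * mcoeff H c))"
      by (rule sum.reindex_bij_witness
          [where i = "\<lambda>((a, t), (b, c)). (((\<lambda>i. a i + b i), c), (a, b))"
             and j = "\<lambda>((s, c), (a, b)). ((a, (\<lambda>i. b i + c i)), (b, c))"])
        (auto simp: msplits_def algebra_simps fun_eq_iff)
    also have "\<dots> = (\<Sum>(a, t)\<in>msplits m. \<Sum>(b, c)\<in>msplits t.
        mcoeff F a * (mcoeff G b * mcoeff H c))"
      by (subst sum.Sigma[symmetric]) (auto simp: finite_msplits case_prod_unfold)
    also have "\<dots> = mcoeff (F * (G * H)) m"
      by (simp add: times_mfps_def sum_distrib_left case_prod_unfold)
    finally show "mcoeff (F * G * H) m = mcoeff (F * (G * H)) m" .
  qed
  show "(0 :: ('a, 'b) mfps) \<noteq> 1"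
    by (auto simp: zero_mfps_def one_mfps_def Abs_mfps_inject fun_eq_iff)
qed

end

lemma mfps_lowest_exponents:
  fixes F G :: "('a::zero, 'n) mfps"
  assumes "finite A" and "\<exists>m. mcoeff F m \<noteq> 0" and "\<exists>m. mcoeff G m \<noteq> 0"
  shows "\<exists>a b. mcoeff F a \<noteq> 0 \<and> mcoeff G b \<noteq> 0 \<and>
    (\<forall>a' b'. mcoeff F a' \<noteq> 0 \<longrightarrow> mcoeff G b' \<noteq> 0 \<longrightarrow> (\<forall>i\<in>A. a' i + b' i = a i + b i) \<longrightarrow>
      (\<forall>i\<in>A. a' i = a i \<and> b' i = b i))"
  using assms(1)
proof (induction A rule: finite_induct)
  case empty
  then show ?case using assms by auto
next
  case (insert j A)
  then obtain a b where ab: "mcoeff F a \<noteq> 0" "mcoeff G b \<noteq> 0" and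
    uniq: "\<And>a' b'. mcoeff F a' \<noteq> 0 \<Longrightarrow> mcoeff G b' \<noteq> 0 \<Longrightarrow> \<forall>i\<in>A. a' i + b' i = a i + b i \<Longrightarrow>
      \<forall>i\<in>A. a' i = a i \<and> b' i = b i"
    by metis
  obtain a1 where a1: "mcoeff F a1 \<noteq> 0" "\<forall>i\<in>A. a1 i = a i"
    and a1_min: "\<And>a'. mcoeff F a' \<noteq> 0 \<Longrightarrow> \<forall>i\<in>A. a' i = a i \<Longrightarrow> a1 j \<le> a' j"
    using ab ex_has_least_nat[of "\<lambda>a'. mcoeff F a' \<noteq> 0 \<and> (\<forall>i\<in>A. a' i = a i)" a "\<lambda>a'. a' j"]
    by auto
  obtain b1 where b1: "mcoeff G b1 \<noteq> 0" "\<forall>i\<in>A. b1 i = b i"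
    and b1_min: "\<And>b'. mcoeff G b' \<noteq> 0 \<Longrightarrow> \<forall>i\<in>A. b' i = b i \<Longrightarrow> b1 j \<le> b' j"
    using ab ex_has_least_nat[of "\<lambda>b'. mcoeff G b' \<noteq> 0 \<and> (\<forall>i\<in>A. b' i = b i)" b "\<lambda>b'. b' j"]
    by auto
  have "\<forall>i\<in>insert j A. a' i = a1 i \<and> b' i = b1 i"
    if "mcoeff F a' \<noteq> 0" "mcoeff G b' \<noteq> 0" "\<forall>i\<in>insert j A. a' i + b' i = a1 i + b1 i" for a' b'
  proof -
    have "\<forall>i\<in>A. a' i = a i \<and> b' i = b i"
      using that a1(2) b1(2) by (intro uniq) auto
    moreover from this have "a1 j \<le> a' j" "b1 j \<le> b' j"
      using that a1_min b1_min by auto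
    moreover have "a' j + b' j = a1 j + b1 j"
      using that by auto
    ultimately show ?thesis
      using a1(2) b1(2) by auto
  qed
  then show ?case
    using a1(1) b1(1) by blast
qed

instance mfps :: (idom, finite) idom
proof
  fix F G :: "('a, 'b) mfps"
  assume "F \<noteq> 0" "G \<noteq> 0"
  then have "\<exists>m. mcoeff F m \<noteq> 0" "\<exists>m. mcoeff G m \<noteq> 0"
    by (auto simp: zero_mfps_def intro: mfps_eqI)
  from mfps_lowest_exponents[OF finite_class.finite_UNIV this]
  obtain a b where ab: "mcoeff F a \<noteq> 0" "mcoeff G b \<noteq> 0" and
    lowest: "\<forall>a' b'. mcoeff F a' \<noteq> 0 \<longrightarrow> mcoeff G b' \<noteq> 0 \<longrightarrow>
      (\<forall>i\<in>UNIV. a' i + b' i = a i + b i) \<longrightarrow> (\<forall>i\<in>UNIV. a' i = a i \<and> b' i = b i)"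
    by (elim exE conjE)
  have uniq: "a' = a \<and> b' = b"
    if "mcoeff F a' \<noteq> 0" "mcoeff G b' \<noteq> 0" "\<forall>i. a' i + b' i = a i + b i" for a' b'
    using lowest[rule_format, of a' b'] that by (simp add: fun_eq_iff)
  define m where "m = (\<lambda>i. a i + b i)"
  have "(case x of (a', b') \<Rightarrow> mcoeff F a' * mcoeff G b') = 0" if "x \<in> msplits m - {(a, b)}" for x
    using that uniq[of "fst x" "snd x"] by (cases x) (auto simp: msplits_def m_def)
  then have "(\<Sum>(a', b')\<in>msplits m. mcoeff F a' * mcoeff G b')
      = (\<Sum>(a', b')\<in>{(a, b)}. mcoeff F a' * mcoeff G b')"
    by (intro sum.mono_neutral_right[OF finite_msplits] ballI) (simp_all add: msplits_def m_def)
  then have "mcoeff (F * G) m \<noteq> 0"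
    using ab by (simp add: times_mfps_def)
  then show "F * G \<noteq> 0"
    by (auto simp: zero_mfps_def)
qed

definition mfps_const :: "'a::zero \<Rightarrow> ('a, 'n) mfps" where
  "mfps_const c = Abs_mfps (\<lambda>m. if m = (\<lambda>i. 0) then c else 0)"

definition mfps_var :: "'n \<Rightarrow> ('a::zero_neq_one, 'n) mfps" where
  "mfps_var k = Abs_mfps (\<lambda>m. if m = (\<lambda>i. if i = k then 1 else 0) then 1 else 0)"

definition mfps_deriv :: "'n \<Rightarrow> ('a::semiring_1, 'n) mfps \<Rightarrow> ('a, 'n) mfps" where
  "mfps_deriv j F = Abs_mfps (\<lambda>m. of_nat (m j + 1) * mcoeff F (m(j := m j + 1)))"


section \<open>Analytic functions of several variables\<close>

definition analytic_on_space :: "('k::real_normed_field ^ 'n \<Rightarrow> 'k) \<Rightarrow> ('k ^ 'n) set \<Rightarrow> bool" where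
  "analytic_on_space F U \<longleftrightarrow> (\<forall>p\<in>U. \<exists>c :: ('n \<Rightarrow> nat) \<Rightarrow> 'k. \<exists>r>0. \<forall>x.
     (\<forall>i. norm (x $ i - p $ i) < r) \<longrightarrow>
       ((\<lambda>m. c m * (\<Prod>i\<in>UNIV. (x $ i - p $ i) ^ m i)) has_sum F x) UNIV)"

definition partial_deriv :: "'n \<Rightarrow> ('k::real_normed_field ^ 'n \<Rightarrow> 'k) \<Rightarrow> 'k ^ 'n \<Rightarrow> 'k" where
  "partial_deriv j F x = deriv (\<lambda>t. F (\<chi> i. if i = j then t else x $ i)) (x $ j)"


section \<open>Invariants\<close>

text \<open>Everything here is expressed through the structure constants \<open>c i j k\<close> of a Lie algebra
  with respect to a basis indexed by \<open>'n\<close>; a point \<open>f\<close> of the dual space is identified with its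
  coordinate vector, whose \<open>k\<close>-th entry is the value of \<open>f\<close> at the \<open>k\<close>-th basis vector.\<close>

text \<open>A formal power series around the point \<open>p\<close> is a power series in \<open>t\<^sub>k = x\<^sub>k - p\<^sub>k\<close>, so
  the coordinate function \<open>x\<^sub>k\<close> is the series \<open>p\<^sub>k + t\<^sub>k\<close>.\<close>

definition formal_invariant ::
  "('n::finite \<Rightarrow> 'n \<Rightarrow> 'n \<Rightarrow> 'k::field) \<Rightarrow> 'k ^ 'n \<Rightarrow> ('k, 'n) mfps \<Rightarrow> bool" where
  "formal_invariant c p F \<longleftrightarrow> (\<forall>i. (\<Sum>j\<in>UNIV. \<Sum>k\<in>UNIV.
     mfps_const (c i j k) * (mfps_const (p $ k) + mfps_var k) * mfps_deriv j F) = 0)"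

text \<open>\<open>vec.dim\<close> of the set of rows is the rank of a matrix, as in \<open>row_rank_def_gen\<close>; here
  the number of rows is not a type, so the matrix itself is not formed. The Jacobian matrix of
  power series is taken over the field of fractions.\<close>

definition formally_independent :: "nat \<Rightarrow> (nat \<Rightarrow> ('k::field, 'n::finite) mfps) \<Rightarrow> bool" where
  "formally_independent r F \<longleftrightarrow>
     vec.dim ((\<lambda>a. (\<chi> j. Fract (mfps_deriv j (F a)) 1) :: ('k, 'n) mfps fract ^ 'n) ` {..<r}) = r"

definition number_of_formal_invariants :: "('n::finite \<Rightarrow> 'n \<Rightarrow> 'n \<Rightarrow> 'k::field) \<Rightarrow> nat" where
  "number_of_formal_invariants c = (GREATEST r. \<exists>p F.
     (\<forall>a<r. formal_invariant c p (F a)) \<and> formally_independent r F)"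

definition analytic_invariant ::
  "('n::finite \<Rightarrow> 'n \<Rightarrow> 'n \<Rightarrow> 'k::real_normed_field) \<Rightarrow> ('k ^ 'n) set \<Rightarrow> ('k ^ 'n \<Rightarrow> 'k) \<Rightarrow> bool"
  where
  "analytic_invariant c U F \<longleftrightarrow> analytic_on_space F U \<and>
     (\<forall>x\<in>U. \<forall>i. (\<Sum>j\<in>UNIV. \<Sum>k\<in>UNIV. c i j k * x $ k * partial_deriv j F x) = 0)"

text \<open>\<open>Generically\<close> means on a dense open subset of the common domain.\<close>

definition functionally_independent ::
  "nat \<Rightarrow> ('k::real_normed_field ^ 'n::finite) set \<Rightarrow> (nat \<Rightarrow> 'k ^ 'n \<Rightarrow> 'k) \<Rightarrow> bool" where
  "functionally_independent r U F \<longleftrightarrow> (\<exists>V. open V \<and> V \<subseteq> U \<and> U \<subseteq> closure V \<and>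
     (\<forall>x\<in>V. vec.dim ((\<lambda>a. \<chi> j. partial_deriv j (F a) x) ` {..<r}) = r))"

definition number_of_analytic_invariants ::
  "('n::finite \<Rightarrow> 'n \<Rightarrow> 'n \<Rightarrow> 'k::real_normed_field) \<Rightarrow> nat" where
  "number_of_analytic_invariants c = (GREATEST r. \<exists>U F. open U \<and> connected U \<and> U \<noteq> {} \<and>
     (\<forall>a<r. analytic_invariant c U (F a)) \<and> functionally_independent r U F)"

text \<open>The maxima are attained: the ranks are bounded by the number of variables.\<close>

lemma vec_dim_le: "vec.dim (A :: ('k::field ^ 'n::finite) set) \<le> CARD('n)"
  using vec.dim_subset_UNIV[of A] by (simp add: vec.dimension_def card_cart_basis)

lemma formally_independent_le:
  fixes F :: "nat \<Rightarrow> ('k::field, 'n::finite) mfps"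
  assumes "formally_independent r F"
  shows "r \<le> CARD('n)"
  using assms unfolding formally_independent_def by (metis vec_dim_le)

lemma functionally_independent_le:
  fixes F :: "nat \<Rightarrow> 'k::real_normed_field ^ 'n::finite \<Rightarrow> 'k"
  assumes "functionally_independent r U F" and "U \<noteq> {}"
  shows "r \<le> CARD('n)"
proof -
  obtain V where V: "U \<subseteq> closure V"
    and rank: "\<forall>x\<in>V. vec.dim ((\<lambda>a. \<chi> j. partial_deriv j (F a) x) ` {..<r}) = r"
    using assms(1) unfolding functionally_independent_def by blast
  have "V \<noteq> {}"
    using V assms(2) by auto
  then obtain x where "x \<in> V"
    by blast
  then have "vec.dim ((\<lambda>a. \<chi> j. partial_deriv j (F a) x) ` {..<r}) = r"
    using rank by blast
  then show ?thesis
    using vec_dim_le[of "(\<lambda>a. \<chi> j. partial_deriv j (F a) x) ` {..<r}"] by linarith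
qed

lemma number_of_formal_invariants_attained:
  "\<exists>p F. (\<forall>a<number_of_formal_invariants c. formal_invariant c p (F a)) \<and>
     formally_independent (number_of_formal_invariants c) F"
  unfolding number_of_formal_invariants_def
proof (rule GreatestI_nat[where k = 0 and P = "\<lambda>r. \<exists>p F. (\<forall>a<r. formal_invariant c p (F a)) \<and>
     formally_independent r F"])
  show "\<exists>p F. (\<forall>a<0. formal_invariant c p (F a)) \<and> formally_independent 0 F"
    by (simp add: formally_independent_def)
qed (use formally_independent_le in blast)

lemma number_of_analytic_invariants_attained:
  fixes c :: "'b::finite \<Rightarrow> 'b \<Rightarrow> 'b \<Rightarrow> 'a::real_normed_field"
  shows "\<exists>U F. open U \<and> connected U \<and> U \<noteq> {} \<and>
     (\<forall>a<number_of_analytic_invariants c. analytic_invariant c U (F a)) \<and>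
     functionally_independent (number_of_analytic_invariants c) U F"
  unfolding number_of_analytic_invariants_def
proof (rule GreatestI_nat[where k = 0 and P = "\<lambda>r. \<exists>U F. open U \<and> connected U \<and> U \<noteq> {} \<and>
     (\<forall>a<r. analytic_invariant c U (F a)) \<and> functionally_independent r U F"])
  have "functionally_independent 0 U F" if "open U" for U and F :: "nat \<Rightarrow> 'a ^ 'b \<Rightarrow> 'a"
    unfolding functionally_independent_def using that closure_subset[of U]
    by (intro exI[of _ U]) simp
  moreover have "open (ball (0 :: 'a ^ 'b) 1)" "connected (ball (0 :: 'a ^ 'b) 1)"
    by (simp_all add: convex_connected)
  ultimately show "\<exists>U F. open U \<and> connected U \<and> U \<noteq> {} \<and>
     (\<forall>a<0. analytic_invariant c U (F a)) \<and> functionally_independent 0 U F"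
    by (metis centre_in_ball empty_iff not_less0 zero_less_one)
qed (use functionally_independent_le in blast)


section \<open>Lie algebras\<close>

locale lie_algebra = vector_space smul
  for smul :: "'k::field \<Rightarrow> 'l::ab_group_add \<Rightarrow> 'l" +
  fixes bracket :: "'l \<Rightarrow> 'l \<Rightarrow> 'l"
  assumes linear_left: "\<And>y. Vector_Spaces.linear smul smul (\<lambda>x. bracket x y)"
    and linear_right: "\<And>x. Vector_Spaces.linear smul smul (bracket x)"
    and alternating: "\<And>x. bracket x x = 0"
    and jacobi: "\<And>x y z.
      bracket x (bracket y z) + bracket y (bracket z x) + bracket z (bracket x y) = 0"
begin

definition lie_subalgebra :: "'l set \<Rightarrow> bool" where
  "lie_subalgebra A \<longleftrightarrow> subspace A \<and> (\<forall>x\<in>A. \<forall>y\<in>A. bracket x y \<in> A)"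

definition lie_ideal :: "'l set \<Rightarrow> bool" where
  "lie_ideal A \<longleftrightarrow> subspace A \<and> (\<forall>x. \<forall>y\<in>A. bracket x y \<in> A)"

primrec derived_series :: "nat \<Rightarrow> 'l set \<Rightarrow> 'l set" where
  "derived_series 0 A = A"
| "derived_series (Suc n) A =
     span {bracket x y | x y. x \<in> derived_series n A \<and> y \<in> derived_series n A}"

definition solvable :: "'l set \<Rightarrow> bool" where
  "solvable A \<longleftrightarrow> (\<exists>n. derived_series n A = {0})"

definition is_radical :: "'l set \<Rightarrow> bool" where
  "is_radical A \<longleftrightarrow> lie_ideal A \<and> solvable A \<and> (\<forall>B. lie_ideal B \<and> solvable B \<longrightarrow> B \<subseteq> A)"

definition representation_on :: "'l set \<Rightarrow> 'l set \<Rightarrow> ('l \<Rightarrow> 'l \<Rightarrow> 'l) \<Rightarrow> bool" where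
  "representation_on S V \<pi> \<longleftrightarrow>
     (\<forall>s\<in>S. \<forall>v\<in>V. \<pi> s v \<in> V) \<and>
     (\<forall>s\<in>S. \<forall>v\<in>V. \<forall>w\<in>V. \<pi> s (v + w) = \<pi> s v + \<pi> s w) \<and>
     (\<forall>s\<in>S. \<forall>v\<in>V. \<forall>a. \<pi> s (smul a v) = smul a (\<pi> s v)) \<and>
     (\<forall>s\<in>S. \<forall>t\<in>S. \<forall>v\<in>V. \<pi> (s + t) v = \<pi> s v + \<pi> t v) \<and>
     (\<forall>s\<in>S. \<forall>v\<in>V. \<forall>a. \<pi> (smul a s) v = smul a (\<pi> s v)) \<and>
     (\<forall>s\<in>S. \<forall>t\<in>S. \<forall>v\<in>V. \<pi> (bracket s t) v = \<pi> s (\<pi> t v) - \<pi> t (\<pi> s v))"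

definition irreducible_on :: "'l set \<Rightarrow> 'l set \<Rightarrow> ('l \<Rightarrow> 'l \<Rightarrow> 'l) \<Rightarrow> bool" where
  "irreducible_on S V \<pi> \<longleftrightarrow> V \<noteq> {0} \<and>
     (\<forall>W. subspace W \<and> W \<subseteq> V \<and> (\<forall>s\<in>S. \<forall>w\<in>W. \<pi> s w \<in> W) \<longrightarrow> W = {0} \<or> W = V)"

definition semidirect_sum :: "'l set \<Rightarrow> 'l set \<Rightarrow> ('l \<Rightarrow> 'l \<Rightarrow> 'l) \<Rightarrow> bool" where
  "semidirect_sum S R \<pi> \<longleftrightarrow>
     lie_subalgebra S \<and> is_radical R \<and>
     S \<inter> R = {0} \<and> (\<forall>x. \<exists>s\<in>S. \<exists>v\<in>R. x = s + v) \<and>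
     representation_on S R \<pi> \<and> (\<forall>s\<in>S. \<forall>v\<in>R. bracket s v = \<pi> s v)"

definition is_basis :: "('n \<Rightarrow> 'l) \<Rightarrow> bool" where
  "is_basis e \<longleftrightarrow> inj e \<and> independent (range e) \<and> span (range e) = UNIV"

definition structure_constant :: "('n \<Rightarrow> 'l) \<Rightarrow> 'n \<Rightarrow> 'n \<Rightarrow> 'n \<Rightarrow> 'k" where
  "structure_constant e i j k = representation (range e) (bracket (e i) (e j)) (e k)"

end

definition sl2 :: "('k::field ^ 2 ^ 2) set" where
  "sl2 = {A. trace A = 0}"

definition is_sl2 ::
  "('k::field \<Rightarrow> 'l::ab_group_add \<Rightarrow> 'l) \<Rightarrow> ('l \<Rightarrow> 'l \<Rightarrow> 'l) \<Rightarrow> 'l set \<Rightarrow> bool" where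
  "is_sl2 smul bracket S \<longleftrightarrow> (\<exists>\<phi> :: 'k ^ 2 ^ 2 \<Rightarrow> 'l. bij_betw \<phi> sl2 S \<and>
     (\<forall>A\<in>sl2. \<forall>B\<in>sl2. \<phi> (A + B) = \<phi> A + \<phi> B) \<and>
     (\<forall>A\<in>sl2. \<forall>a. \<phi> (\<chi> i j. a * A $ i $ j) = smul a (\<phi> A)) \<and>
     (\<forall>A\<in>sl2. \<forall>B\<in>sl2. \<phi> (A ** B - B ** A) = bracket (\<phi> A) (\<phi> B)))"

text \<open>Finite-dimensionality is not listed: it follows from the existence of a basis indexed by a
  finite type, in terms of which the invariants are expressed.\<close>

locale sl2_semidirect_sum = lie_algebra smul bracket
  for smul :: "'k::field_char_0 \<Rightarrow> 'l::ab_group_add \<Rightarrow> 'l" and bracket +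
  fixes S R :: "'l set" and \<pi> :: "'l \<Rightarrow> 'l \<Rightarrow> 'l"
  assumes sl2: "is_sl2 smul bracket S"
    and semidirect_sum: "semidirect_sum S R \<pi>"
    and irreducible: "irreducible_on S R \<pi>"

end

theory Submission
  imports Defs
begin

text \<open>Irreducibility forces the radical \<open>R\<close> to be abelian: \<open>[R, R]\<close> is an \<open>S\<close>-invariant
  subspace, and it is not all of \<open>R\<close> because \<open>R\<close> is solvable (\<open>R_abelian\<close>). Hence \<open>L\<close> is the
  semi-direct product of \<open>sl(2)\<close> with an irreducible module, and over any field of characteristic
  zero such a module has a basis \<open>v\<^sub>0, \<dots>, v\<^sub>m\<close>, \<open>m = d - 1\<close>, with \<open>E v\<^sub>k = k v\<^bsub>k-1\<^esub>\<close>,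
  \<open>H v\<^sub>k = (m - 2k) v\<^sub>k\<close>, \<open>F v\<^sub>k = (m - k) v\<^bsub>k+1\<^esub>\<close> (\<open>adapted_basis_exists\<close>). In particular
  \<open>L\<close> has dimension \<open>m + 4\<close>.

  For the upper bound, the gradient of an invariant, taken at a point of \<open>L\<^sup>*\<close>, is an element of \<open>L\<close>
  whose bracket with every element of \<open>L\<close> is annihilated by that point. At a generic point no
  nonzero combination of certain elements of the adapted basis has this property: of \<open>E, F\<close> if
  \<open>m = 0\<close>, of \<open>E, H, v\<^sub>0, v\<^sub>1\<close> if \<open>m\<close> is \<open>1\<close> or \<open>2\<close>, of \<open>E, H, F, v\<^sub>0, v\<^sub>1, v\<^sub>2\<close> if \<open>m \<ge> 3\<close>. This
  leaves \<open>2\<close>, \<open>1\<close>, \<open>2\<close> and \<open>m - 2\<close> dimensions for the gradients (\<open>dim_annihilator_regular\<close>). In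
  the formal case the point is the generic one with coordinates \<open>p\<^sub>k + t\<^sub>k\<close> over the field of
  fractions of the power series; in the analytic case it is found inside the given open set.

  For the lower bound, that many invariants are exhibited. For \<open>m \<le> 2\<close> they are
  explicit polynomials. For \<open>m \<ge> 3\<close> they depend on the coordinates \<open>a\<^sub>k\<close> belonging to \<open>v\<^sub>k\<close> only and come from a moving
  frame: read \<open>a\<close> as the linear functional on binary forms of degree \<open>m\<close> with value \<open>a\<^sub>k\<close> on
  \<open>x\<^bsup>m-k\<^esup> y\<^sup>k\<close>, and choose linear forms \<open>X, Y\<close> of determinant \<open>1\<close>, depending on \<open>a\<close>, on which
  it is normalised: \<open>Y\<^sup>m\<close> and \<open>X\<^sup>2 Y\<^bsup>m-2\<^esup>\<close> have value \<open>0\<close> and \<open>X Y\<^bsup>m-1\<^esup>\<close> has value \<open>1\<close>. These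
  three conditions pin down the frame infinitesimally, so \<open>sl(2)\<close> moves the frame along with
  \<open>a\<close>, and all values on \<open>X\<^sup>j Y\<^bsup>m-j\<^esup>\<close> are invariant (\<open>frame_invariants\<close>). At the base point
  where \<open>a\<^bsub>m-1\<^esub> = 1\<close> and all other coordinates vanish, the value for \<open>j \<ge> 3\<close> has the same
  gradient as \<open>a\<^bsub>m-j\<^esub>\<close>, which gives \<open>m - 2\<close> independent invariants.

  The frame is obtained by lifting a simple root of a one-variable polynomial to a power series,
  three times (\<open>frame_exists\<close>). A simple root of a polynomial with convergent coefficients is
  itself convergent, so the same construction, carried out in an arbitrary ring of power series
  closed under simple roots (\<open>root_closed\<close>), serves the formal and the analytic count. Convergent
  formal invariants become analytic ones by summing the series.\<close>


section \<open>Coefficients of power series\<close>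

lemma mcoeff_simps [simp]:
  "mcoeff 0 m = 0" "mcoeff (F + G) m = mcoeff F m + mcoeff G m"
  "mcoeff (F - G) m = mcoeff F m - mcoeff G m" "mcoeff (- F) m = - mcoeff F m"
  for F G :: "('a::comm_ring_1, 'n::finite) mfps"
  by (simp_all add: zero_mfps_def plus_mfps_def minus_mfps_def uminus_mfps_def)

lemma mcoeff_sum [simp]:
  "mcoeff (\<Sum>i\<in>A. F i) m = (\<Sum>i\<in>A. mcoeff (F i :: ('a::comm_ring_1, 'n::finite) mfps) m)"
  by (induction A rule: infinite_finite_induct) auto

lemma mcoeff_const: "mcoeff (mfps_const c) m = (if m = (\<lambda>i. 0) then c else 0)"
  by (simp add: mfps_const_def)

lemma mcoeff_mult:
  "mcoeff (F * G) m = (\<Sum>(a, b)\<in>msplits m. mcoeff F a * mcoeff G b)"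
  for F G :: "('a::comm_ring_1, 'n::finite) mfps"
  by (simp add: times_mfps_def)

lemma one_eq_mfps_const: "1 = (mfps_const 1 :: ('a::comm_ring_1, 'n::finite) mfps)"
  by (simp add: one_mfps_def mfps_const_def)

lemma mcoeff_const_mult [simp]:
  "mcoeff (mfps_const c * F) m = c * mcoeff (F :: ('a::comm_ring_1, 'n::finite) mfps) m"
proof -
  have "mcoeff (mfps_const c * F) m = (\<Sum>(a, b)\<in>{(\<lambda>i. 0, m)}. mcoeff (mfps_const c :: ('a, 'n) mfps) a * mcoeff F b)"
    unfolding mcoeff_mult
    by (rule sum.mono_neutral_right[OF finite_msplits])
      (auto simp: msplits_def mcoeff_const fun_eq_iff split: if_splits)
  then show ?thesis by (simp add: mcoeff_const)
qed

lemma mfps_const_add: "mfps_const (a + b) = (mfps_const a + mfps_const b :: ('a::comm_ring_1, 'n::finite) mfps)"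
  and mfps_const_mult: "mfps_const (a * b) = (mfps_const a * mfps_const b :: ('a::comm_ring_1, 'n::finite) mfps)"
  and mfps_const_0 [simp]: "mfps_const 0 = (0 :: ('a::comm_ring_1, 'n::finite) mfps)"
  and mfps_const_1 [simp]: "mfps_const 1 = (1 :: ('a::comm_ring_1, 'n::finite) mfps)"
  and mfps_const_minus: "mfps_const (- a) = (- mfps_const a :: ('a::comm_ring_1, 'n::finite) mfps)"
  by (rule mfps_eqI; simp add: mcoeff_const one_eq_mfps_const)+

lemma mfps_const_of_nat: "mfps_const (of_nat k) = (of_nat k :: ('a::comm_ring_1, 'n::finite) mfps)"
  by (induction k) (simp_all add: mfps_const_add)

lemma mfps_const_eq_0_iff [simp]: "mfps_const c = (0 :: ('a::comm_ring_1, 'n::finite) mfps) \<longleftrightarrow> c = 0"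
proof
  assume "mfps_const c = (0 :: ('a, 'n) mfps)"
  then have "mcoeff (mfps_const c :: ('a, 'n) mfps) (\<lambda>i. 0) = 0" by simp
  then show "c = 0" by (simp add: mcoeff_const)
qed simp

instance mfps :: ("{comm_ring_1, ring_char_0}", finite) ring_char_0
proof
  show "inj (of_nat :: nat \<Rightarrow> ('a, 'b) mfps)"
  proof (rule injI)
    fix x y assume "of_nat x = (of_nat y :: ('a, 'b) mfps)"
    then have "mfps_const (of_nat x - of_nat y) = (0 :: ('a, 'b) mfps)"
      by (simp only: diff_conv_add_uminus mfps_const_add mfps_const_minus mfps_const_of_nat) simp
    then have "(of_nat x :: 'a) = of_nat y"
      by (simp only: mfps_const_eq_0_iff) simp
    then show "x = y" by simp
  qed
qed

lemma Fract_ne_0: "x \<noteq> 0 \<Longrightarrow> Fract x 1 \<noteq> 0"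
  by (metis One_fract_def Zero_fract_def eq_fract(1) mult_1 mult.right_neutral zero_neq_one)

lemma Fract_hom:
  "Fract (x + y) 1 = Fract x 1 + Fract y 1" "Fract (x * y) 1 = Fract x 1 * Fract y 1"
  "Fract 0 1 = 0" "Fract 1 1 = 1"
  by (simp_all add: Zero_fract_def One_fract_def)

lemma Fract_sum: "Fract (\<Sum>i\<in>A. f i) 1 = (\<Sum>i\<in>A. Fract (f i) 1)"
  by (induction A rule: infinite_finite_induct) (simp_all add: Fract_hom)


section \<open>Derivations and the filtration by order\<close>

lemma mcoeff_deriv:
  "mcoeff (mfps_deriv j F) m = of_nat (m j + 1) * mcoeff F (m(j := m j + 1))"
  by (simp add: mfps_deriv_def)

lemma mfps_deriv_add: "mfps_deriv j (F + G) = mfps_deriv j F + mfps_deriv j G"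
  for F G :: "('a::comm_ring_1, 'n::finite) mfps"
  by (rule mfps_eqI) (simp add: mcoeff_deriv algebra_simps)

lemma mfps_deriv_mult: "mfps_deriv j (F * G) = F * mfps_deriv j G + mfps_deriv j F * G"
  for F G :: "('a::comm_ring_1, 'n::finite) mfps"
proof (rule mfps_eqI)
  fix m :: "'n \<Rightarrow> nat"
  define m' where "m' = m(j := m j + 1)"
  have split: "of_nat (Suc (m j)) = (of_nat (a j) + of_nat (b j) :: 'a)" if "(a, b) \<in> msplits m'" for a b
  proof -
    have "Suc (m j) = a j + b j"
      using that unfolding msplits_def m'_def by (auto dest!: spec[of _ j])
    then show ?thesis by (metis of_nat_add)
  qed
  have half: "(\<Sum>(a, b)\<in>msplits m'. of_nat (a j) * mcoeff P a * mcoeff Q b)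
      = mcoeff (mfps_deriv j P * Q) m" for P Q :: "('a, 'n) mfps"
  proof -
    have "(\<Sum>(a, b)\<in>msplits m'. of_nat (a j) * mcoeff P a * mcoeff Q b)
        = (\<Sum>(a, b)\<in>{(a, b)\<in>msplits m'. a j > 0}. of_nat (a j) * mcoeff P a * mcoeff Q b)"
      by (rule sum.mono_neutral_right[OF finite_msplits]) (auto intro!: Nat.gr0I)
    also have "\<dots> = (\<Sum>(a, b)\<in>msplits m. mcoeff (mfps_deriv j P) a * mcoeff Q b)"
    proof (rule sum.reindex_bij_witness[where i = "\<lambda>(a, b). (a(j := a j + 1), b)"
            and j = "\<lambda>(a, b). (a(j := a j - 1), b)"])
      fix x assume x: "x \<in> msplits m"
      then show "(case x of (a, b) \<Rightarrow> (a(j := a j + 1), b)) \<in> {(a, b) \<in> msplits m'. 0 < a j}"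
        by (auto simp: msplits_def m'_def)
    next
      fix x assume x: "x \<in> {(a, b) \<in> msplits m'. 0 < a j}"
      obtain a b where ab: "x = (a, b)" by (cases x)
      have *: "\<forall>i. a i + b i = m' i" "0 < a j" using x by (auto simp: ab msplits_def)
      have "(a(j := a j - 1)) i + b i = m i" for i
        using *(1)[rule_format, of i] *(2) by (auto simp: m'_def split: if_splits)
      then show "(case x of (a, b) \<Rightarrow> (a(j := a j - 1), b)) \<in> msplits m"
        by (simp add: ab msplits_def)
    qed (auto simp: mcoeff_deriv simp del: of_nat_Suc of_nat_add)
    finally show ?thesis by (simp add: mcoeff_mult)
  qed
  have "mcoeff (mfps_deriv j (F * G)) m
      = (\<Sum>(a, b)\<in>msplits m'. of_nat (m j + 1) * (mcoeff F a * mcoeff G b))"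
    by (simp add: mcoeff_deriv mcoeff_mult m'_def sum_distrib_left case_prod_unfold del: of_nat_Suc of_nat_add)
  also have "\<dots> = (\<Sum>(a, b)\<in>msplits m'. of_nat (a j) * mcoeff F a * mcoeff G b
        + of_nat (b j) * mcoeff G b * mcoeff F a)"
    by (rule sum.cong) (auto simp: split algebra_simps simp del: of_nat_Suc of_nat_add)
  also have "\<dots> = (\<Sum>(a, b)\<in>msplits m'. of_nat (a j) * mcoeff F a * mcoeff G b)
        + (\<Sum>(a, b)\<in>msplits m'. of_nat (b j) * mcoeff G b * mcoeff F a)"
    by (simp add: sum.distrib case_prod_unfold)
  also have "(\<Sum>(a, b)\<in>msplits m'. of_nat (b j) * mcoeff G b * mcoeff F a)
      = (\<Sum>(a, b)\<in>msplits m'. of_nat (a j) * mcoeff G a * mcoeff F b)"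
    by (rule sum.reindex_bij_witness[where i = prod.swap and j = prod.swap])
      (auto simp: msplits_def add.commute)
  finally show "mcoeff (mfps_deriv j (F * G)) m = mcoeff (F * mfps_deriv j G + mfps_deriv j F * G) m"
    unfolding half by (simp add: mult.commute[of F])
qed

lemma mfps_deriv_const [simp]: "mfps_deriv j (mfps_const c) = (0 :: ('a::comm_ring_1, 'n::finite) mfps)"
proof (rule mfps_eqI)
  fix m :: "'n \<Rightarrow> nat"
  have "m(j := m j + 1) \<noteq> (\<lambda>i. 0)" by (metis Suc_eq_plus1 fun_upd_same nat.distinct(1))
  then show "mcoeff (mfps_deriv j (mfps_const c) :: ('a, 'n) mfps) m = mcoeff 0 m"
    by (simp add: mcoeff_deriv mcoeff_const)
qed

lemma mfps_deriv_var: "mfps_deriv j (mfps_var k) = (mfps_const (if j = k then 1 else 0) :: ('a::comm_ring_1, 'n::finite) mfps)"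
proof (rule mfps_eqI)
  fix m :: "'n \<Rightarrow> nat"
  have "m(j := m j + 1) = (\<lambda>i. if i = k then 1 else 0) \<longleftrightarrow> m = (\<lambda>i. 0) \<and> j = k"
  proof
    assume *: "m(j := m j + 1) = (\<lambda>i. if i = k then 1 else 0)"
    have jk: "j = k" and mj: "m j = 0"
      using fun_cong[OF *, of j] by (auto split: if_splits)
    have "m i = 0" for i using fun_cong[OF *, of i] jk mj by (cases "i = j") auto
    then show "m = (\<lambda>i. 0) \<and> j = k" using jk by auto
  qed auto
  then show "mcoeff (mfps_deriv j (mfps_var k) :: ('a, 'n) mfps) m
      = mcoeff (mfps_const (if j = k then 1 else 0)) m"
    by (auto simp: mcoeff_deriv mcoeff_const mfps_var_def)
qed

lemma mfps_deriv_sum: "mfps_deriv j (\<Sum>i\<in>A. F i) = (\<Sum>i\<in>A. mfps_deriv j (F i :: ('a::comm_ring_1, 'n::finite) mfps))"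
proof (induction A rule: infinite_finite_induct)
  case (insert x A)
  then show ?case by (simp add: mfps_deriv_add)
qed (simp_all add: mfps_deriv_const[of j 0, simplified])

definition mdeg :: "('n::finite \<Rightarrow> nat) \<Rightarrow> nat" where
  "mdeg m = (\<Sum>i\<in>UNIV. m i)"

lemma mdeg_msplits: "(a, b) \<in> msplits m \<Longrightarrow> mdeg a + mdeg b = mdeg m"
  unfolding msplits_def mdeg_def sum.distrib[symmetric] by simp

lemma mdeg_eq_0_iff: "mdeg m = 0 \<longleftrightarrow> m = (\<lambda>i. 0)"
  by (auto simp: mdeg_def fun_eq_iff)

lemma mdeg_upd: "mdeg (m(j := m j + 1)) = mdeg m + 1"
proof -
  have "mdeg (m(j := m j + 1)) = (\<Sum>i\<in>UNIV. m i + (if i = j then 1 else 0))"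
    unfolding mdeg_def by (rule sum.cong) auto
  then show ?thesis by (simp add: sum.distrib mdeg_def)
qed

text \<open>The ring homomorphism to the coefficients that evaluates a power series at its base point.\<close>

definition cst :: "('a, 'n) mfps \<Rightarrow> 'a" where
  "cst F = mcoeff F (\<lambda>i. 0)"

lemma msplits_0: "msplits (\<lambda>i. 0) = {(\<lambda>i. 0, \<lambda>i. 0)}"
  by (auto simp: msplits_def)

lemma cst_simps [simp]:
  "cst 0 = 0" "cst (F + G) = cst F + cst G" "cst (F - G) = cst F - cst G" "cst (- F) = - cst F"
  "cst (F * G) = cst F * cst G" "cst (mfps_const c) = c"
  for F G :: "('a::comm_ring_1, 'n::finite) mfps"
  by (simp_all add: cst_def mcoeff_mult msplits_0 mcoeff_const)

lemma cst_var [simp]: "cst (mfps_var k) = 0"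
  by (simp add: cst_def mfps_var_def fun_eq_iff)

lemma cst_1 [simp]: "cst (1 :: ('a::comm_ring_1, 'n::finite) mfps) = 1"
  by (metis cst_simps(6) mfps_const_1)

lemma cst_sum [simp]: "cst (\<Sum>i\<in>A. F i) = (\<Sum>i\<in>A. cst (F i :: ('a::comm_ring_1, 'n::finite) mfps))"
  by (simp add: cst_def)

lemma cst_power [simp]: "cst (F ^ n) = cst (F :: ('a::comm_ring_1, 'n::finite) mfps) ^ n"
  by (induction n) simp_all

lemma cst_of_nat [simp]: "cst (of_nat n :: ('a::comm_ring_1, 'n::finite) mfps) = of_nat n"
  by (metis cst_simps(6) mfps_const_of_nat)

text \<open>These sets are the powers of the maximal ideal. A power series is determined by its residues
  modulo all of them, which is how identities obtained by successive approximation are concluded.\<close>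

definition order_ge :: "nat \<Rightarrow> ('a::zero, 'n::finite) mfps \<Rightarrow> bool" where
  "order_ge n F \<longleftrightarrow> (\<forall>m. mdeg m < n \<longrightarrow> mcoeff F m = 0)"

lemma order_ge_0 [simp]: "order_ge 0 F" "order_ge n (0 :: ('a::comm_ring_1, 'n::finite) mfps)"
  by (simp_all add: order_ge_def)

lemma order_ge_1_iff: "order_ge 1 F \<longleftrightarrow> cst F = 0"
  by (auto simp: order_ge_def cst_def mdeg_eq_0_iff)

lemma order_ge_mono: "order_ge n F \<Longrightarrow> k \<le> n \<Longrightarrow> order_ge k F"
  by (auto simp: order_ge_def)

lemma order_ge_add: "order_ge n F \<Longrightarrow> order_ge n G \<Longrightarrow> order_ge n (F + G)"
  and order_ge_diff: "order_ge n F \<Longrightarrow> order_ge n G \<Longrightarrow> order_ge n (F - G)"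
  and order_ge_minus: "order_ge n F \<Longrightarrow> order_ge n (- F)"
  for F G :: "('a::comm_ring_1, 'n::finite) mfps"
  by (simp_all add: order_ge_def)

lemma order_ge_sum: "(\<And>i. i \<in> A \<Longrightarrow> order_ge n (F i)) \<Longrightarrow> order_ge n (\<Sum>i\<in>A. F i)"
  for F :: "'i \<Rightarrow> ('a::comm_ring_1, 'n::finite) mfps"
  by (simp add: order_ge_def)

lemma order_ge_mult:
  fixes F G :: "('a::comm_ring_1, 'n::finite) mfps"
  assumes "order_ge k F" "order_ge l G"
  shows "order_ge (k + l) (F * G)"
  unfolding order_ge_def
proof (intro allI impI)
  fix m :: "'n \<Rightarrow> nat" assume m: "mdeg m < k + l"
  have "mcoeff F a * mcoeff G b = 0" if "(a, b) \<in> msplits m" for a b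
  proof -
    have "mdeg a < k \<or> mdeg b < l" using mdeg_msplits[OF that] m by linarith
    then show ?thesis using assms by (auto simp: order_ge_def)
  qed
  then show "mcoeff (F * G) m = 0"
    by (auto simp: mcoeff_mult intro!: sum.neutral)
qed

lemma order_ge_mult_left: "order_ge n G \<Longrightarrow> order_ge n (F * G)"
  for F G :: "('a::comm_ring_1, 'n::finite) mfps"
  using order_ge_mult[of 0 F n G] by simp

lemma order_ge_all_imp_0: "(\<And>n. order_ge n F) \<Longrightarrow> F = 0"
  for F :: "('a::comm_ring_1, 'n::finite) mfps"
proof (rule mfps_eqI)
  fix m :: "'n \<Rightarrow> nat" assume "\<And>n. order_ge n F"
  then have "order_ge (Suc (mdeg m)) F" .
  then show "mcoeff F m = mcoeff 0 m" by (simp add: order_ge_def)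
qed

lemma order_ge_power: "order_ge 1 F \<Longrightarrow> order_ge k (F ^ k)"
  for F :: "('a::comm_ring_1, 'n::finite) mfps"
proof (induction k)
  case (Suc k)
  then show ?case using order_ge_mult[of 1 F k "F ^ k"] by simp
qed simp

lemma cst_deriv_order_2: "order_ge 2 F \<Longrightarrow> cst (mfps_deriv j F) = 0"
proof -
  assume F: "order_ge 2 F"
  have "mdeg ((\<lambda>i. 0)(j := 0 + 1)) = 1"
    by (simp add: mdeg_def fun_upd_def)
  then show ?thesis using F by (simp add: order_ge_def cst_def mcoeff_deriv)
qed


section \<open>Simple roots of polynomials over power series\<close>

lemma power_diff_order_ge:
  fixes r s :: "('a::comm_ring_1, 'n::finite) mfps"
  assumes "order_ge n (r - s)" "order_ge 1 r" "order_ge 1 s" "k \<ge> 2"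
  shows "order_ge (Suc n) (r ^ k - s ^ k)"
proof -
  obtain l where k: "k = Suc (Suc l)" using assms(4) by (metis add_2_eq_Suc le_Suc_ex)
  have "order_ge 1 (\<Sum>p<Suc (Suc l). r ^ p * s ^ (Suc l - p))"
  proof (rule order_ge_sum)
    fix p assume "p \<in> {..<Suc (Suc l)}"
    then have "order_ge (p + (Suc l - p)) (r ^ p * s ^ (Suc l - p))"
      by (intro order_ge_mult order_ge_power assms)
    then show "order_ge 1 (r ^ p * s ^ (Suc l - p))"
      using \<open>p \<in> _\<close> by (elim order_ge_mono) auto
  qed
  from order_ge_mult[OF assms(1) this] show ?thesis
    by (simp add: k power_diff_sumr2 mult.commute del: power_Suc sum.lessThan_Suc)
qed

definition root_step :: "(nat \<Rightarrow> ('a, 'n) mfps) \<Rightarrow> nat \<Rightarrow> ('a, 'n) mfps \<Rightarrow> ('a::comm_ring_1, 'n::finite) mfps" where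
  "root_step B N r = (\<Sum>k\<le>N. B k * r ^ k)"

text \<open>When the two lowest coefficients have no constant term, the polynomial map is a contraction for
  the adic topology: it raises the order of a difference by one. Its iterates therefore stabilise
  coefficientwise, the coefficient at \<open>m\<close> after \<open>mdeg m + 1\<close> steps, and the limit is a fixed point.\<close>

lemma fixpoint_of_contracting_polynomial:
  fixes B :: "nat \<Rightarrow> ('a::comm_ring_1, 'n::finite) mfps" and N :: nat
  assumes B: "order_ge 1 (B 0)" "order_ge 1 (B 1)"
  defines "r \<equiv> Abs_mfps (\<lambda>m. mcoeff ((root_step B N ^^ Suc (mdeg m)) 0) m)"
  shows "order_ge n (r - (root_step B N ^^ n) 0)" and "root_step B N r = r" and "order_ge 1 r"
proof -
  define G where "G = root_step B N"
  define s where "s n = (G ^^ n) 0" for n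
  have s_simps: "s 0 = 0" "s (Suc n) = G (s n)" for n by (simp_all add: s_def)
  have contract: "order_ge (Suc n) (G x - G y)" if "order_ge n (x - y)" "order_ge 1 x" "order_ge 1 y" for n x y
  proof -
    have "order_ge (Suc n) (B k * x ^ k - B k * y ^ k)" for k
    proof (cases "k \<ge> 2")
      case True
      show ?thesis
        using order_ge_mult_left[OF power_diff_order_ge[OF that True], of "B k"]
        by (simp only: right_diff_distrib)
    next
      case False
      then consider "k = 0" | "k = 1" by linarith
      then show ?thesis
      proof cases
        case 2
        then show ?thesis
          using order_ge_mult[OF B(2) that(1)] by (simp add: right_diff_distrib)
      qed simp
    qed
    then show ?thesis unfolding G_def root_step_def sum_subtractf[symmetric] by (intro order_ge_sum)
  qed
  have pres: "order_ge 1 (G x)" if "order_ge 1 x" for x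
  proof -
    have "order_ge 1 (B k * x ^ k)" for k
    proof (cases k)
      case (Suc l)
      have "order_ge 1 (x ^ k)"
        by (rule order_ge_mono[OF order_ge_power[OF that]]) (simp add: Suc)
      then show ?thesis by (rule order_ge_mult_left)
    qed (use B(1) in simp)
    then show ?thesis unfolding G_def root_step_def by (intro order_ge_sum)
  qed
  have s1: "order_ge 1 (s n)" for n by (induction n) (use pres in \<open>simp_all add: s_simps\<close>)
  have step: "order_ge n (s (Suc n) - s n)" for n
  proof (induction n)
    case (Suc n)
    from contract[OF this s1 s1] show ?case by (simp add: s_simps)
  qed simp
  have cauchy: "order_ge n (s (n + k) - s n)" for n k
  proof (induction k)
    case (Suc k)
    have "order_ge n (s (Suc (n + k)) - s (n + k))"
      by (rule order_ge_mono[OF step]) simp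
    from order_ge_add[OF this Suc] show ?case by simp
  qed simp
  have r: "order_ge n (r - s n)" for n
    unfolding order_ge_def
  proof (intro allI impI)
    fix m :: "'n \<Rightarrow> nat" assume "mdeg m < n"
    then obtain k where "n = Suc (mdeg m) + k" by (metis Suc_leI le_Suc_ex)
    with cauchy[of "Suc (mdeg m)" k] show "mcoeff (r - s n) m = 0"
      unfolding r_def order_ge_def s_def G_def by (auto simp del: funpow.simps)
  qed
  show r1: "order_ge 1 r" using order_ge_add[OF r[of 1] s1[of 1]] by simp
  have "order_ge n (G r - r)" for n
  proof -
    have "order_ge (Suc n) (G r - s (Suc n))" using contract[OF r[of n] r1 s1] by (simp add: s_simps)
    from order_ge_diff[OF this r[of "Suc n"]] have "order_ge (Suc n) (G r - r)" by simp
    then show ?thesis by (rule order_ge_mono) simp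
  qed
  then show "root_step B N r = r" using order_ge_all_imp_0[of "G r - r"] by (simp add: G_def)
  show "order_ge n (r - (root_step B N ^^ n) 0)" using r by (simp add: s_def G_def)
qed


text \<open>The root is a definite series rather than a chosen one, so that its convergence can be stated
  separately. Dividing by the constant term of \<open>A 1\<close> turns \<open>\<Sum> A\<^sub>k r\<^sup>k = 0\<close> into a fixed point equation
  for \<open>r\<close> of the contracting kind.\<close>

definition simple_root ::
  "(nat \<Rightarrow> ('k::field, 'n::finite) mfps) \<Rightarrow> nat \<Rightarrow> ('k, 'n) mfps" where
  "simple_root A N = (let u = mfps_const (inverse (cst (A 1)));
     B = (\<lambda>k. if k = 1 then 1 - u * A 1 else - (u * A k)) in
   Abs_mfps (\<lambda>m. mcoeff ((root_step B N ^^ Suc (mdeg m)) 0) m))"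

lemma simple_root:
  fixes A :: "nat \<Rightarrow> ('k::field, 'n::finite) mfps"
  assumes A: "cst (A 0) = 0" "cst (A 1) \<noteq> 0" and N: "1 \<le> N"
  shows "cst (simple_root A N) = 0" and "(\<Sum>k\<le>N. A k * simple_root A N ^ k) = 0"
proof -
  define u :: "('k, 'n) mfps" where "u = mfps_const (inverse (cst (A 1)))"
  define B where "B k = (if k = 1 then 1 - u * A 1 else - (u * A k))" for k
  define r where "r = simple_root A N"
  have r_def': "r = Abs_mfps (\<lambda>m. mcoeff ((root_step B N ^^ Suc (mdeg m)) 0) m)"
    unfolding r_def simple_root_def Let_def u_def[symmetric] B_def[abs_def] ..
  have "order_ge 1 (B 0)" "order_ge 1 (B 1)"
    unfolding order_ge_1_iff using A by (simp_all add: B_def u_def)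
  from fixpoint_of_contracting_polynomial(2,3)[OF this, of N, folded r_def']
  have fix_r: "root_step B N r = r" and "cst r = 0"
    by (simp_all only: order_ge_1_iff)
  then show "cst (simple_root A N) = 0" by (simp add: r_def)
  have "root_step B N r = (\<Sum>k\<le>N. (if k = 1 then r else 0) - u * (A k * r ^ k))"
    unfolding root_step_def by (rule sum.cong) (auto simp: B_def algebra_simps)
  also have "\<dots> = r - u * (\<Sum>k\<le>N. A k * r ^ k)"
    using N by (simp add: sum_subtractf sum_distrib_left)
  finally have "u * (\<Sum>k\<le>N. A k * r ^ k) = 0" using fix_r by simp
  moreover have "u \<noteq> 0" using A by (simp add: u_def)
  ultimately show "(\<Sum>k\<le>N. A k * simple_root A N ^ k) = 0" by (simp add: r_def)
qed

text \<open>Division by a series \<open>c\<close> with invertible constant term is included: it is the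
  extraction of a root of a linear polynomial.\<close>

locale root_closed =
  fixes C :: "('k::field, 'n::finite) mfps set"
  assumes const_closed [simp]: "mfps_const c \<in> C"
    and var_closed [simp]: "mfps_var j \<in> C"
    and add_closed [intro, simp]: "F \<in> C \<Longrightarrow> G \<in> C \<Longrightarrow> F + G \<in> C"
    and mult_closed [intro, simp]: "F \<in> C \<Longrightarrow> G \<in> C \<Longrightarrow> F * G \<in> C"
    and simple_root_closed: "(\<And>k. k \<le> N \<Longrightarrow> A k \<in> C) \<Longrightarrow> 1 \<le> N \<Longrightarrow>
      cst (A 0) = 0 \<Longrightarrow> cst (A 1) \<noteq> 0 \<Longrightarrow> simple_root A N \<in> C"
begin

lemma minus_closed [intro, simp]: "F \<in> C \<Longrightarrow> - F \<in> C"
  using mult_closed[OF const_closed[of "-1"], of F] by (simp add: mfps_const_minus del: const_closed)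

lemma diff_closed [intro, simp]: "F \<in> C \<Longrightarrow> G \<in> C \<Longrightarrow> F - G \<in> C"
  unfolding diff_conv_add_uminus by blast

lemma zero_closed [simp]: "0 \<in> C" and one_closed [simp]: "1 \<in> C" and of_nat_closed [simp]: "of_nat l \<in> C"
  using const_closed[of 0] const_closed[of 1] const_closed[of "of_nat l"]
  by (simp_all add: mfps_const_of_nat)

lemma power_closed [intro, simp]: "F \<in> C \<Longrightarrow> F ^ l \<in> C"
  by (induction l) simp_all

lemma sum_closed [intro, simp]: "(\<And>i. i \<in> I \<Longrightarrow> F i \<in> C) \<Longrightarrow> (\<Sum>i\<in>I. F i) \<in> C"
  by (induction I rule: infinite_finite_induct) simp_all

end

interpretation formal: root_closed UNIV
  by unfold_locales simp_all


section \<open>Convergent power series\<close>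

text \<open>\<open>mbound \<rho> M F\<close> says that the weighted \<open>\<ell>\<^sup>1\<close>-norm of \<open>F\<close> on the polydisc of radius \<open>\<rho>\<close> is at most
  \<open>M\<close>. Stated through finite partial sums, the bound passes to coefficientwise limits.\<close>

definition mbound :: "real \<Rightarrow> real \<Rightarrow> ('k::real_normed_field, 'n::finite) mfps \<Rightarrow> bool" where
  "mbound \<rho> M F \<longleftrightarrow> (\<forall>A. finite A \<longrightarrow> (\<Sum>m\<in>A. norm (mcoeff F m) * \<rho> ^ mdeg m) \<le> M)"

definition convergent_series :: "('k::real_normed_field, 'n::finite) mfps \<Rightarrow> bool" where
  "convergent_series F \<longleftrightarrow> (\<exists>\<rho>>0. \<exists>M. mbound \<rho> M F)"

lemma mboundD: "mbound \<rho> M F \<Longrightarrow> finite A \<Longrightarrow> (\<Sum>m\<in>A. norm (mcoeff F m) * \<rho> ^ mdeg m) \<le> M"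
  by (simp add: mbound_def)

lemma mbound_nonneg: "mbound \<rho> M F \<Longrightarrow> 0 \<le> M"
  using mboundD[of \<rho> M F "{}"] by simp

lemma mbound_mono: "mbound \<rho> M F \<Longrightarrow> M \<le> M' \<Longrightarrow> mbound \<rho> M' F"
  unfolding mbound_def by (meson order_trans)

lemma mbound_finite_support:
  fixes F :: "('k::real_normed_field, 'b::finite) mfps"
  assumes "finite S" "\<And>m. m \<notin> S \<Longrightarrow> mcoeff F m = 0" "0 \<le> \<rho>"
  shows "mbound \<rho> (\<Sum>m\<in>S. norm (mcoeff F m) * \<rho> ^ mdeg m) F"
  unfolding mbound_def
proof (intro allI impI)
  fix A :: "('b \<Rightarrow> nat) set" assume A: "finite A"
  have "(\<Sum>m\<in>A. norm (mcoeff F m) * \<rho> ^ mdeg m) = (\<Sum>m\<in>A \<inter> S. norm (mcoeff F m) * \<rho> ^ mdeg m)"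
    by (rule sum.mono_neutral_right[OF A]) (use assms(2) in auto)
  also have "\<dots> \<le> (\<Sum>m\<in>S. norm (mcoeff F m) * \<rho> ^ mdeg m)"
    by (rule sum_mono2) (use assms in auto)
  finally show "(\<Sum>m\<in>A. norm (mcoeff F m) * \<rho> ^ mdeg m) \<le> \<dots>" .
qed

lemma mbound_add:
  assumes "mbound \<rho> M F" "mbound \<rho> N G" "0 \<le> \<rho>"
  shows "mbound \<rho> (M + N) (F + G)"
  unfolding mbound_def
proof (intro allI impI)
  fix A :: "('b \<Rightarrow> nat) set" assume A: "finite A"
  have "(\<Sum>m\<in>A. norm (mcoeff (F + G) m) * \<rho> ^ mdeg m)
      \<le> (\<Sum>m\<in>A. norm (mcoeff F m) * \<rho> ^ mdeg m + norm (mcoeff G m) * \<rho> ^ mdeg m)"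
    by (rule sum_mono) (use assms(3) norm_triangle_ineq in \<open>auto simp flip: distrib_right intro!: mult_right_mono\<close>)
  also have "\<dots> \<le> M + N"
    unfolding sum.distrib by (intro add_mono mboundD assms A)
  finally show "(\<Sum>m\<in>A. norm (mcoeff (F + G) m) * \<rho> ^ mdeg m) \<le> M + N" .
qed

lemma mbound_mult:
  fixes F G :: "('k::real_normed_field, 'n::finite) mfps"
  assumes "mbound \<rho> M F" "mbound \<rho> N G" "0 \<le> \<rho>"
  shows "mbound \<rho> (M * N) (F * G)"
  unfolding mbound_def
proof (intro allI impI)
  fix A :: "('n \<Rightarrow> nat) set" assume A: "finite A"
  define f g where "f m = norm (mcoeff F m) * \<rho> ^ mdeg m" and "g m = norm (mcoeff G m) * \<rho> ^ mdeg m" for m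
  have nonneg: "0 \<le> f m" "0 \<le> g m" for m using assms(3) by (simp_all add: f_def g_def)
  define P where "P = (\<Union>m\<in>A. msplits m)"
  have P: "finite P" using A finite_msplits by (auto simp: P_def)
  have disj: "msplits m \<inter> msplits m' = {}" if "m \<noteq> m'" for m m' :: "'n \<Rightarrow> nat"
    using that by (auto simp: msplits_def fun_eq_iff)
  have "norm (mcoeff (F * G) m) * \<rho> ^ mdeg m \<le> (\<Sum>(a, b)\<in>msplits m. f a * g b)" for m
  proof -
    have "norm (mcoeff (F * G) m) \<le> (\<Sum>(a, b)\<in>msplits m. norm (mcoeff F a) * norm (mcoeff G b))"
      unfolding mcoeff_mult by (rule order_trans[OF norm_sum]) (simp add: case_prod_unfold norm_mult)
    then have "norm (mcoeff (F * G) m) * \<rho> ^ mdeg m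
        \<le> (\<Sum>(a, b)\<in>msplits m. norm (mcoeff F a) * norm (mcoeff G b)) * \<rho> ^ mdeg m"
      using assms(3) by (intro mult_right_mono) auto
    also have "\<dots> = (\<Sum>(a, b)\<in>msplits m. f a * g b)"
      unfolding sum_distrib_right
    proof (rule sum.cong[OF refl], clarify)
      fix a b assume "(a, b) \<in> msplits m"
      from mdeg_msplits[OF this]
      show "norm (mcoeff F a) * norm (mcoeff G b) * \<rho> ^ mdeg m = f a * g b"
        by (simp add: f_def g_def power_add flip: \<open>mdeg a + mdeg b = mdeg m\<close>)
    qed
    finally show ?thesis .
  qed
  then have "(\<Sum>m\<in>A. norm (mcoeff (F * G) m) * \<rho> ^ mdeg m) \<le> (\<Sum>m\<in>A. \<Sum>(a, b)\<in>msplits m. f a * g b)"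
    by (rule sum_mono)
  also have "\<dots> = (\<Sum>(a, b)\<in>P. f a * g b)"
    unfolding P_def by (rule sum.UNION_disjoint[symmetric]) (use A finite_msplits disj in auto)
  also have "\<dots> \<le> (\<Sum>(a, b)\<in>fst ` P \<times> snd ` P. f a * g b)"
    by (rule sum_mono2) (use P nonneg in \<open>force+\<close>)
  also have "\<dots> = (\<Sum>a\<in>fst ` P. f a) * (\<Sum>b\<in>snd ` P. g b)"
    by (simp add: sum_product sum.cartesian_product)
  also have "\<dots> \<le> M * N"
    unfolding f_def g_def
    by (intro mult_mono mboundD assms sum_nonneg mbound_nonneg[OF assms(1)] finite_imageI P) (use assms(3) in auto)
  finally show "(\<Sum>m\<in>A. norm (mcoeff (F * G) m) * \<rho> ^ mdeg m) \<le> M * N" .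
qed

lemma mbound_const: "0 \<le> \<rho> \<Longrightarrow> mbound \<rho> (norm c) (mfps_const c :: ('k::real_normed_field, 'n::finite) mfps)"
proof -
  assume \<rho>: "0 \<le> \<rho>"
  have "mbound \<rho> (\<Sum>m\<in>{\<lambda>i. 0}. norm (mcoeff (mfps_const c :: ('k, 'n) mfps) m) * \<rho> ^ mdeg m) (mfps_const c :: ('k, 'n) mfps)"
    by (rule mbound_finite_support[OF _ _ \<rho>]) (auto simp: mcoeff_const)
  then show ?thesis by (simp add: mcoeff_const mdeg_def)
qed

lemma mbound_power: "mbound \<rho> M F \<Longrightarrow> 0 \<le> \<rho> \<Longrightarrow> mbound \<rho> (M ^ k) (F ^ k)"
proof (induction k)
  case 0
  then show ?case using mbound_const[of \<rho> 1] by simp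
next
  case (Suc k)
  then show ?case by (simp add: mbound_mult)
qed

lemma mbound_zero: "mbound \<rho> 0 0"
  by (simp add: mbound_def)

lemma mbound_sum:
  assumes "\<And>i. i \<in> I \<Longrightarrow> mbound \<rho> (M i) (F i)" "0 \<le> \<rho>"
  shows "mbound \<rho> (\<Sum>i\<in>I. M i) (\<Sum>i\<in>I. F i)"
  using assms
  by (induction I rule: infinite_finite_induct) (simp_all add: mbound_zero mbound_add)

text \<open>The gain of a factor \<open>\<theta>\<close> for series without constant term is what makes the contraction argument
  for roots work on a small polydisc.\<close>

lemma mbound_shrink:
  assumes "mbound \<rho> M F" "0 \<le> \<theta>" "\<theta> \<le> 1" "0 \<le> \<rho>"
  shows "mbound (\<theta> * \<rho>) M F" and "cst F = 0 \<Longrightarrow> mbound (\<theta> * \<rho>) (\<theta> * M) F"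
proof -
  show "mbound (\<theta> * \<rho>) M F"
    unfolding mbound_def
  proof (intro allI impI)
    fix A :: "('b \<Rightarrow> nat) set" assume A: "finite A"
    have "(\<Sum>m\<in>A. norm (mcoeff F m) * (\<theta> * \<rho>) ^ mdeg m) \<le> (\<Sum>m\<in>A. norm (mcoeff F m) * \<rho> ^ mdeg m)"
      using assms by (intro sum_mono mult_left_mono power_mono) (auto simp: mult_left_le_one_le)
    with mboundD[OF assms(1) A] show "(\<Sum>m\<in>A. norm (mcoeff F m) * (\<theta> * \<rho>) ^ mdeg m) \<le> M" by simp
  qed
  assume F: "cst F = 0"
  show "mbound (\<theta> * \<rho>) (\<theta> * M) F"
    unfolding mbound_def
  proof (intro allI impI)
    fix A :: "('b \<Rightarrow> nat) set" assume A: "finite A"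
    have "norm (mcoeff F m) * (\<theta> * \<rho>) ^ mdeg m \<le> \<theta> * (norm (mcoeff F m) * \<rho> ^ mdeg m)" for m
    proof (cases "mdeg m")
      case 0
      then show ?thesis using F by (simp add: mdeg_eq_0_iff cst_def)
    next
      case (Suc k)
      have "\<theta> ^ mdeg m \<le> \<theta>" unfolding Suc using assms by (simp add: mult_left_le power_le_one)
      from mult_left_mono[OF this, of "norm (mcoeff F m) * \<rho> ^ mdeg m"] assms(4)
      show ?thesis by (simp add: power_mult_distrib mult_ac)
    qed
    then have "(\<Sum>m\<in>A. norm (mcoeff F m) * (\<theta> * \<rho>) ^ mdeg m) \<le> \<theta> * (\<Sum>m\<in>A. norm (mcoeff F m) * \<rho> ^ mdeg m)"
      unfolding sum_distrib_left by (rule sum_mono)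
    also have "\<dots> \<le> \<theta> * M" by (intro mult_left_mono mboundD[OF assms(1) A] assms)
    finally show "(\<Sum>m\<in>A. norm (mcoeff F m) * (\<theta> * \<rho>) ^ mdeg m) \<le> \<theta> * M" .
  qed
qed

lemma mbound_radius_mono: "mbound \<rho> M F \<Longrightarrow> 0 < \<rho> \<Longrightarrow> 0 \<le> \<sigma> \<Longrightarrow> \<sigma> \<le> \<rho> \<Longrightarrow> mbound \<sigma> M F"
  using mbound_shrink(1)[of \<rho> M F "\<sigma> / \<rho>"] by simp

text \<open>Halving the radius pays for the factor \<open>m\<^sub>j + 1\<close>, since \<open>k + 1 \<le> 2\<^sup>k\<close>.\<close>

lemma mbound_deriv:
  assumes "mbound \<rho> M F" "0 < \<rho>"
  shows "mbound (\<rho> / 2) (M / \<rho>) (mfps_deriv j F)"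
  unfolding mbound_def
proof (intro allI impI)
  fix A :: "('b \<Rightarrow> nat) set" assume A: "finite A"
  define s where "s m = m(j := m j + 1)" for m :: "'b \<Rightarrow> nat"
  have inj: "inj_on s A"
    by (rule inj_on_inverseI[of _ "\<lambda>m. m(j := m j - 1)"]) (simp add: s_def)
  have "norm (mcoeff (mfps_deriv j F) m) * (\<rho> / 2) ^ mdeg m \<le> norm (mcoeff F (s m)) * \<rho> ^ mdeg (s m) / \<rho>" for m
  proof -
    have "m j \<le> mdeg m" unfolding mdeg_def by (rule member_le_sum) auto
    moreover have "Suc (mdeg m) \<le> 2 ^ mdeg m" using less_exp[of "mdeg m"] by (simp only: Suc_le_eq)
    ultimately have "Suc (m j) \<le> 2 ^ mdeg m" by linarith
    then have le: "real (Suc (m j)) \<le> 2 ^ mdeg m"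
      by (metis of_nat_le_iff of_nat_numeral of_nat_power)
    have "norm (mcoeff (mfps_deriv j F) m) * (\<rho> / 2) ^ mdeg m
        = real (Suc (m j)) / 2 ^ mdeg m * (norm (mcoeff F (s m)) * \<rho> ^ mdeg m)"
      by (simp add: mcoeff_deriv s_def norm_mult power_divide del: of_nat_Suc)
    also have "\<dots> \<le> 1 * (norm (mcoeff F (s m)) * \<rho> ^ mdeg m)"
      using le assms(2) by (intro mult_right_mono) (auto simp del: of_nat_Suc)
    also have "\<dots> = norm (mcoeff F (s m)) * \<rho> ^ mdeg (s m) / \<rho>"
      unfolding s_def mdeg_upd using assms(2) by simp
    finally show ?thesis .
  qed
  then have "(\<Sum>m\<in>A. norm (mcoeff (mfps_deriv j F) m) * (\<rho> / 2) ^ mdeg m)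
      \<le> (\<Sum>m\<in>A. norm (mcoeff F (s m)) * \<rho> ^ mdeg (s m)) / \<rho>"
    unfolding sum_divide_distrib by (rule sum_mono)
  also have "(\<Sum>m\<in>A. norm (mcoeff F (s m)) * \<rho> ^ mdeg (s m)) = (\<Sum>m\<in>s ` A. norm (mcoeff F m) * \<rho> ^ mdeg m)"
    by (simp add: sum.reindex[OF inj])
  also have "\<dots> \<le> M" by (rule mboundD[OF assms(1)]) (use A in simp)
  finally show "(\<Sum>m\<in>A. norm (mcoeff (mfps_deriv j F) m) * (\<rho> / 2) ^ mdeg m) \<le> M / \<rho>"
    using assms(2) by (simp add: divide_right_mono)
qed

text \<open>Every finite partial sum of the norm of a limit is a partial sum of the norm of an approximant.\<close>

lemma mbound_limit:
  assumes "\<And>n. mbound \<rho> M (G n)" "\<And>n. order_ge n (F - G n)"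
  shows "mbound \<rho> M F"
  unfolding mbound_def
proof (intro allI impI)
  fix A :: "('b \<Rightarrow> nat) set" assume A: "finite A"
  obtain n where n: "\<forall>k\<in>mdeg ` A. k < n"
    using finite_nat_set_iff_bounded[of "mdeg ` A"] A by blast
  have eq: "mcoeff F m = mcoeff (G n) m" if "m \<in> A" for m
    using assms(2)[of n] n that by (auto simp: order_ge_def)
  have "(\<Sum>m\<in>A. norm (mcoeff F m) * \<rho> ^ mdeg m) = (\<Sum>m\<in>A. norm (mcoeff (G n) m) * \<rho> ^ mdeg m)"
    by (rule sum.cong) (simp_all add: eq)
  also have "\<dots> \<le> M" by (rule mboundD[OF assms(1) A])
  finally show "(\<Sum>m\<in>A. norm (mcoeff F m) * \<rho> ^ mdeg m) \<le> M" .
qed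

lemma convergent_series_common_bound:
  assumes "finite I" "\<And>i. i \<in> I \<Longrightarrow> convergent_series (F i)"
  shows "\<exists>\<rho>>0. \<exists>M\<ge>1. \<forall>i\<in>I. mbound \<rho> M (F i)"
  using assms
proof (induction I rule: finite_induct)
  case empty
  show ?case by (intro exI[of _ 1]) auto
next
  case (insert i I)
  then obtain \<rho> M where 1: "0 < \<rho>" "1 \<le> M" "\<forall>i\<in>I. mbound \<rho> M (F i)" by blast
  obtain \<sigma> N where 2: "0 < \<sigma>" "mbound \<sigma> N (F i)"
    using insert.prems[of i] by (auto simp: convergent_series_def)
  have "mbound (min \<rho> \<sigma>) (max M N) (F k)" if "k \<in> insert i I" for k
  proof (cases "k = i")
    case True
    show ?thesis unfolding True by (rule mbound_mono[OF mbound_radius_mono[OF 2(2)]]) (use 1 2 in auto)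
  next
    case False
    then have "mbound \<rho> M (F k)" using 1 that by simp
    then show ?thesis by (rule mbound_mono[OF mbound_radius_mono]) (use 1 2 in auto)
  qed
  then show ?case using 1 2 by (intro exI[of _ "min \<rho> \<sigma>"] conjI exI[of _ "max M N"]) auto
qed

lemma convergent_series_const: "convergent_series (mfps_const c)"
  unfolding convergent_series_def using mbound_const[of 1 c] by (metis zero_le_one zero_less_one)

lemma convergent_series_var: "convergent_series (mfps_var j)"
  unfolding convergent_series_def
  using mbound_finite_support[of "{\<lambda>i. if i = j then 1 else 0}" "mfps_var j" 1]
  by (intro exI[of _ 1] conjI exI) (auto simp: mfps_var_def)

lemma
  fixes F G :: "('k::real_normed_field, 'n::finite) mfps"
  shows convergent_series_add: "convergent_series F \<Longrightarrow> convergent_series G \<Longrightarrow> convergent_series (F + G)"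
  and convergent_series_mult: "convergent_series F \<Longrightarrow> convergent_series G \<Longrightarrow> convergent_series (F * G)"
proof -
  assume "convergent_series F" "convergent_series G"
  then have "convergent_series (if i then F else G)" for i by simp
  then obtain \<rho> M where "\<rho> > 0" "\<forall>i\<in>UNIV. mbound \<rho> M (if i then F else G)"
    using convergent_series_common_bound[of "UNIV :: bool set" "\<lambda>i. if i then F else G",
        OF finite_class.finite_UNIV]
    by blast
  then have "\<rho> > 0" "mbound \<rho> M F" "mbound \<rho> M G" by (metis UNIV_I)+
  then show "convergent_series (F + G)" "convergent_series (F * G)"
    unfolding convergent_series_def by (meson less_imp_le mbound_add mbound_mult)+
qed

text \<open>On a small enough polydisc the fixed point iteration maps the ball of radius \<open>R\<close> to itself. Since
  the iterates stabilise coefficientwise, the bound \<open>R\<close> is inherited by the root.\<close>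

lemma convergent_series_simple_root:
  fixes A :: "nat \<Rightarrow> ('k::real_normed_field, 'n::finite) mfps"
  assumes A: "\<And>k. k \<le> N \<Longrightarrow> convergent_series (A k)" "1 \<le> N" "cst (A 0) = 0" "cst (A 1) \<noteq> 0"
  shows "convergent_series (simple_root A N)"
proof -
  define u :: "('k, 'n) mfps" where "u = mfps_const (inverse (cst (A 1)))"
  define B where "B k = (if k = 1 then 1 - u * A 1 else - (u * A k))" for k
  define r where "r = simple_root A N"
  have r_def': "r = Abs_mfps (\<lambda>m. mcoeff ((root_step B N ^^ Suc (mdeg m)) 0) m)"
    unfolding r_def simple_root_def Let_def u_def[symmetric] B_def[abs_def] ..
  have B0: "cst (B 0) = 0" "cst (B 1) = 0" using A by (simp_all add: B_def u_def)
  then have ord: "order_ge 1 (B 0)" "order_ge 1 (B 1)" by (simp_all only: order_ge_1_iff)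
  have "convergent_series (B k)" if "k \<in> {..N}" for k
  proof -
    have uA: "convergent_series (mfps_const (c * inverse (cst (A 1))) * A k)" for c
      using A(1) that by (intro convergent_series_mult convergent_series_const) auto
    have "B k = mfps_const (if k = 1 then 1 else 0) + mfps_const (- inverse (cst (A 1))) * A k"
      by (simp add: B_def u_def mfps_const_minus)
    then show ?thesis
      using convergent_series_add[OF convergent_series_const uA[of "-1"]] by simp
  qed
  then obtain \<rho> M where \<rho>: "0 < \<rho>" and M: "1 \<le> M" and bd: "\<forall>k\<in>{..N}. mbound \<rho> M (B k)"
    using convergent_series_common_bound[of "{..N}" B] by blast
  \<comment> \<open>With \<open>\<theta> = R\<^sup>2\<close> each of the \<open>N + 1\<close> terms of a step is at most \<open>2 M R\<^sup>2\<close>, and these add up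
    to exactly \<open>R\<close>.\<close>
  define R where "R = 1 / (2 * M * (real N + 1))"
  have "1 \<le> 2 * M * (real N + 1)" using M mult_mono[of 1 "2 * M" 1 "real N + 1"] by simp
  then have R: "0 < R" "R \<le> 1" using M by (simp_all add: R_def divide_le_eq)
  define \<theta> where "\<theta> = R ^ 2"
  have \<theta>: "0 < \<theta>" "\<theta> \<le> 1" using R by (simp_all add: \<theta>_def power_le_one)
  have sum_le: "(real N + 1) * (\<theta> * M + M * R ^ 2) = R"
  proof -
    have "(real N + 1) * (\<theta> * M + M * R ^ 2) = (2 * M * (real N + 1)) * R * R"
      by (simp add: \<theta>_def algebra_simps power2_eq_square)
    also have "(2 * M * (real N + 1)) * R = 1" using M by (simp add: R_def)
    finally show ?thesis by simp
  qed
  have step: "mbound (\<theta> * \<rho>) R (root_step B N x)" if x: "mbound (\<theta> * \<rho>) R x" for x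
  proof -
    have "mbound (\<theta> * \<rho>) (\<theta> * M + M * R ^ 2) (B k * x ^ k)" if "k \<in> {..N}" for k
    proof (cases "k < 2")
      case True
      then have "k = 0 \<or> k = 1" by linarith
      then have "cst (B k) = 0" using B0 by auto
      then have "mbound (\<theta> * \<rho>) (\<theta> * M) (B k)"
        using bd that \<theta> \<rho> by (intro mbound_shrink(2)) auto
      then have "mbound (\<theta> * \<rho>) (\<theta> * M * R ^ k) (B k * x ^ k)"
        using \<theta> \<rho> x by (intro mbound_mult mbound_power) auto
      then show ?thesis
      proof (rule mbound_mono)
        have "\<theta> * M * R ^ k \<le> \<theta> * M" using \<theta> M R by (simp add: mult_left_le power_le_one)
        also have "\<dots> \<le> \<theta> * M + M * R ^ 2" using M by simp
        finally show "\<theta> * M * R ^ k \<le> \<theta> * M + M * R ^ 2" .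
      qed
    next
      case False
      have "mbound (\<theta> * \<rho>) M (B k)"
        using bd that \<theta> \<rho> by (intro mbound_shrink(1)) auto
      then have "mbound (\<theta> * \<rho>) (M * R ^ k) (B k * x ^ k)"
        using \<theta> \<rho> x by (intro mbound_mult mbound_power) auto
      then show ?thesis
      proof (rule mbound_mono)
        have "R ^ k \<le> R ^ 2" using R False by (intro power_decreasing) auto
        then have "M * R ^ k \<le> M * R ^ 2" using M by simp
        then show "M * R ^ k \<le> \<theta> * M + M * R ^ 2" using M \<theta> by (simp add: add_increasing)
      qed
    qed
    from mbound_sum[OF this, of "{..N}" "\<lambda>k. k"] \<theta> \<rho>
    have "mbound (\<theta> * \<rho>) ((real N + 1) * (\<theta> * M + M * R ^ 2)) (root_step B N x)"
      by (simp add: root_step_def add.commute)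
    then show ?thesis by (simp add: sum_le)
  qed
  have "mbound (\<theta> * \<rho>) R ((root_step B N ^^ n) 0)" for n
    by (induction n) (use R step in \<open>simp_all add: mbound_mono[OF mbound_zero]\<close>)
  then have "mbound (\<theta> * \<rho>) R r"
    by (rule mbound_limit) (rule fixpoint_of_contracting_polynomial(1)[OF ord, of _ N, folded r_def'])
  then show ?thesis
    unfolding r_def[symmetric] convergent_series_def using \<theta> \<rho> by (metis mult_pos_pos)
qed

interpretation analytic: root_closed "{F :: ('k::real_normed_field, 'n::finite) mfps. convergent_series F}"
  by unfold_locales
    (simp_all add: convergent_series_const convergent_series_var convergent_series_add
      convergent_series_mult convergent_series_simple_root)


section \<open>Convergent power series as analytic functions\<close>

definition mono_eval :: "'k::comm_ring_1 ^ 'n::finite \<Rightarrow> ('n \<Rightarrow> nat) \<Rightarrow> 'k" where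
  "mono_eval u m = (\<Prod>i\<in>UNIV. (u $ i) ^ m i)"

definition series_eval :: "('k::real_normed_field, 'n::finite) mfps \<Rightarrow> 'k ^ 'n \<Rightarrow> 'k" where
  "series_eval F u = (\<Sum>\<^sub>\<infinity>m. mcoeff F m * mono_eval u m)"

lemma norm_mono_eval_le:
  fixes u :: "'k::real_normed_field ^ 'n::finite"
  assumes "\<And>i. norm (u $ i) \<le> \<rho>"
  shows "norm (mono_eval u m) \<le> \<rho> ^ mdeg m"
proof -
  have "norm (mono_eval u m) = (\<Prod>i\<in>UNIV. norm (u $ i) ^ m i)"
    by (simp add: mono_eval_def norm_power flip: prod_norm)
  also have "\<dots> \<le> (\<Prod>i\<in>UNIV. \<rho> ^ m i)"
    by (intro prod_mono conjI power_mono zero_le_power assms) auto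
  finally show ?thesis by (simp add: mdeg_def power_sum)
qed

lemma mono_eval_add: "mono_eval u (\<lambda>i. a i + b i) = mono_eval u a * mono_eval u b"
  by (simp add: mono_eval_def power_add prod.distrib)

lemma abs_summable_mbound:
  fixes F :: "('k::real_normed_field, 'n::finite) mfps"
  assumes F: "mbound \<rho> M F" and u: "\<And>i. norm (u $ i) \<le> \<rho>"
  shows "(\<lambda>m. norm (mcoeff F m * mono_eval u m)) summable_on UNIV"
    and "(\<Sum>\<^sub>\<infinity>m. norm (mcoeff F m * mono_eval u m)) \<le> M"
proof -
  have "(\<Sum>m\<in>A. norm (mcoeff F m * mono_eval u m)) \<le> M" if "finite A" for A
  proof -
    have "(\<Sum>m\<in>A. norm (mcoeff F m * mono_eval u m)) \<le> (\<Sum>m\<in>A. norm (mcoeff F m) * \<rho> ^ mdeg m)"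
      by (auto simp: norm_mult intro!: sum_mono mult_left_mono norm_mono_eval_le u)
    also have "\<dots> \<le> M" by (rule mboundD[OF F that])
    finally show ?thesis .
  qed
  note * = this
  show s: "(\<lambda>m. norm (mcoeff F m * mono_eval u m)) summable_on UNIV"
    by (rule nonneg_bdd_above_summable_on) (use * in \<open>auto intro!: bdd_aboveI[of _ M]\<close>)
  show "(\<Sum>\<^sub>\<infinity>m. norm (mcoeff F m * mono_eval u m)) \<le> M"
    by (rule infsum_le_finite_sums[OF s]) (use * in auto)
qed

lemma series_eval_has_sum:
  fixes F :: "('k::{real_normed_field, banach}, 'n::finite) mfps"
  assumes "mbound \<rho> M F" and "\<And>i. norm (u $ i) \<le> \<rho>"
  shows "((\<lambda>m. mcoeff F m * mono_eval u m) has_sum series_eval F u) UNIV"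
  unfolding series_eval_def
  by (rule has_sum_infsum, rule abs_summable_summable, rule abs_summable_mbound[OF assms])

lemma norm_series_eval_le:
  fixes F :: "('k::{real_normed_field, banach}, 'n::finite) mfps"
  assumes "mbound \<rho> M F" and "\<And>i. norm (u $ i) \<le> \<rho>"
  shows "norm (series_eval F u) \<le> M"
  unfolding series_eval_def
  using norm_infsum_bound[OF abs_summable_mbound(1)[OF assms]] abs_summable_mbound(2)[OF assms]
  by linarith

text \<open>Summing a family over pairs of multi-indices in the order given by their sums; used for
  products of series and for their re-expansion around another point.\<close>

lemma has_sum_msplits:
  fixes f :: "('n::finite \<Rightarrow> nat) \<times> ('n \<Rightarrow> nat) \<Rightarrow> 'b::banach"
  assumes "(f has_sum T) UNIV"
  shows "((\<lambda>m. \<Sum>ab\<in>msplits m. f ab) has_sum T) UNIV"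
proof -
  have "((\<lambda>(m, ab). f ab) has_sum T) (Sigma UNIV msplits)"
    using assms
    by (subst has_sum_reindex_bij_witness[where i = "\<lambda>ab. (\<lambda>i. fst ab i + snd ab i, ab)" and j = snd
          and T = UNIV and h = f])
      (auto simp: msplits_def)
  then show ?thesis
    by (rule has_sum_SigmaD) (auto intro!: has_sum_finiteI finite_msplits)
qed

lemma abs_summable_pairs:
  fixes f :: "'a \<times> 'b \<Rightarrow> 'c::banach"
  assumes "\<And>A. finite A \<Longrightarrow> (\<Sum>x\<in>A. norm (f x)) \<le> M"
  shows "f summable_on UNIV" and "(\<lambda>b. f (a, b)) summable_on UNIV"
proof -
  have "(\<lambda>x. norm (f x)) summable_on UNIV"
    by (rule nonneg_bdd_above_summable_on) (use assms in \<open>auto intro!: bdd_aboveI[of _ M]\<close>)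
  then show "f summable_on UNIV" by (rule abs_summable_summable)
  have "(\<lambda>b. norm (f (a, b))) summable_on UNIV"
  proof (rule nonneg_bdd_above_summable_on)
    have "(\<Sum>b\<in>A. norm (f (a, b))) \<le> M" if "finite A" for A
      using assms[of "Pair a ` A"] that by (simp add: sum.reindex inj_on_def)
    then show "bdd_above (sum (\<lambda>b. norm (f (a, b))) ` {F. F \<subseteq> UNIV \<and> finite F})"
      by (auto intro!: bdd_aboveI[of _ M])
  qed simp
  then show "(\<lambda>b. f (a, b)) summable_on UNIV" by (rule abs_summable_summable)
qed

lemma series_eval_mult:
  fixes F G :: "('k::{real_normed_field, banach}, 'n::finite) mfps"
  assumes F: "mbound \<rho> M F" and G: "mbound \<rho> N G" and u: "\<And>i. norm (u $ i) \<le> \<rho>"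
  shows "series_eval (F * G) u = series_eval F u * series_eval G u"
proof -
  define A B where "A m = mcoeff F m * mono_eval u m" and "B m = mcoeff G m * mono_eval u m" for m
  define f where "f = (\<lambda>(a, b). A a * B b)"
  have sA: "(A has_sum series_eval F u) UNIV" and sB: "(B has_sum series_eval G u) UNIV"
    unfolding A_def B_def by (rule series_eval_has_sum[OF F u] series_eval_has_sum[OF G u])+
  have bound: "(\<Sum>x\<in>P. norm (f x)) \<le> M * N" if "finite P" for P
  proof -
    have "(\<Sum>x\<in>P. norm (f x)) \<le> (\<Sum>x\<in>fst ` P \<times> snd ` P. norm (f x))"
      by (rule sum_mono2) (use that in force)+
    also have "\<dots> = (\<Sum>a\<in>fst ` P. norm (A a)) * (\<Sum>b\<in>snd ` P. norm (B b))"
      by (simp add: f_def sum_product sum.cartesian_product case_prod_unfold norm_mult)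
    also have "\<dots> \<le> M * N"
    proof (intro mult_mono)
      show "(\<Sum>a\<in>fst ` P. norm (A a)) \<le> M" unfolding A_def
        using finite_sum_le_infsum[OF abs_summable_mbound(1)[OF F u], of "fst ` P"] that
          abs_summable_mbound(2)[OF F u] by force
      show "(\<Sum>a\<in>snd ` P. norm (B a)) \<le> N" unfolding B_def
        using finite_sum_le_infsum[OF abs_summable_mbound(1)[OF G u], of "snd ` P"] that
          abs_summable_mbound(2)[OF G u] by force
    qed (auto intro: sum_nonneg mbound_nonneg[OF F])
    finally show ?thesis .
  qed
  obtain T where T: "(f has_sum T) UNIV"
    using abs_summable_pairs(1)[OF bound] by (auto simp: summable_on_def)
  have "((\<lambda>a. A a * series_eval G u) has_sum T) UNIV"
  proof (rule has_sum_SigmaD[where B = "\<lambda>_. UNIV"])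
    show "(f has_sum T) (Sigma UNIV (\<lambda>_. UNIV))" using T by simp
    show "((\<lambda>b. f (a, b)) has_sum A a * series_eval G u) UNIV" for a
      unfolding f_def using has_sum_cmult_right[OF sB, of "A a"] by simp
  qed
  then have T_eq: "T = series_eval F u * series_eval G u"
    using has_sum_cmult_left[OF sA, of "series_eval G u"] has_sum_unique by blast
  have "(\<Sum>ab\<in>msplits m. f ab) = mcoeff (F * G) m * mono_eval u m" for m
    unfolding mcoeff_mult sum_distrib_right
  proof (rule sum.cong[OF refl], clarify)
    fix a b assume "(a, b) \<in> msplits m"
    then have "m = (\<lambda>i. a i + b i)" by (auto simp: msplits_def)
    then show "f (a, b) = mcoeff F a * mcoeff G b * mono_eval u m"
      by (simp add: f_def A_def B_def mono_eval_add)
  qed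
  with has_sum_msplits[OF T] have "((\<lambda>m. mcoeff (F * G) m * mono_eval u m) has_sum T) UNIV"
    by simp
  then show ?thesis unfolding series_eval_def[of "F * G"] by (simp add: infsumI T_eq)
qed

lemma series_eval_add:
  fixes F G :: "('k::{real_normed_field, banach}, 'n::finite) mfps"
  assumes F: "mbound \<rho> M F" and G: "mbound \<rho> N G" and u: "\<And>i. norm (u $ i) \<le> \<rho>"
  shows "series_eval (F + G) u = series_eval F u + series_eval G u"
  using has_sum_add[OF series_eval_has_sum[OF F u] series_eval_has_sum[OF G u]]
  unfolding series_eval_def[of "F + G"] by (simp add: infsumI distrib_right)

lemma series_eval_const [simp]: "series_eval (mfps_const c) u = c"
proof -
  have "((\<lambda>m. mcoeff (mfps_const c) m * mono_eval u m) has_sum c) UNIV"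
    by (rule has_sum_finite_neutralI[where B = "{\<lambda>i. 0}"]) (auto simp: mcoeff_const mono_eval_def)
  then show ?thesis by (simp add: series_eval_def infsumI)
qed

lemma series_eval_var [simp]:
  fixes u :: "'k::real_normed_field ^ 'n::finite"
  shows "series_eval (mfps_var j) u = u $ j"
proof -
  have "mono_eval u (\<lambda>i. if i = j then 1 else 0) = (\<Prod>i\<in>UNIV. if i = j then u $ i else 1)"
    unfolding mono_eval_def by (rule prod.cong) auto
  then have "((\<lambda>m. mcoeff (mfps_var j) m * mono_eval u m) has_sum u $ j) UNIV"
    by (intro has_sum_finite_neutralI[where B = "{\<lambda>i. if i = j then 1 else 0}"])
      (auto simp: mfps_var_def)
  then show ?thesis by (simp add: series_eval_def infsumI)
qed

lemma series_eval_zero [simp]: "series_eval 0 u = 0"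
  by (simp add: series_eval_def)

subsection \<open>Recentring and partial derivatives\<close>

text \<open>The multivariate binomial coefficient belonging to the splitting of \<open>m + b\<close> into \<open>m\<close> and \<open>b\<close>.\<close>

definition multi_binomial :: "('n::finite \<Rightarrow> nat) \<Rightarrow> ('n \<Rightarrow> nat) \<Rightarrow> nat" where
  "multi_binomial m b = (\<Prod>i\<in>UNIV. (m i + b i) choose m i)"

lemma mono_eval_binomial:
  fixes u v :: "'k::comm_ring_1 ^ 'n::finite"
  shows "mono_eval (u + v) a
    = (\<Sum>(m, b)\<in>msplits a. of_nat (multi_binomial m b) * mono_eval u m * mono_eval v b)"
proof -
  have "mono_eval (u + v) a
      = (\<Prod>i\<in>UNIV. \<Sum>k\<in>{..a i}. of_nat (a i choose k) * (u $ i) ^ k * (v $ i) ^ (a i - k))"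
    by (simp add: mono_eval_def binomial_ring)
  also have "\<dots> = (\<Sum>m\<in>PiE UNIV (\<lambda>i. {..a i}). \<Prod>i\<in>UNIV. of_nat (a i choose m i) * (u $ i) ^ m i * (v $ i) ^ (a i - m i))"
    by (rule prod_sum_PiE) auto
  also have "\<dots> = (\<Sum>(m, b)\<in>msplits a. of_nat (multi_binomial m b) * mono_eval u m * mono_eval v b)"
  proof (rule sum.reindex_bij_witness[where i = fst and j = "\<lambda>m. (m, \<lambda>i. a i - m i)"])
    fix m assume "m \<in> PiE UNIV (\<lambda>i. {..a i})"
    then have "m i \<le> a i" for i by (auto dest: PiE_mem)
    then show "(m, \<lambda>i. a i - m i) \<in> msplits a"
      and "(case (m, \<lambda>i. a i - m i) of (m, b) \<Rightarrow> of_nat (multi_binomial m b) * mono_eval u m * mono_eval v b)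
        = (\<Prod>i\<in>UNIV. of_nat (a i choose m i) * (u $ i) ^ m i * (v $ i) ^ (a i - m i))"
      by (simp_all add: msplits_def multi_binomial_def mono_eval_def prod.distrib)
  next
    fix x assume "x \<in> msplits a"
    then obtain m b where x: "x = (m, b)" and a: "a = (\<lambda>i. m i + b i)"
      by (cases x) (auto simp: msplits_def)
    show "(fst x, \<lambda>i. a i - fst x i) = x" "fst x \<in> PiE UNIV (\<lambda>i. {..a i})"
      by (simp_all add: x a PiE_UNIV_domain)
  qed simp
  finally show ?thesis .
qed

text \<open>The coefficients of the expansion of the series around the point that lies at \<open>v\<close> from the old
  centre.\<close>

definition recentred :: "'k::real_normed_field ^ 'n \<Rightarrow> ('k, 'n::finite) mfps \<Rightarrow> ('n \<Rightarrow> nat) \<Rightarrow> 'k" where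
  "recentred v F m = (\<Sum>\<^sub>\<infinity>b. mcoeff F (\<lambda>i. m i + b i) * of_nat (multi_binomial m b) * mono_eval v b)"

text \<open>Expand every monomial of the series in \<open>u + v\<close> by the binomial theorem and collect powers of
  \<open>u\<close>. The double family is absolutely summable because replacing all terms by their norms gives the
  series of norms evaluated at \<open>|u| + |v|\<close>, still inside the polydisc.\<close>

lemma recentred_has_sum:
  fixes F :: "('k::{real_normed_field, banach}, 'n::finite) mfps"
  assumes F: "mbound \<rho> M F" and uv: "\<And>i. norm (u $ i) + norm (v $ i) \<le> \<rho>"
  shows "((\<lambda>m. recentred v F m * mono_eval u m) has_sum series_eval F (u + v)) UNIV"
proof -
  define f where "f = (\<lambda>(m, b). mcoeff F (\<lambda>i. m i + b i) * of_nat (multi_binomial m b) * mono_eval v b * mono_eval u m)"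
  define u' v' :: "real ^ 'n" where "u' = (\<chi> i. norm (u $ i))" and "v' = (\<chi> i. norm (v $ i))"
  have norm_mono: "norm (mono_eval u m) = mono_eval u' m" "norm (mono_eval v m) = mono_eval v' m" for m
    by (simp_all add: u'_def v'_def mono_eval_def norm_power flip: prod_norm)
  have bound: "(\<Sum>x\<in>P. norm (f x)) \<le> M" if P: "finite P" for P
  proof -
    define A where "A = (\<lambda>(m, b) i. m i + b i) ` P"
    have A: "finite A" using P by (simp add: A_def)
    have "(\<Sum>x\<in>P. norm (f x)) \<le> (\<Sum>x\<in>(\<Union>a\<in>A. msplits a). norm (f x))"
    proof (rule sum_mono2)
      show "P \<subseteq> (\<Union>a\<in>A. msplits a)"
        by (auto simp: A_def msplits_def)
    qed (use A finite_msplits in auto)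
    also have "\<dots> = (\<Sum>a\<in>A. \<Sum>x\<in>msplits a. norm (f x))"
      by (rule sum.UNION_disjoint) (use A finite_msplits in \<open>auto simp: msplits_def fun_eq_iff\<close>)
    also have "\<dots> = (\<Sum>a\<in>A. norm (mcoeff F a) * mono_eval (u' + v') a)"
    proof (rule sum.cong[OF refl])
      fix a assume "a \<in> A"
      show "(\<Sum>x\<in>msplits a. norm (f x)) = norm (mcoeff F a) * mono_eval (u' + v') a"
        unfolding mono_eval_binomial sum_distrib_left
      proof (rule sum.cong[OF refl], clarify)
        fix m b assume "(m, b) \<in> msplits a"
        then have "a = (\<lambda>i. m i + b i)" by (auto simp: msplits_def)
        then show "norm (f (m, b)) = norm (mcoeff F a) * (real (multi_binomial m b) * mono_eval u' m * mono_eval v' b)"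
          by (simp add: f_def norm_mult norm_mono)
      qed
    qed
    also have "\<dots> \<le> (\<Sum>a\<in>A. norm (mcoeff F a) * \<rho> ^ mdeg a)"
    proof (intro sum_mono mult_left_mono)
      fix a
      have "norm (mono_eval (u' + v') a) \<le> \<rho> ^ mdeg a"
        by (rule norm_mono_eval_le) (simp add: u'_def v'_def uv)
      then show "mono_eval (u' + v') a \<le> \<rho> ^ mdeg a" by simp
    qed simp
    also have "\<dots> \<le> M" by (rule mboundD[OF F A])
    finally show ?thesis .
  qed
  obtain T where T: "(f has_sum T) UNIV"
    using abs_summable_pairs(1)[OF bound] by (auto simp: summable_on_def)
  have "(\<Sum>x\<in>msplits a. f x) = mcoeff F a * mono_eval (u + v) a" for a
    unfolding mono_eval_binomial sum_distrib_left
  proof (rule sum.cong[OF refl], clarify)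
    fix m b assume "(m, b) \<in> msplits a"
    then have "a = (\<lambda>i. m i + b i)" by (auto simp: msplits_def)
    then show "f (m, b) = mcoeff F a * (of_nat (multi_binomial m b) * mono_eval u m * mono_eval v b)"
      by (simp add: f_def mult_ac)
  qed
  with has_sum_msplits[OF T] have "((\<lambda>a. mcoeff F a * mono_eval (u + v) a) has_sum T) UNIV"
    by simp
  then have T_eq: "T = series_eval F (u + v)"
    by (simp add: series_eval_def infsumI)
  show ?thesis
  proof (rule has_sum_SigmaD[where B = "\<lambda>_. UNIV"])
    show "(f has_sum series_eval F (u + v)) (Sigma UNIV (\<lambda>_. UNIV))" using T by (simp add: T_eq)
    fix m
    show "((\<lambda>b. f (m, b)) has_sum recentred v F m * mono_eval u m) UNIV"
    proof (cases "mono_eval u m = 0")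
      case True
      then show ?thesis by (simp add: f_def)
    next
      case False
      have "(\<lambda>b. f (m, b)) summable_on UNIV" by (rule abs_summable_pairs(2)[OF bound])
      then have "(\<lambda>b. mcoeff F (\<lambda>i. m i + b i) * of_nat (multi_binomial m b) * mono_eval v b) summable_on UNIV"
        using False by (simp add: f_def summable_on_cmult_left')
      then have "((\<lambda>b. mcoeff F (\<lambda>i. m i + b i) * of_nat (multi_binomial m b) * mono_eval v b) has_sum recentred v F m) UNIV"
        unfolding recentred_def by (rule has_sum_infsum)
      from has_sum_cmult_left[OF this, of "mono_eval u m"] show ?thesis by (simp add: f_def)
    qed
  qed
qed

lemma analytic_series_eval:
  fixes F :: "('k::{real_normed_field, banach}, 'n::finite) mfps"
  assumes F: "mbound \<rho> M F" and U: "\<And>x i. x \<in> U \<Longrightarrow> norm (x $ i - p $ i) < \<rho>"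
  shows "analytic_on_space (\<lambda>x. series_eval F (x - p)) U"
  unfolding analytic_on_space_def
proof
  fix q assume q: "q \<in> U"
  define r where "r = Min (range (\<lambda>i. \<rho> - norm (q $ i - p $ i)))"
  have r: "r \<le> \<rho> - norm (q $ i - p $ i)" for i
    unfolding r_def by (rule Min_le) auto
  have "r > 0" unfolding r_def using U[OF q] by (subst Min_gr_iff) auto
  moreover have "((\<lambda>m. recentred (q - p) F m * (\<Prod>i\<in>UNIV. (x $ i - q $ i) ^ m i)) has_sum series_eval F (x - p)) UNIV"
    if x: "\<forall>i. norm (x $ i - q $ i) < r" for x
  proof -
    have "norm ((x - q) $ i) + norm ((q - p) $ i) \<le> \<rho>" for i
      using x[rule_format, of i] r[of i] by simp
    from recentred_has_sum[OF F this] show ?thesis by (simp add: mono_eval_def)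
  qed
  ultimately show "\<exists>c r. r > 0 \<and> (\<forall>x. (\<forall>i. norm (x $ i - q $ i) < r) \<longrightarrow>
       ((\<lambda>m. c m * (\<Prod>i\<in>UNIV. (x $ i - q $ i) ^ m i)) has_sum series_eval F (x - p)) UNIV)"
    by blast
qed

text \<open>The linear coefficients of the expansion around another point are the values there of the formal
  partial derivatives; this is how the formal and the actual derivative are identified.\<close>

lemma recentred_unit:
  fixes F :: "('k::real_normed_field, 'n::finite) mfps"
  shows "recentred v F (\<lambda>i. if i = j then 1 else 0) = series_eval (mfps_deriv j F) v"
proof -
  have "multi_binomial (\<lambda>i. if i = j then 1 else 0) b = b j + 1" for b
  proof -
    have "multi_binomial (\<lambda>i. if i = j then 1 else 0) b = (\<Prod>i\<in>UNIV. if i = j then b i + 1 else 1)"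
      unfolding multi_binomial_def by (rule prod.cong) auto
    then show ?thesis by simp
  qed
  moreover have "(\<lambda>i. (if i = j then 1 else 0) + b i) = b(j := b j + 1)" for b :: "'n \<Rightarrow> nat"
    by auto
  ultimately show ?thesis
    unfolding recentred_def series_eval_def mcoeff_deriv by (simp add: mult.commute)
qed

lemma power_series_has_derivative_at_0:
  fixes f :: "'k::{real_normed_field, banach} \<Rightarrow> 'k"
  assumes "r > 0" and sums: "\<And>h. norm h < r \<Longrightarrow> (\<lambda>k. c k * h ^ k) sums f h"
  shows "(f has_field_derivative c 1) (at 0)"
proof -
  define K :: 'k where "K = of_real (r / 2)"
  have K: "norm K < r" "norm (0 :: 'k) < norm K" using assms(1) by (simp_all add: K_def)
  have "((\<lambda>x. \<Sum>n. c n * x ^ n) has_field_derivative (\<Sum>n. diffs c n * 0 ^ n)) (at 0)"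
    by (rule termdiffs_strong[OF sums_summable[OF sums[OF K(1)]] K(2)])
  moreover have "(\<Sum>n. diffs c n * 0 ^ n) = c 1"
    by (simp add: diffs_def)
  moreover have "eventually (\<lambda>h. (\<Sum>n. c n * h ^ n) = f h) (nhds 0)"
  proof (rule eventually_mono)
    show "eventually (\<lambda>h. h \<in> ball 0 r) (nhds 0)"
      using assms(1) by (intro eventually_nhds_in_open) auto
  qed (use sums sums_unique in force)
  ultimately show ?thesis by (simp add: DERIV_cong_ev[OF refl _ refl])
qed

lemma partial_deriv_series_eval:
  fixes F :: "('k::{real_normed_field, banach}, 'n::finite) mfps"
  assumes F: "mbound \<rho> M F" and x: "\<And>i. norm (x $ i - p $ i) < \<rho>"
  shows "partial_deriv j (\<lambda>x. series_eval F (x - p)) x = series_eval (mfps_deriv j F) (x - p)"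
proof -
  define g where "g t = series_eval F ((\<chi> i. if i = j then t else x $ i) - p)" for t
  define e where "e k = (\<lambda>i. if i = j then k else 0 :: nat)" for k
  have "inj e" unfolding inj_def e_def by metis
  have "(\<lambda>k. recentred (x - p) F (e k) * h ^ k) sums g (x $ j + h)"
    if h: "norm h < \<rho> - norm (x $ j - p $ j)" for h
  proof -
    define u :: "'k ^ 'n" where "u = (\<chi> i. if i = j then h else 0)"
    have eq: "(\<chi> i. if i = j then x $ j + h else x $ i) - p = u + (x - p)"
      by (simp add: u_def vec_eq_iff)
    have u_mono: "mono_eval u (e k) = h ^ k" for k
    proof -
      have "mono_eval u (e k) = (\<Prod>i\<in>UNIV. if i = j then h ^ k else 1)"
        unfolding mono_eval_def u_def e_def by (rule prod.cong) auto
      then show ?thesis by simp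
    qed
    have u_mono_0: "mono_eval u m = 0" if "m \<notin> range e" for m
    proof -
      have "m \<noteq> e (m j)" using that by blast
      then obtain i where "i \<noteq> j" "m i \<noteq> 0" by (auto simp: e_def fun_eq_iff split: if_splits)
      then show ?thesis unfolding mono_eval_def u_def by (intro prod_zero) auto
    qed
    have "norm (u $ i) + norm ((x - p) $ i) \<le> \<rho>" for i
      using h x[of i] by (auto simp: u_def)
    from recentred_has_sum[OF F this]
    have "((\<lambda>m. recentred (x - p) F m * mono_eval u m) has_sum g (x $ j + h)) UNIV"
      unfolding g_def eq .
    then have "((\<lambda>m. recentred (x - p) F m * mono_eval u m) has_sum g (x $ j + h)) (range e)"
      by (rule has_sum_cong_neutral[THEN iffD1, rotated -1]) (auto simp: u_mono_0)
    then have "((\<lambda>k. recentred (x - p) F (e k) * h ^ k) has_sum g (x $ j + h)) UNIV"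
      by (simp add: has_sum_reindex[OF \<open>inj e\<close>] o_def u_mono)
    then show ?thesis by (rule has_sum_imp_sums)
  qed
  from power_series_has_derivative_at_0[where r = "\<rho> - norm (x $ j - p $ j)", OF _ this]
  have "((\<lambda>h. g (x $ j + h)) has_field_derivative recentred (x - p) F (e 1)) (at 0)"
    using x[of j] by simp
  then have "(g has_field_derivative recentred (x - p) F (e 1)) (at (x $ j))"
    using DERIV_shift[of g "recentred (x - p) F (e 1)" 0 "x $ j"] by (simp add: add.commute)
  then have "deriv g (x $ j) = recentred (x - p) F (e 1)" by (rule DERIV_imp_deriv)
  then show ?thesis
    unfolding partial_deriv_def g_def[symmetric] e_def by (simp add: recentred_unit)
qed


section \<open>Independence of gradients\<close>

context vector_space
begin

lemma inj_on_independent_family: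
  fixes f :: "nat \<Rightarrow> 'b"
  assumes indep: "\<And>\<mu>. (\<Sum>a<r. scale (\<mu> a) (f a)) = 0 \<Longrightarrow> \<forall>a<r. \<mu> a = 0"
  shows "inj_on f {..<r}"
proof (rule inj_onI, rule ccontr)
  fix a b assume ab: "a \<in> {..<r}" "b \<in> {..<r}" "f a = f b" "a \<noteq> b"
  define \<mu> where "\<mu> i = (if i = a then 1 else if i = b then - 1 else 0 :: 'a)" for i
  have "(\<Sum>i<r. scale (\<mu> i) (f i)) = (\<Sum>i\<in>{a, b}. scale (\<mu> i) (f i))"
    by (rule sum.mono_neutral_right) (use ab in \<open>auto simp: \<mu>_def\<close>)
  also have "\<dots> = 0" using ab by (simp add: \<mu>_def)
  finally have "\<mu> a = 0" using indep ab by auto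
  then show False by (simp add: \<mu>_def)
qed

lemma independent_image_family:
  fixes f :: "nat \<Rightarrow> 'b"
  assumes indep: "\<And>\<mu>. (\<Sum>a<r. scale (\<mu> a) (f a)) = 0 \<Longrightarrow> \<forall>a<r. \<mu> a = 0"
  shows "independent (f ` {..<r})"
proof
  assume "dependent (f ` {..<r})"
  then obtain u where u: "\<exists>v\<in>f ` {..<r}. u v \<noteq> 0" "(\<Sum>v\<in>f ` {..<r}. scale (u v) v) = 0"
    using dependent_finite[of "f ` {..<r}"] by auto
  then have "(\<Sum>a<r. scale (u (f a)) (f a)) = 0"
    by (simp add: sum.reindex[OF inj_on_independent_family[OF indep]])
  with indep[of "\<lambda>a. u (f a)"] u(1) show False by auto
qed

lemma dim_independent_family:
  fixes f :: "nat \<Rightarrow> 'b"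
  assumes indep: "\<And>\<mu>. (\<Sum>a<r. scale (\<mu> a) (f a)) = 0 \<Longrightarrow> \<forall>a<r. \<mu> a = 0"
  shows "dim (f ` {..<r}) = r"
  using dim_eq_card_independent[OF independent_image_family[OF indep]]
  by (simp add: card_image[OF inj_on_independent_family[OF indep]])

end

text \<open>Rank and nullity, in the form in which the rank is witnessed by a family meeting the null space
  trivially.\<close>

lemma vec_dim_plus_complement_le:
  fixes u :: "nat \<Rightarrow> 'k::field ^ 'n::finite"
  assumes K: "vec.subspace K" and W: "W \<subseteq> K"
    and indep: "\<And>\<nu>. (\<Sum>j<r. \<nu> j *s u j) \<in> K \<Longrightarrow> \<forall>j<r. \<nu> j = 0"
  shows "vec.dim W + r \<le> CARD('n)"
proof -
  have indep0: "\<forall>j<r. \<nu> j = 0" if "(\<Sum>j<r. \<nu> j *s u j) = 0" for \<nu>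
    using indep[of \<nu>] that vec.subspace_0[OF K] by simp
  define T where "T = vec.span (u ` {..<r})"
  have dimT: "vec.dim T = r"
    unfolding T_def by (simp add: vec.dim_span vec.dim_independent_family[OF indep0])
  have "K \<inter> T \<subseteq> {0}"
  proof
    fix x assume x: "x \<in> K \<inter> T"
    then obtain c where "x = (\<Sum>v\<in>u ` {..<r}. c v *s v)"
      unfolding T_def by (auto simp: vec.span_finite)
    then have c: "x = (\<Sum>j<r. c (u j) *s u j)"
      by (simp add: sum.reindex[OF vec.inj_on_independent_family[OF indep0]])
    with indep[of "\<lambda>j. c (u j)"] x show "x \<in> {0}" by simp
  qed
  then have "vec.dim (K \<inter> T) = 0" by (simp add: vec.dim_eq_0)
  moreover have "vec.dim {x + y |x y. x \<in> K \<and> y \<in> T} + vec.dim (K \<inter> T) = vec.dim K + vec.dim T"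
    by (rule vec.dim_sums_Int) (simp_all add: K T_def)
  moreover have "vec.dim {x + y |x y. x \<in> K \<and> y \<in> T} \<le> CARD('n)" by (rule vec_dim_le)
  moreover have "vec.dim W \<le> vec.dim K" using W by (rule vec.dim_subset)
  ultimately show ?thesis using dimT by linarith
qed

lemma common_denominator:
  fixes \<mu> :: "'i \<Rightarrow> 'a::idom fract"
  assumes "finite I"
  shows "\<exists>D. D \<noteq> 0 \<and> (\<forall>i\<in>I. \<exists>\<nu>. \<mu> i * Fract D 1 = Fract \<nu> 1)"
  using assms
proof (induction I rule: finite_induct)
  case empty
  show ?case by (intro exI[of _ 1]) simp
next
  case (insert k I)
  then obtain D where D: "D \<noteq> 0" "\<forall>i\<in>I. \<exists>\<nu>. \<mu> i * Fract D 1 = Fract \<nu> 1" by blast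
  obtain a b where ab: "\<mu> k = Fract a b" "b \<noteq> 0" by (cases "\<mu> k") auto
  have "\<exists>\<nu>. \<mu> i * Fract (D * b) 1 = Fract \<nu> 1" if "i \<in> insert k I" for i
  proof (cases "i = k")
    case True
    have "\<mu> k * Fract (D * b) 1 = Fract (a * D) 1" using ab by (simp add: eq_fract)
    then show ?thesis using True by blast
  next
    case False
    with that D obtain \<nu> where "\<mu> i * Fract D 1 = Fract \<nu> 1" by blast
    moreover have "Fract (D * b) 1 = Fract D 1 * Fract b 1" by simp
    ultimately have "\<mu> i * Fract (D * b) 1 = Fract \<nu> 1 * Fract b 1" by (metis mult.assoc)
    also have "\<dots> = Fract (\<nu> * b) 1" by simp
    finally show ?thesis by blast
  qed
  then show ?case using D ab by (intro exI[of _ "D * b"]) auto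
qed

text \<open>The vectors \<open>y b\<close> are dual to the gradients at the base point, so the pairing matrix \<open>G\<close> over the
  power series is the identity modulo the maximal ideal. A linear relation with coefficients cleared
  of denominators then lies in every power of that ideal, hence is trivial.\<close>

lemma formally_independent_if_dual:
  fixes F :: "nat \<Rightarrow> ('k::field, 'n::finite) mfps"
  assumes dual: "\<And>a b. a < r \<Longrightarrow> b < r \<Longrightarrow>
      (\<Sum>j\<in>UNIV. y b j * cst (mfps_deriv j (F a))) = (if a = b then 1 else 0)"
  shows "formally_independent r F"
  unfolding formally_independent_def
proof (rule vec.dim_independent_family)
  fix \<mu> :: "nat \<Rightarrow> ('k, 'n) mfps fract"
  assume rel: "(\<Sum>a<r. \<mu> a *s (\<chi> j. Fract (mfps_deriv j (F a)) 1)) = 0"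
  obtain D where D: "D \<noteq> 0" "\<forall>a\<in>{..<r}. \<exists>\<nu>. \<mu> a * Fract D 1 = Fract \<nu> 1"
    using common_denominator[of "{..<r}" \<mu>] by auto
  then obtain \<nu> where \<nu>: "\<mu> a * Fract D 1 = Fract (\<nu> a) 1" if "a < r" for a
    by (metis lessThan_iff)
  have \<nu>_rel: "(\<Sum>a<r. \<nu> a * mfps_deriv j (F a)) = 0" for j
  proof -
    have "0 = (\<Sum>a<r. \<mu> a * Fract (mfps_deriv j (F a)) 1)"
      using arg_cong[OF rel, of "\<lambda>v. v $ j"] by simp
    then have "0 = (\<Sum>a<r. \<mu> a * Fract (mfps_deriv j (F a)) 1) * Fract D 1" by simp
    also have "\<dots> = (\<Sum>a<r. Fract (\<nu> a) 1 * Fract (mfps_deriv j (F a)) 1)"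
      unfolding sum_distrib_right by (rule sum.cong) (auto simp: mult_ac simp flip: \<nu>)
    also have "\<dots> = Fract (\<Sum>a<r. \<nu> a * mfps_deriv j (F a)) 1"
      by (simp add: Fract_sum)
    finally show ?thesis using Fract_ne_0 by metis
  qed
  define G where "G a b = (\<Sum>j\<in>UNIV. mfps_const (y b j) * mfps_deriv j (F a))" for a b
  have cst_G: "cst (G a b) = (if a = b then 1 else 0)" if "a < r" "b < r" for a b
    using dual[OF that] by (simp add: G_def)
  have \<nu>_G: "(\<Sum>a<r. \<nu> a * G a b) = 0" for b
  proof -
    have "(\<Sum>a<r. \<nu> a * G a b) = (\<Sum>j\<in>UNIV. mfps_const (y b j) * (\<Sum>a<r. \<nu> a * mfps_deriv j (F a)))"
      unfolding G_def sum_distrib_left by (subst sum.swap) (simp add: mult_ac)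
    then show ?thesis by (simp add: \<nu>_rel)
  qed
  have "\<forall>a<r. order_ge n (\<nu> a)" for n
  proof (induction n)
    case (Suc n)
    show ?case
    proof (intro allI impI)
      fix b assume b: "b < r"
      have "(\<Sum>a<r. \<nu> a * (G a b - (if a = b then 1 else 0)))
          = (\<Sum>a<r. \<nu> a * G a b) - (\<Sum>a<r. if a = b then \<nu> a else 0)"
        unfolding sum_subtractf[symmetric] by (rule sum.cong) (auto simp: algebra_simps)
      also have "\<dots> = - \<nu> b" using b by (simp add: \<nu>_G)
      finally have eq: "\<nu> b = - (\<Sum>a<r. \<nu> a * (G a b - (if a = b then 1 else 0)))" by simp
      have "order_ge (n + 1) (\<nu> a * (G a b - (if a = b then 1 else 0)))" if "a < r" for a
        by (rule order_ge_mult) (use Suc that b in \<open>simp_all only: order_ge_1_iff, simp_all add: cst_G\<close>)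
      then have "order_ge (n + 1) (\<Sum>a<r. \<nu> a * (G a b - (if a = b then 1 else 0)))"
        by (intro order_ge_sum) auto
      then show "order_ge (Suc n) (\<nu> b)" by (subst eq) (simp add: order_ge_minus)
    qed
  qed simp
  then have "\<nu> a = 0" if "a < r" for a using that order_ge_all_imp_0[of "\<nu> a"] by blast
  then show "\<forall>a<r. \<mu> a = 0" using \<nu> D(1) Fract_ne_0 by (metis Fract_hom(3) mult_eq_0_iff)
qed

text \<open>Look at a coefficient of largest norm: diagonal dominance.\<close>

lemma independent_if_near_identity:
  fixes G :: "nat \<Rightarrow> nat \<Rightarrow> 'k::real_normed_field"
  assumes G: "\<And>a b. a < r \<Longrightarrow> b < r \<Longrightarrow> norm (G a b - (if a = b then 1 else 0)) < 1 / (real r + 1)"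
    and \<mu>: "\<And>b. b < r \<Longrightarrow> (\<Sum>a<r. \<mu> a * G a b) = 0"
  shows "\<forall>a<r. \<mu> a = 0"
proof (rule ccontr)
  assume "\<not> (\<forall>a<r. \<mu> a = 0)"
  then obtain a0 where a0: "a0 < r" "\<mu> a0 \<noteq> 0" by blast
  define M where "M = Max ((\<lambda>a. norm (\<mu> a)) ` {..<r})"
  have le: "norm (\<mu> a) \<le> M" if "a < r" for a unfolding M_def using that by (intro Max_ge) auto
  have "M \<in> (\<lambda>a. norm (\<mu> a)) ` {..<r}" unfolding M_def using a0 by (intro Max_in) auto
  then obtain b where b: "b < r" "norm (\<mu> b) = M" by auto
  have M: "M > 0" using le[OF a0(1)] a0(2) by (meson less_le_trans zero_less_norm_iff)
  have "(\<Sum>a<r. \<mu> a * (G a b - (if a = b then 1 else 0)))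
      = (\<Sum>a<r. \<mu> a * G a b) - (\<Sum>a<r. if a = b then \<mu> a else 0)"
    unfolding sum_subtractf[symmetric] by (rule sum.cong) (auto simp: algebra_simps)
  also have "\<dots> = - \<mu> b" using b \<mu> by simp
  finally have "M = norm (\<Sum>a<r. \<mu> a * (G a b - (if a = b then 1 else 0)))" using b by simp
  also have "\<dots> \<le> (\<Sum>a<r. M * (1 / (real r + 1)))"
  proof (rule sum_norm_le)
    fix a assume "a \<in> {..<r}"
    then show "norm (\<mu> a * (G a b - (if a = b then 1 else 0))) \<le> M * (1 / (real r + 1))"
      unfolding norm_mult using le[of a] less_imp_le[OF G[of a b]] b(1) M by (intro mult_mono) auto
  qed
  also have "\<dots> < M" using M by (simp add: field_simps)
  finally show False by simp
qed

lemma series_eval_near_cst: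
  fixes F :: "('k::{real_normed_field, banach}, 'n::finite) mfps"
  assumes F: "mbound \<rho> M F" and \<rho>: "0 < \<rho>" and \<epsilon>: "0 < \<epsilon>"
  shows "\<exists>\<delta>>0. \<forall>u. (\<forall>i. norm (u $ i) < \<delta>) \<longrightarrow> norm (series_eval F u - cst F) < \<epsilon>"
proof -
  define M' where "M' = M + norm (- cst F)"
  have M': "mbound \<rho> M' (F + mfps_const (- cst F))" "0 \<le> M'"
    unfolding M'_def using \<rho> add_nonneg_nonneg[OF mbound_nonneg[OF F] norm_ge_zero]
    by (blast intro: mbound_add F mbound_const less_imp_le)+
  define \<theta> where "\<theta> = min 1 (\<epsilon> / (2 * (M' + 1)))"
  have \<theta>: "0 < \<theta>" "\<theta> \<le> 1" "\<theta> * M' < \<epsilon>"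
  proof -
    show "0 < \<theta>" "\<theta> \<le> 1" using \<epsilon> M'(2) by (simp_all add: \<theta>_def)
    have "\<theta> * M' \<le> \<epsilon> / (2 * (M' + 1)) * (M' + 1)"
      using \<epsilon> M'(2) by (intro mult_mono) (auto simp: \<theta>_def)
    also have "\<dots> = \<epsilon> / 2" using M'(2) by (simp add: divide_simps)
    also have "\<dots> < \<epsilon>" using \<epsilon> by simp
    finally show "\<theta> * M' < \<epsilon>" .
  qed
  have "norm (series_eval F u - cst F) < \<epsilon>" if u: "\<forall>i. norm (u $ i) < \<theta> * \<rho>" for u
  proof -
    have u': "norm (u $ i) \<le> \<theta> * \<rho>" for i using u by (simp add: less_imp_le)
    have "mbound (\<theta> * \<rho>) (\<theta> * M') (F + mfps_const (- cst F))"
      using M' \<theta> \<rho> by (intro mbound_shrink(2)) auto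
    from norm_series_eval_le[OF this u'] have "norm (series_eval (F + mfps_const (- cst F)) u) \<le> \<theta> * M'" .
    moreover have "series_eval (F + mfps_const (- cst F)) u = series_eval F u + - cst F"
    proof (subst series_eval_add)
      show "mbound (\<theta> * \<rho>) M F" using F \<theta> \<rho> by (intro mbound_shrink(1)) auto
      show "mbound (\<theta> * \<rho>) (norm (- cst F)) (mfps_const (- cst F) :: ('k, 'n) mfps)" using \<theta> \<rho> by (intro mbound_const) auto
    qed (use u' in auto)
    ultimately show ?thesis using \<theta>(3) by simp
  qed
  then show ?thesis using \<theta> \<rho> by (metis mult_pos_pos)
qed


section \<open>Counting invariants\<close>

lemma number_of_formal_invariants_ge:
  fixes F :: "nat \<Rightarrow> ('k::field, 'n::finite) mfps"
  assumes "\<And>a. a < r \<Longrightarrow> formal_invariant c p (F a)" and indep: "formally_independent r F"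
  shows "r \<le> number_of_formal_invariants c"
  unfolding number_of_formal_invariants_def
proof (rule Greatest_le_nat[where b = "CARD('n)"])
  show "\<exists>p F. (\<forall>a<r. formal_invariant c p (F a)) \<and> formally_independent r F"
    using assms by (intro exI conjI allI impI)
qed (elim exE conjE, rule formally_independent_le)

text \<open>The analytic functions are the sums of the series on a small ball. They are independent at every
  point of it because the pairing with the dual vectors \<open>y b\<close>, the identity at the centre, stays
  close to the identity.\<close>

lemma number_of_analytic_invariants_ge:
  fixes F :: "nat \<Rightarrow> ('k::{real_normed_field, banach}, 'n::finite) mfps"
  assumes inv: "\<And>a. a < r \<Longrightarrow> formal_invariant c p (F a)"
    and conv: "\<And>a. a < r \<Longrightarrow> convergent_series (F a)"
    and dual: "\<And>a b. a < r \<Longrightarrow> b < r \<Longrightarrow>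
      (\<Sum>j\<in>UNIV. y b j * cst (mfps_deriv j (F a))) = (if a = b then 1 else 0)"
  shows "r \<le> number_of_analytic_invariants c"
proof -
  obtain \<rho> M where \<rho>: "0 < \<rho>" and "1 \<le> M" and bd: "\<And>a. a < r \<Longrightarrow> mbound \<rho> M (F a)"
    using convergent_series_common_bound[of "{..<r}" F] conv by auto
  have bd': "mbound (\<rho> / 2) M (F a)" if "a < r" for a
    using mbound_radius_mono[OF bd[OF that] \<rho>] \<rho> by simp
  have bd_deriv: "mbound (\<rho> / 2) (M / \<rho>) (mfps_deriv j (F a))" if "a < r" for a j
    by (rule mbound_deriv[OF bd[OF that] \<rho>])
  define G where "G a b = (\<Sum>j\<in>UNIV. mfps_const (y b j) * mfps_deriv j (F a))" for a b
  have bd_term: "mbound (\<rho> / 2) (norm (y b j) * (M / \<rho>)) (mfps_const (y b j) * mfps_deriv j (F a))" if "a < r" for a b j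
    using \<rho> that by (intro mbound_mult mbound_const bd_deriv) auto
  have bd_G: "mbound (\<rho> / 2) (\<Sum>j\<in>UNIV. norm (y b j) * (M / \<rho>)) (G a b)" if "a < r" for a b
    unfolding G_def using \<rho> that by (intro mbound_sum bd_term) auto
  have cst_G: "cst (G a b) = (if a = b then 1 else 0)" if "a < r" "b < r" for a b
    using dual[OF that] by (simp add: G_def)
  have "\<exists>\<delta>>0. \<forall>u. (\<forall>i. norm (u $ i) < \<delta>) \<longrightarrow> (\<forall>ab\<in>{..<r} \<times> {..<r}.
      norm (series_eval (G (fst ab) (snd ab)) u - cst (G (fst ab) (snd ab))) < 1 / (real r + 1))"
  proof -
    define P where "P ab \<delta> \<longleftrightarrow> (\<forall>u. (\<forall>i. norm (u $ i) < \<delta>) \<longrightarrow>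
      norm (series_eval (G (fst ab) (snd ab)) u - cst (G (fst ab) (snd ab))) < 1 / (real r + 1))" for ab and \<delta> :: real
    have "\<exists>\<delta>>0. \<forall>ab\<in>X. P ab \<delta>" if "finite X" "X \<subseteq> {..<r} \<times> {..<r}" for X
      using that
    proof (induction X rule: finite_induct)
      case empty
      show ?case by (intro exI[of _ 1]) simp
    next
      case (insert ab X)
      then obtain \<delta> where \<delta>: "\<delta> > 0" "\<forall>ab\<in>X. P ab \<delta>" by auto
      have "fst ab < r" using insert by auto
      have "\<exists>\<delta>'>0. P ab \<delta>'" unfolding P_def
        by (rule series_eval_near_cst[OF bd_G[OF \<open>fst ab < r\<close>]]) (use \<rho> in auto)
      then obtain \<delta>' where \<delta>': "\<delta>' > 0" "P ab \<delta>'" by blast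
      show ?case
        using \<delta> \<delta>' by (intro exI[of _ "min \<delta> \<delta>'"]) (auto simp: P_def)
    qed
    from this[of "{..<r} \<times> {..<r}"] show ?thesis unfolding P_def by auto
  qed
  then obtain \<delta> where \<delta>: "\<delta> > 0" and near': "\<And>u ab. (\<forall>i. norm (u $ i) < \<delta>) \<Longrightarrow> ab \<in> {..<r} \<times> {..<r} \<Longrightarrow>
      norm (series_eval (G (fst ab) (snd ab)) u - cst (G (fst ab) (snd ab))) < 1 / (real r + 1)"
    by blast
  have near: "norm (series_eval (G a b) u - (if a = b then 1 else 0)) < 1 / (real r + 1)"
    if "\<And>i. norm (u $ i) < \<delta>" "a < r" "b < r" for u a b
    using near'[of u "(a, b)"] that cst_G[of a b] by simp
  define U where "U = ball p (min \<delta> (\<rho> / 2))"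
  have U: "norm (x $ i - p $ i) < \<delta>" "norm (x $ i - p $ i) < \<rho> / 2" if "x \<in> U" for x i
  proof -
    have "norm (x $ i - p $ i) \<le> dist p x"
      using Finite_Cartesian_Product.norm_nth_le[of "x - p" i] by (simp add: dist_norm norm_minus_commute)
    then show "norm (x $ i - p $ i) < \<delta>" "norm (x $ i - p $ i) < \<rho> / 2"
      using that by (simp_all add: U_def)
  qed
  have U_le: "norm ((x - p) $ i) \<le> \<rho> / 2" if "x \<in> U" for x i
    using U(2)[OF that, of i] by simp
  have open_U: "open U" "connected U" "U \<noteq> {}"
    using \<delta> \<rho> by (simp_all add: U_def convex_connected)
  define f where "f a x = series_eval (F a) (x - p)" for a x
  have partial: "partial_deriv j (f a) x = series_eval (mfps_deriv j (F a)) (x - p)"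
    if "a < r" "x \<in> U" for a x j
    unfolding f_def[abs_def] by (rule partial_deriv_series_eval[OF bd'[OF that(1)] U(2)[OF that(2)]])
  have "analytic_invariant c U (f a)" if a: "a < r" for a
    unfolding analytic_invariant_def
  proof (intro conjI ballI allI)
    show "analytic_on_space (f a) U"
      unfolding f_def[abs_def] by (rule analytic_series_eval[OF bd'[OF a] U(2)])
  next
    fix x i assume x: "x \<in> U"
    note [simp] = series_eval_add[OF _ _ U_le[OF x]]
    define T where "T j k = mfps_const (c i j k) * (mfps_const (p $ k) + mfps_var k) * mfps_deriv j (F a)" for j k
    have coord: "\<exists>N. mbound (\<rho> / 2) N (mfps_var k :: ('k, 'n) mfps)" for k
      using mbound_finite_support[of "{\<lambda>i. if i = k then 1 else 0}" "mfps_var k :: ('k, 'n) mfps" "\<rho> / 2"] \<rho>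
      by (intro exI) (auto simp: mfps_var_def)
    have "\<exists>N. mbound (\<rho> / 2) N (T j k) \<and> series_eval (T j k) (x - p) = c i j k * x $ k * partial_deriv j (f a) x" for j k
    proof -
      obtain N where N: "mbound (\<rho> / 2) N (mfps_var k :: ('k, 'n) mfps)" using coord by blast
      have c1: "mbound (\<rho> / 2) (norm d) (mfps_const d :: ('k, 'n) mfps)" for d
        using \<rho> by (intro mbound_const) auto
      have half: "0 \<le> \<rho> / 2" using \<rho> by simp
      note b1 = mbound_add[OF c1[of "p $ k"] N half]
      note b2 = mbound_mult[OF c1[of "c i j k"] b1 half]
      note b3 = mbound_mult[OF b2 bd_deriv[OF a, of j] half]
      have "series_eval (T j k) (x - p) = c i j k * x $ k * partial_deriv j (f a) x"
        unfolding T_def series_eval_mult[OF b2 bd_deriv[OF a] U_le[OF x]]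
          series_eval_mult[OF c1 b1 U_le[OF x]] series_eval_add[OF c1 N U_le[OF x]] partial[OF a x]
        by simp
      then show ?thesis using b3 unfolding T_def by blast
    qed
    then obtain N where N: "\<And>j k. mbound (\<rho> / 2) (N j k) (T j k)"
      and ev: "\<And>j k. series_eval (T j k) (x - p) = c i j k * x $ k * partial_deriv j (f a) x"
      by metis
    have eval_sum: "series_eval (\<Sum>j\<in>J. H j) (x - p) = (\<Sum>j\<in>J. series_eval (H j) (x - p))"
      if "\<And>j. mbound (\<rho> / 2) (B j) (H j)" "finite J" for J :: "'n set" and H :: "'n \<Rightarrow> ('k, 'n) mfps" and B
      using that(2)
    proof (induction J rule: finite_induct)
      case (insert j J)
      have "mbound (\<rho> / 2) (\<Sum>j\<in>J. B j) (\<Sum>j\<in>J. H j)" using \<rho> that(1) by (intro mbound_sum) auto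
      with that(1)[of j] show ?case using insert by simp
    qed simp
    have "(\<Sum>j\<in>UNIV. \<Sum>k\<in>UNIV. c i j k * x $ k * partial_deriv j (f a) x)
        = series_eval (\<Sum>j\<in>UNIV. \<Sum>k\<in>UNIV. T j k) (x - p)"
    proof (subst eval_sum)
      show "mbound (\<rho> / 2) (\<Sum>k\<in>UNIV. N j k) (\<Sum>k\<in>UNIV. T j k)" for j
        using \<rho> N by (intro mbound_sum) auto
      show "(\<Sum>j\<in>UNIV. \<Sum>k\<in>UNIV. c i j k * x $ k * partial_deriv j (f a) x)
        = (\<Sum>j\<in>UNIV. series_eval (\<Sum>k\<in>UNIV. T j k) (x - p))"
        by (simp add: eval_sum[OF N] ev)
    qed simp
    also have "\<dots> = 0"
      using inv[OF a] unfolding formal_invariant_def T_def by simp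
    finally show "(\<Sum>j\<in>UNIV. \<Sum>k\<in>UNIV. c i j k * x $ k * partial_deriv j (f a) x) = 0" .
  qed
  moreover have "functionally_independent r U f"
    unfolding functionally_independent_def
  proof (intro exI[of _ U] conjI ballI)
    fix x assume x: "x \<in> U"
    show "vec.dim ((\<lambda>a. \<chi> j. partial_deriv j (f a) x) ` {..<r}) = r"
    proof (rule vec.dim_independent_family, rule independent_if_near_identity)
      fix a b assume ab: "a < r" "b < r"
      show "norm (series_eval (G a b) (x - p) - (if a = b then 1 else 0)) < 1 / (real r + 1)"
        by (rule near) (use U(1)[OF x] ab in auto)
    next
      fix \<mu> b assume \<mu>: "(\<Sum>a<r. \<mu> a *s (\<chi> j. partial_deriv j (f a) x)) = 0"
      have G_eval: "series_eval (G a b) (x - p) = (\<Sum>j\<in>UNIV. y b j * partial_deriv j (f a) x)" if a: "a < r" for a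
      proof -
        have "series_eval (\<Sum>j\<in>J. mfps_const (y b j) * mfps_deriv j (F a)) (x - p)
            = (\<Sum>j\<in>J. y b j * partial_deriv j (f a) x)" if "finite J" for J
          using that
        proof (induction J rule: finite_induct)
          case (insert j J)
          have c1: "mbound (\<rho> / 2) (norm (y b j)) (mfps_const (y b j) :: ('k, 'n) mfps)"
            using \<rho> by (intro mbound_const) auto
          have "mbound (\<rho> / 2) (\<Sum>j\<in>J. norm (y b j) * (M / \<rho>)) (\<Sum>j\<in>J. mfps_const (y b j) * mfps_deriv j (F a))"
            using \<rho> a by (intro mbound_sum bd_term) auto
          from series_eval_add[OF bd_term[OF a] this U_le[OF x]] insert show ?case
            by (simp add: series_eval_mult[OF c1 bd_deriv[OF a] U_le[OF x]] partial[OF a x])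
        qed simp
        then show ?thesis unfolding G_def by simp
      qed
      have "(\<Sum>a<r. \<mu> a * series_eval (G a b) (x - p)) = (\<Sum>a<r. \<mu> a * (\<Sum>j\<in>UNIV. y b j * partial_deriv j (f a) x))"
        by (rule sum.cong) (simp_all add: G_eval)
      also have "\<dots> = (\<Sum>j\<in>UNIV. y b j * (\<Sum>a<r. \<mu> a *s (\<chi> j. partial_deriv j (f a) x)) $ j)"
        unfolding sum_distrib_left sum_component vector_smult_component
        by (subst sum.swap) (simp add: mult_ac)
      finally show "(\<Sum>a<r. \<mu> a * series_eval (G a b) (x - p)) = 0" by (simp add: \<mu>)
    qed
  qed (use open_U closure_subset in auto)
  ultimately have ex: "\<exists>U f. open U \<and> connected U \<and> U \<noteq> {} \<and>
      (\<forall>a<r. analytic_invariant c U (f a)) \<and> functionally_independent r U f"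
    using open_U by (intro exI conjI allI impI)
  show ?thesis
    unfolding number_of_analytic_invariants_def
  proof (rule Greatest_le_nat[where b = "CARD('n)"])
    show "\<exists>U f. open U \<and> connected U \<and> U \<noteq> {} \<and>
      (\<forall>a<r. analytic_invariant c U (f a)) \<and> functionally_independent r U f"
      by (rule ex)
  qed (elim exE conjE, rule functionally_independent_le)
qed


section \<open>Nilpotent elements of a Lie algebra\<close>

lemma vector_space_field: "vector_space ((*) :: 'k::field \<Rightarrow> 'k \<Rightarrow> 'k)"
  by unfold_locales (simp_all add: algebra_simps)

lemma obtain_largest_nonzero_index:
  fixes c :: "nat \<Rightarrow> 'a::zero"
  assumes "a < r" "c a \<noteq> 0"
  obtains K where "K < r" "c K \<noteq> 0" "\<And>b. b < r \<Longrightarrow> K < b \<Longrightarrow> c b = 0"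
proof -
  define K where "K = Max {b. b < r \<and> c b \<noteq> 0}"
  have K: "K \<in> {b. b < r \<and> c b \<noteq> 0}" unfolding K_def by (rule Max_in) (use assms in auto)
  have "c b = 0" if "b < r" "K < b" for b
  proof (rule ccontr)
    assume "c b \<noteq> 0"
    then have "b \<le> K" unfolding K_def using that by (intro Max_ge) auto
    then show False using that by simp
  qed
  with K that show ?thesis by blast
qed

context lie_algebra
begin

lemma bracket_linear:
  "bracket (x + y) z = bracket x z + bracket y z" "bracket (smul a x) z = smul a (bracket x z)"
  "bracket z (x + y) = bracket z x + bracket z y" "bracket z (smul a x) = smul a (bracket z x)"
  using linear_left[of z] linear_right[of z] by (simp_all add: Vector_Spaces.linear_iff)

lemma bracket_0 [simp]: "bracket 0 z = 0" "bracket z 0 = 0"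
  using bracket_linear(2)[of 0 0 z] bracket_linear(4)[of z 0 0] by simp_all

lemma bracket_minus: "bracket (- x) z = - bracket x z" "bracket z (- x) = - bracket z x"
  using bracket_linear(2)[of "- 1" x z] bracket_linear(4)[of z "- 1" x] by simp_all

lemma bracket_diff: "bracket (x - y) z = bracket x z - bracket y z" "bracket z (x - y) = bracket z x - bracket z y"
  unfolding diff_conv_add_uminus bracket_linear bracket_minus by simp_all

lemma bracket_sum_right: "bracket z (\<Sum>i\<in>I. f i) = (\<Sum>i\<in>I. bracket z (f i))"
  by (induction I rule: infinite_finite_induct) (simp_all add: bracket_linear)

lemma bracket_sum_left: "bracket (\<Sum>i\<in>I. f i) z = (\<Sum>i\<in>I. bracket (f i) z)"
  by (induction I rule: infinite_finite_induct) (simp_all add: bracket_linear)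

lemma bracket_antisym: "bracket x y = - bracket y x"
proof -
  have "bracket x x + bracket y x + (bracket x y + bracket y y) = 0"
    using alternating[of "x + y"] unfolding bracket_linear .
  then show ?thesis by (simp add: alternating eq_neg_iff_add_eq_0 add.commute)
qed

lemma bracket_derivation: "bracket x (bracket y z) = bracket y (bracket x z) + bracket (bracket x y) z"
proof -
  have "bracket x (bracket y z) + (- bracket y (bracket x z)) + (- bracket (bracket x y) z) = 0"
    using jacobi[of x y z] bracket_antisym[of z x] bracket_antisym[of z "bracket x y"]
    by (simp add: bracket_minus)
  then show ?thesis by (simp add: algebra_simps add_eq_0_iff)
qed

lemma funpow_bracket_linear:
  "(bracket x ^^ k) (y + z) = (bracket x ^^ k) y + (bracket x ^^ k) z"
  "(bracket x ^^ k) (smul a y) = smul a ((bracket x ^^ k) y)"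
  "(bracket x ^^ k) 0 = 0"
  by (induction k) (simp_all add: bracket_linear)

lemma funpow_bracket_diff: "(bracket x ^^ k) (y - z) = (bracket x ^^ k) y - (bracket x ^^ k) z"
  by (induction k) (simp_all add: bracket_diff)

lemma funpow_bracket_sum: "(bracket x ^^ k) (\<Sum>i\<in>I. f i) = (\<Sum>i\<in>I. (bracket x ^^ k) (f i))"
  by (induction I rule: infinite_finite_induct) (simp_all add: funpow_bracket_linear)

lemma funpow_bracket_ideal: "lie_ideal A \<Longrightarrow> y \<in> A \<Longrightarrow> (bracket x ^^ k) y \<in> A"
  by (induction k) (auto simp: lie_ideal_def)

lemma basis_sum:
  assumes "is_basis (e :: 'n::finite \<Rightarrow> 'l)"
  shows "x = (\<Sum>i\<in>UNIV. smul (representation (range e) x (e i)) (e i))"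
proof -
  have "x = (\<Sum>b\<in>range e. smul (representation (range e) x b) b)"
    using assms unfolding is_basis_def by (subst sum_representation_eq) auto
  then show ?thesis
    using assms unfolding is_basis_def by (simp add: sum.reindex)
qed

lemma representation_linear:
  assumes "is_basis (e :: 'n::finite \<Rightarrow> 'l)"
  shows "representation (range e) (x + y) b = representation (range e) x b + representation (range e) y b"
    and "representation (range e) (smul a x) b = a * representation (range e) x b"
    and "representation (range e) 0 b = 0"
  using assms unfolding is_basis_def
  by (simp_all add: representation_add representation_scale representation_zero)

lemma dim_eq_card_basis:
  assumes "is_basis (e :: 'n::finite \<Rightarrow> 'l)"
  shows "dim UNIV = CARD('n)"
  using assms dim_eq_card[of "range e" UNIV] unfolding is_basis_def by (simp add: card_image)

text \<open>The powers of \<open>ad x\<close> live in the finite-dimensional space of matrices.\<close>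

lemma powers_of_ad_dependent:
  assumes "is_basis (e :: 'n::finite \<Rightarrow> 'l)"
  shows "\<exists>N \<mu>. \<mu> N \<noteq> 0 \<and> (\<forall>y. (\<Sum>a\<le>N. smul (\<mu> a) ((bracket x ^^ a) y)) = 0)"
proof -
  define T :: "nat \<Rightarrow> 'k ^ ('n \<times> 'n)" where
    "T a = (\<chi> ij. representation (range e) ((bracket x ^^ a) (e (fst ij))) (e (snd ij)))" for a
  define r where "r = CARD('n \<times> 'n) + 1"
  have "\<not> (\<forall>\<mu>. (\<Sum>a<r. \<mu> a *s T a) = 0 \<longrightarrow> (\<forall>a<r. \<mu> a = 0))"
  proof
    assume "\<forall>\<mu>. (\<Sum>a<r. \<mu> a *s T a) = 0 \<longrightarrow> (\<forall>a<r. \<mu> a = 0)"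
    then have "vec.dim (T ` {..<r}) = r" by (intro vec.dim_independent_family) blast
    then show False using vec_dim_le[of "T ` {..<r}"] by (simp add: r_def)
  qed
  then obtain \<mu> where \<mu>: "(\<Sum>a<r. \<mu> a *s T a) = 0" and "\<not> (\<forall>a<r. \<mu> a = 0)" by blast
  then obtain a0 where a0: "a0 < r" "\<mu> a0 \<noteq> 0" by blast
  obtain N where N: "N < r" "\<mu> N \<noteq> 0" and gt: "\<And>a. a < r \<Longrightarrow> N < a \<Longrightarrow> \<mu> a = 0"
    by (rule obtain_largest_nonzero_index[where c = \<mu>, OF a0]) blast
  have on_basis: "(\<Sum>a\<le>N. smul (\<mu> a) ((bracket x ^^ a) (e i))) = 0" for i
  proof -
    have "(\<Sum>a\<le>N. smul (\<mu> a) ((bracket x ^^ a) (e i))) = (\<Sum>a<r. smul (\<mu> a) ((bracket x ^^ a) (e i)))"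
      by (rule sum.mono_neutral_left) (use N gt in auto)
    moreover have "representation (range e) (\<Sum>a<r. smul (\<mu> a) ((bracket x ^^ a) (e i))) (e j) = 0" for j
    proof -
      have "representation (range e) (\<Sum>a\<in>A. smul (\<mu> a) ((bracket x ^^ a) (e i))) (e j)
          = (\<Sum>a\<in>A. \<mu> a *s T a) $ (i, j)" for A
        by (induction A rule: infinite_finite_induct)
          (simp_all add: representation_linear[OF assms] T_def)
      from this[of "{..<r}"] show ?thesis unfolding \<mu> by simp
    qed
    ultimately show ?thesis
      by (subst basis_sum[OF assms]) simp
  qed
  have "(\<Sum>a\<le>N. smul (\<mu> a) ((bracket x ^^ a) y)) = 0" for y
  proof -
    have "(\<Sum>a\<le>N. smul (\<mu> a) ((bracket x ^^ a) y))
        = (\<Sum>a\<le>N. smul (\<mu> a) ((bracket x ^^ a) (\<Sum>i\<in>UNIV. smul (representation (range e) y (e i)) (e i))))"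
      by (subst basis_sum[OF assms, of y]) simp
    also have "\<dots> = (\<Sum>i\<in>UNIV. smul (representation (range e) y (e i)) (\<Sum>a\<le>N. smul (\<mu> a) ((bracket x ^^ a) (e i))))"
      unfolding funpow_bracket_sum funpow_bracket_linear scale_sum_right
      by (subst sum.swap) (simp add: mult.commute)
    finally show ?thesis by (simp add: on_basis)
  qed
  with N show ?thesis by blast
qed

text \<open>Take a relation of least degree between the powers of \<open>ad x\<close>. Commuting it with \<open>ad h\<close>
  multiplies the coefficient of the \<open>a\<close>-th power by \<open>2a\<close>; subtracting this from \<open>2N\<close> times the
  original relation removes the leading term, so by minimality all other coefficients vanish too.\<close>

lemma ad_nilpotent:
  assumes "is_basis (e :: 'n::finite \<Rightarrow> 'l)" and HE: "bracket h x = smul 2 x"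
    and char_0: "\<And>n. n > 0 \<Longrightarrow> (of_nat n :: 'k) \<noteq> 0"
  shows "\<exists>N. \<forall>y. (bracket x ^^ N) y = 0"
proof -
  define P where "P N \<longleftrightarrow> (\<exists>\<mu>. \<mu> N \<noteq> 0 \<and> (\<forall>y. (\<Sum>a\<le>N. smul (\<mu> a) ((bracket x ^^ a) y)) = 0))" for N
  have "\<exists>N. P N" using powers_of_ad_dependent[OF assms(1)] unfolding P_def by blast
  then obtain N where N: "P N" and min: "\<And>N'. P N' \<Longrightarrow> N \<le> N'"
    by (metis LeastI_ex Least_le)
  obtain \<mu> where \<mu>N: "\<mu> N \<noteq> 0" and \<mu>: "\<And>y. (\<Sum>a\<le>N. smul (\<mu> a) ((bracket x ^^ a) y)) = 0"
    using N unfolding P_def by blast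
  have comm: "bracket h ((bracket x ^^ a) y) = (bracket x ^^ a) (bracket h y) + smul (2 * of_nat a) ((bracket x ^^ a) y)" for a y
  proof (induction a)
    case (Suc a)
    have "bracket h (bracket x z) = bracket x (bracket h z) + smul 2 (bracket x z)" for z
      using bracket_derivation[of h x z] by (simp add: HE bracket_linear)
    then show ?case using Suc by (simp add: bracket_linear algebra_simps)
  qed simp
  have weighted: "(\<Sum>a\<le>N. smul (2 * of_nat a * \<mu> a) ((bracket x ^^ a) y)) = 0" for y
  proof -
    have "0 = bracket h (\<Sum>a\<le>N. smul (\<mu> a) ((bracket x ^^ a) y))" by (simp add: \<mu>)
    also have "\<dots> = (\<Sum>a\<le>N. smul (\<mu> a) ((bracket x ^^ a) (bracket h y)))
        + (\<Sum>a\<le>N. smul (2 * of_nat a * \<mu> a) ((bracket x ^^ a) y))"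
      unfolding bracket_sum_right bracket_linear comm
      by (simp add: scale_right_distrib sum.distrib mult.commute)
    finally show ?thesis by (simp add: \<mu>)
  qed
  have lower: "\<mu> a = 0" if "a < N" for a
  proof (rule ccontr)
    assume a: "\<mu> a \<noteq> 0"
    obtain K where K: "K < N" "\<mu> K \<noteq> 0" and gt: "\<And>b. b < N \<Longrightarrow> K < b \<Longrightarrow> \<mu> b = 0"
      by (rule obtain_largest_nonzero_index[where c = \<mu>, OF \<open>a < N\<close> a]) blast
    define \<nu> where "\<nu> b = 2 * (of_nat N - of_nat b) * \<mu> b" for b
    have "(\<Sum>b\<le>K. smul (\<nu> b) ((bracket x ^^ b) y)) = 0" for y
    proof -
      have "(\<Sum>b\<le>K. smul (\<nu> b) ((bracket x ^^ b) y)) = (\<Sum>b\<le>N. smul (\<nu> b) ((bracket x ^^ b) y))"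
      proof (rule sum.mono_neutral_left)
        show "\<forall>b\<in>{..N} - {..K}. smul (\<nu> b) ((bracket x ^^ b) y) = 0"
        proof
          fix b assume "b \<in> {..N} - {..K}"
          then have "b = N \<or> \<mu> b = 0" using gt[of b] by (cases "b = N") auto
          then show "smul (\<nu> b) ((bracket x ^^ b) y) = 0" by (auto simp: \<nu>_def)
        qed
      qed (use K in auto)
      also have "\<dots> = smul (2 * of_nat N) (\<Sum>b\<le>N. smul (\<mu> b) ((bracket x ^^ b) y))
          - (\<Sum>b\<le>N. smul (2 * of_nat b * \<mu> b) ((bracket x ^^ b) y))"
        unfolding scale_sum_right sum_subtractf[symmetric]
      proof (rule sum.cong[OF refl])
        fix b
        have "\<nu> b = 2 * of_nat N * \<mu> b - 2 * of_nat b * \<mu> b"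
          by (simp add: \<nu>_def algebra_simps)
        then show "smul (\<nu> b) ((bracket x ^^ b) y) = smul (2 * of_nat N) (smul (\<mu> b) ((bracket x ^^ b) y))
            - smul (2 * of_nat b * \<mu> b) ((bracket x ^^ b) y)"
          by (simp only: scale_scale scale_left_diff_distrib)
      qed
      finally show ?thesis by (simp add: \<mu> weighted)
    qed
    moreover have "\<nu> K \<noteq> 0"
    proof -
      have "(of_nat (2 * (N - K)) :: 'k) \<noteq> 0" using K by (intro char_0) auto
      moreover have "(of_nat (2 * (N - K)) :: 'k) = 2 * (of_nat N - of_nat K)"
        using K by (simp add: of_nat_diff)
      ultimately show ?thesis using K by (auto simp: \<nu>_def)
    qed
    ultimately have "P K" unfolding P_def by blast
    then show False using min[of K] K by simp
  qed
  have "(bracket x ^^ N) y = 0" for y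
  proof -
    have "(\<Sum>a\<le>N. smul (\<mu> a) ((bracket x ^^ a) y)) = (\<Sum>a\<in>{N}. smul (\<mu> a) ((bracket x ^^ a) y))"
      by (rule sum.mono_neutral_right) (use lower in auto)
    then show ?thesis using \<mu>[of y] \<mu>N by simp
  qed
  then show ?thesis by blast
qed

end


section \<open>Irreducible modules of sl(2)\<close>

text \<open>The normal form of the Lie algebra. Linear independence of \<open>E, H, F, v\<^sub>0, \<dots>, v\<^sub>m\<close> is expressed
  dually, by the existence of functionals with prescribed values, because functionals are what is
  used later: as base points in \<open>L\<^sup>*\<close> and as directions of differentiation. For \<open>k = 0\<close> and \<open>k = m\<close>
  the vectors \<open>v (k - 1)\<close> and \<open>v (Suc k)\<close> occur with coefficient zero. The basis \<open>e\<close> is the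
  arbitrary one in which the structure constants are taken.\<close>

locale adapted_basis = lie_algebra smul bracket
  for smul :: "'k::field_char_0 \<Rightarrow> 'l::ab_group_add \<Rightarrow> 'l" and bracket +
  fixes e :: "'n::finite \<Rightarrow> 'l" and E H F :: 'l and v :: "nat \<Rightarrow> 'l" and m :: nat
  assumes basis: "is_basis e"
    and HE: "bracket H E = smul 2 E" and HF: "bracket H F = smul (- 2) F" and EF: "bracket E F = H"
    and Ev: "k \<le> m \<Longrightarrow> bracket E (v k) = smul (of_nat k) (v (k - 1))"
    and Hv: "k \<le> m \<Longrightarrow> bracket H (v k) = smul (of_nat m - 2 * of_nat k) (v k)"
    and Fv: "k \<le> m \<Longrightarrow> bracket F (v k) = smul (of_nat m - of_nat k) (v (Suc k))"
    and vv: "k \<le> m \<Longrightarrow> l \<le> m \<Longrightarrow> bracket (v k) (v l) = 0"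
    and functional_with_values: "\<exists>g. Vector_Spaces.linear smul (*) g \<and>
      g E = \<alpha> \<and> g H = \<beta> \<and> g F = \<gamma> \<and> (\<forall>k\<le>m. g (v k) = a k)"
    and span_eq: "span ({E, H, F} \<union> v ` {..m}) = UNIV"
    and card_eq: "CARD('n) = m + 4"

context sl2_semidirect_sum
begin

lemma sl2_triple_exists:
  "\<exists>E H F. E \<in> S \<and> H \<in> S \<and> F \<in> S \<and>
     bracket H E = smul 2 E \<and> bracket H F = smul (- 2) F \<and> bracket E F = H \<and>
     (\<forall>\<alpha> \<beta> \<gamma>. smul \<alpha> E + smul \<beta> H + smul \<gamma> F = 0 \<longrightarrow> \<alpha> = 0 \<and> \<beta> = 0 \<and> \<gamma> = 0) \<and>
     (\<forall>s\<in>S. \<exists>\<alpha> \<beta> \<gamma>. s = smul \<alpha> E + smul \<beta> H + smul \<gamma> F)"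
proof -
  obtain \<phi> :: "'k ^ 2 ^ 2 \<Rightarrow> 'l" where bij: "bij_betw \<phi> sl2 S"
    and add: "\<And>A B. A \<in> sl2 \<Longrightarrow> B \<in> sl2 \<Longrightarrow> \<phi> (A + B) = \<phi> A + \<phi> B"
    and scale: "\<And>A a. A \<in> sl2 \<Longrightarrow> \<phi> (\<chi> i j. a * A $ i $ j) = smul a (\<phi> A)"
    and br: "\<And>A B. A \<in> sl2 \<Longrightarrow> B \<in> sl2 \<Longrightarrow> \<phi> (A ** B - B ** A) = bracket (\<phi> A) (\<phi> B)"
    using sl2 unfolding is_sl2_def by blast
  define mat4 :: "'k \<Rightarrow> 'k \<Rightarrow> 'k \<Rightarrow> 'k ^ 2 ^ 2" where
    "mat4 \<alpha> \<beta> \<gamma> = vector [vector [\<beta>, \<alpha>], vector [\<gamma>, - \<beta>]]" for \<alpha> \<beta> \<gamma>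
  have mat4_nth: "mat4 \<alpha> \<beta> \<gamma> $ 1 $ 1 = \<beta>" "mat4 \<alpha> \<beta> \<gamma> $ 1 $ 2 = \<alpha>"
      "mat4 \<alpha> \<beta> \<gamma> $ 2 $ 1 = \<gamma>" "mat4 \<alpha> \<beta> \<gamma> $ 2 $ 2 = - \<beta>" for \<alpha> \<beta> \<gamma>
    by (simp_all add: mat4_def)
  have in_sl2: "mat4 \<alpha> \<beta> \<gamma> \<in> sl2" for \<alpha> \<beta> \<gamma>
    by (simp add: sl2_def trace_def sum_2 mat4_nth)
  have sl2_eq: "\<exists>\<alpha> \<beta> \<gamma>. A = mat4 \<alpha> \<beta> \<gamma>" if "A \<in> sl2" for A :: "'k ^ 2 ^ 2"
  proof -
    have "A $ 2 $ 2 = - A $ 1 $ 1"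
      using that by (simp add: sl2_def trace_def sum_2 eq_neg_iff_add_eq_0 add.commute)
    then have "A = mat4 (A $ 1 $ 2) (A $ 1 $ 1) (A $ 2 $ 1)"
      by (simp add: vec_eq_iff forall_2 mat4_nth)
    then show ?thesis by blast
  qed
  define E H F where "E = \<phi> (mat4 1 0 0)" and "H = \<phi> (mat4 0 1 0)" and "F = \<phi> (mat4 0 0 1)"
  have comb: "\<phi> (mat4 \<alpha> \<beta> \<gamma>) = smul \<alpha> E + smul \<beta> H + smul \<gamma> F" for \<alpha> \<beta> \<gamma>
  proof -
    have 1: "(\<chi> i j. \<alpha> * mat4 1 0 0 $ i $ j) = mat4 \<alpha> 0 0" "(\<chi> i j. \<beta> * mat4 0 1 0 $ i $ j) = mat4 0 \<beta> 0"
      "(\<chi> i j. \<gamma> * mat4 0 0 1 $ i $ j) = mat4 0 0 \<gamma>"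
      by (simp_all add: vec_eq_iff forall_2 mat4_nth)
    have 2: "mat4 \<alpha> \<beta> \<gamma> = mat4 \<alpha> 0 0 + mat4 0 \<beta> 0 + mat4 0 0 \<gamma>"
      and 3: "mat4 \<alpha> 0 0 + mat4 0 \<beta> 0 = mat4 \<alpha> \<beta> 0"
      by (simp_all add: vec_eq_iff forall_2 mat4_nth)
    have "\<phi> (mat4 \<alpha> \<beta> \<gamma>) = \<phi> (mat4 \<alpha> \<beta> 0) + \<phi> (mat4 0 0 \<gamma>)"
      unfolding 2 3 by (rule add[OF in_sl2 in_sl2])
    also have "\<phi> (mat4 \<alpha> \<beta> 0) = \<phi> (mat4 \<alpha> 0 0) + \<phi> (mat4 0 \<beta> 0)"
      unfolding 3[symmetric] by (rule add[OF in_sl2 in_sl2])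
    finally show ?thesis
      using scale[OF in_sl2, of \<alpha> 1 0 0] scale[OF in_sl2, of \<beta> 0 1 0] scale[OF in_sl2, of \<gamma> 0 0 1]
      by (simp add: 1 E_def H_def F_def)
  qed
  have img: "\<phi> A \<in> S" if "A \<in> sl2" for A using bij that by (auto simp: bij_betw_def)
  have products: "mat4 0 1 0 ** mat4 1 0 0 - mat4 1 0 0 ** mat4 0 1 0 = mat4 2 0 0"
    "mat4 0 1 0 ** mat4 0 0 1 - mat4 0 0 1 ** mat4 0 1 0 = mat4 0 0 (- 2)"
    "mat4 1 0 0 ** mat4 0 0 1 - mat4 0 0 1 ** mat4 1 0 0 = mat4 0 1 0"
    by (simp_all add: vec_eq_iff forall_2 matrix_matrix_mult_def sum_2 mat4_nth)
  note defs = E_def[symmetric] H_def[symmetric] F_def[symmetric]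
  have HE: "bracket H E = smul 2 E"
    using br[OF in_sl2[of 0 1 0] in_sl2[of 1 0 0]] unfolding products defs comb by simp
  have HF: "bracket H F = smul (- 2) F"
    using br[OF in_sl2[of 0 1 0] in_sl2[of 0 0 1]] unfolding products defs comb by simp
  have EF: "bracket E F = H"
    using br[OF in_sl2[of 1 0 0] in_sl2[of 0 0 1]] unfolding products defs comb by simp
  have indep: "\<alpha> = 0 \<and> \<beta> = 0 \<and> \<gamma> = 0" if "smul \<alpha> E + smul \<beta> H + smul \<gamma> F = 0" for \<alpha> \<beta> \<gamma>
  proof -
    have "\<phi> (mat4 \<alpha> \<beta> \<gamma>) = \<phi> (mat4 0 0 0)" using that by (simp add: comb)
    then have "mat4 \<alpha> \<beta> \<gamma> = mat4 0 0 0" using bij in_sl2 by (auto simp: bij_betw_def inj_on_def)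
    then show ?thesis by (metis mat4_nth(1-3))
  qed
  have span: "\<exists>\<alpha> \<beta> \<gamma>. s = smul \<alpha> E + smul \<beta> H + smul \<gamma> F" if "s \<in> S" for s
  proof -
    have "s \<in> \<phi> ` sl2" using bij that by (simp add: bij_betw_def)
    then obtain A where "A \<in> sl2" "s = \<phi> A" by blast
    then show ?thesis using sl2_eq[of A] comb by blast
  qed
  have S: "E \<in> S" "H \<in> S" "F \<in> S" by (simp_all add: E_def H_def F_def img in_sl2)
  show ?thesis
    by (rule exI[of _ E], rule exI[of _ H], rule exI[of _ F],
        intro conjI allI impI ballI S HE HF EF; (erule span | drule indep, simp))
qed

lemma R_ideal: "lie_ideal R" and R_subspace: "subspace R"
  using semidirect_sum unfolding semidirect_sum_def is_radical_def lie_ideal_def by blast+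

lemma R_nontrivial: "\<exists>w\<in>R. w \<noteq> 0"
  using irreducible subspace_0[OF R_subspace] unfolding irreducible_on_def by blast

lemma invariant_subspace_trivial:
  assumes "subspace W" "W \<subseteq> R" "\<And>s w. s \<in> S \<Longrightarrow> w \<in> W \<Longrightarrow> bracket s w \<in> W"
  shows "W = {0} \<or> W = R"
proof -
  have "\<pi> s w = bracket s w" if "s \<in> S" "w \<in> R" for s w
    using semidirect_sum that unfolding semidirect_sum_def by metis
  then have "\<forall>s\<in>S. \<forall>w\<in>W. \<pi> s w \<in> W" using assms by (metis subsetD)
  then show ?thesis using irreducible assms unfolding irreducible_on_def by blast
qed

text \<open>\<open>[R, R]\<close> is an invariant subspace; if it were \<open>R\<close>, the derived series of \<open>R\<close> would be constant.\<close>

lemma R_abelian: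
  assumes "x \<in> R" "y \<in> R"
  shows "bracket x y = 0"
proof -
  define D where "D = {bracket x y | x y. x \<in> R \<and> y \<in> R}"
  have DR: "D \<subseteq> R" using R_ideal unfolding D_def lie_ideal_def by blast
  have "bracket s w \<in> span D" if "w \<in> span D" for s w
    using that
  proof (induction rule: span_induct_alt)
    case base
    then show ?case by (simp add: span_zero)
  next
    case (step c w u)
    then obtain x y where xy: "w = bracket x y" "x \<in> R" "y \<in> R" by (auto simp: D_def)
    have "bracket s w = bracket x (bracket s y) + bracket (bracket s x) y"
      unfolding xy by (rule bracket_derivation)
    also have "\<dots> \<in> span D"
      using R_ideal xy by (intro span_add span_base) (auto simp: D_def lie_ideal_def)
    finally show ?case by (simp add: bracket_linear span_add span_scale step)
  qed
  then consider "span D = {0}" | "span D = R"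
    using invariant_subspace_trivial[of "span D"] span_minimal[OF DR R_subspace] by auto
  then show ?thesis
  proof cases
    case 1
    have "bracket x y \<in> span D" using assms by (intro span_base) (auto simp: D_def)
    then show ?thesis using 1 by simp
  next
    case 2
    have "derived_series n R = R" for n
      by (induction n) (simp_all add: 2 D_def[symmetric])
    then have "R = {0}"
      using semidirect_sum unfolding semidirect_sum_def is_radical_def solvable_def by metis
    then show ?thesis using R_nontrivial by auto
  qed
qed

text \<open>Among the nonzero vectors of \<open>R\<close> killed by \<open>E\<close> take \<open>w\<close> with the shortest string
  \<open>w, F w, \<dots>, F\<^sup>m w \<noteq> 0 = F\<^bsup>m+1\<^esup> w\<close>. The vector \<open>H w - m w\<close> is again killed by \<open>E\<close>, and also by
  \<open>F\<^sup>m\<close>, because \<open>0 = E F\<^bsup>m+1\<^esup> w = (m + 1) F\<^sup>m (H w - m w)\<close>; by minimality it is zero. So \<open>w\<close> is a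
  highest weight vector, its string spans an invariant subspace, which is \<open>R\<close>, and rescaling the
  string gives the \<open>v\<^sub>k\<close>.\<close>

lemma adapted_basis_exists:
  fixes e :: "'n::finite \<Rightarrow> 'l"
  assumes basis: "is_basis e"
  shows "\<exists>E H F v m. adapted_basis smul bracket e E H F v m \<and> dim R = m + 1"
proof -
  obtain E H F where S: "E \<in> S" "H \<in> S" "F \<in> S"
    and HE: "bracket H E = smul 2 E" and HF: "bracket H F = smul (- 2) F" and EF: "bracket E F = H"
    and indep_S: "\<And>\<alpha> \<beta> \<gamma>. smul \<alpha> E + smul \<beta> H + smul \<gamma> F = 0 \<Longrightarrow> \<alpha> = 0 \<and> \<beta> = 0 \<and> \<gamma> = 0"
    and span_S: "\<And>s. s \<in> S \<Longrightarrow> \<exists>\<alpha> \<beta> \<gamma>. s = smul \<alpha> E + smul \<beta> H + smul \<gamma> F"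
    using sl2_triple_exists by metis
  have char_0: "(of_nat n :: 'k) \<noteq> 0" if "n > 0" for n using that by simp
  obtain NE where NE: "\<And>y. (bracket E ^^ NE) y = 0"
    using ad_nilpotent[OF basis HE char_0] by blast
  have "bracket (- H) F = smul 2 F" using HF by (simp add: bracket_minus)
  then obtain NF where NF: "\<And>y. (bracket F ^^ NF) y = 0"
    using ad_nilpotent[OF basis _ char_0] by blast
  \<comment> \<open>A nonzero vector of \<open>R\<close> killed by \<open>E\<close>, with the shortest possible string under \<open>F\<close>.\<close>
  obtain w0 where w0: "w0 \<in> R" "w0 \<noteq> 0" using R_nontrivial by blast
  define Q where "Q n \<longleftrightarrow> (\<exists>w\<in>R. w \<noteq> 0 \<and> bracket E w = 0 \<and> (bracket F ^^ n) w = 0)" for n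
  have "Q NF"
  proof -
    define n where "n = (LEAST n. (bracket E ^^ n) w0 = 0)"
    have n: "(bracket E ^^ n) w0 = 0" unfolding n_def by (rule LeastI) (rule NE)
    then obtain n' where n': "n = Suc n'" using w0 by (cases n) auto
    have "(bracket E ^^ n') w0 \<noteq> 0"
    proof
      assume "(bracket E ^^ n') w0 = 0"
      then have "n \<le> n'" unfolding n_def by (rule Least_le)
      then show False using n' by simp
    qed
    moreover have "bracket E ((bracket E ^^ n') w0) = 0" using n n' by simp
    ultimately show ?thesis
      unfolding Q_def using funpow_bracket_ideal[OF R_ideal w0(1)] NF by blast
  qed
  then obtain N where N: "Q N" and N_min: "\<And>n. Q n \<Longrightarrow> N \<le> n" by (metis LeastI Least_le)
  then obtain w where w: "w \<in> R" "w \<noteq> 0" "bracket E w = 0" and FN: "(bracket F ^^ N) w = 0"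
    unfolding Q_def by blast
  obtain m where m: "N = Suc m" using FN w by (cases N) auto
  have H_F: "bracket H ((bracket F ^^ k) x) = (bracket F ^^ k) (bracket H x) - smul (2 * of_nat k) ((bracket F ^^ k) x)" for k x
  proof (induction k)
    case (Suc k)
    have "bracket H (bracket F z) = bracket F (bracket H z) + smul (- 2) (bracket F z)" for z
      using bracket_derivation[of H F z] by (simp add: HF bracket_linear del: scale_minus_left)
    from this[of "(bracket F ^^ k) x"] Suc show ?case
      by (simp add: bracket_linear bracket_diff algebra_simps)
  qed simp
  have E_F: "bracket E ((bracket F ^^ Suc k) x) =
      smul (of_nat (Suc k)) ((bracket F ^^ k) (bracket H x - smul (of_nat k) x))" if x: "bracket E x = 0" for k x
  proof (induction k)
    case 0
    then show ?case using bracket_derivation[of E F x] x by (simp add: EF)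
  next
    case (Suc k)
    have "bracket E ((bracket F ^^ Suc (Suc k)) x)
        = bracket F (bracket E ((bracket F ^^ Suc k) x)) + bracket H ((bracket F ^^ Suc k) x)"
      using bracket_derivation[of E F "(bracket F ^^ Suc k) x"] by (simp add: EF)
    also have "\<dots> = smul (of_nat (Suc k)) ((bracket F ^^ Suc k) (bracket H x) - smul (of_nat k) ((bracket F ^^ Suc k) x))
        + ((bracket F ^^ Suc k) (bracket H x) - smul (2 * of_nat (Suc k)) ((bracket F ^^ Suc k) x))"
      unfolding Suc H_F by (simp add: bracket_linear bracket_diff funpow_bracket_diff funpow_bracket_linear)
    also have "\<dots> = smul (of_nat (Suc (Suc k))) ((bracket F ^^ Suc k) (bracket H x - smul (of_nat (Suc k)) x))"
    proof -
      define A B where "A = (bracket F ^^ Suc k) (bracket H x)" and "B = (bracket F ^^ Suc k) x"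
      have A: "smul (of_nat (Suc (Suc k))) A = smul (of_nat (Suc k)) A + A"
        using scale_left_distrib[of 1 "of_nat (Suc k)" A]
        by (simp only: of_nat_Suc[of "Suc k"] scale_one add.commute)
      have "of_nat (Suc (Suc k)) * of_nat (Suc k) = of_nat (Suc k) * of_nat k + 2 * (of_nat (Suc k) :: 'k)"
        by (simp add: algebra_simps)
      then have B: "smul (of_nat (Suc (Suc k)) * of_nat (Suc k)) B
          = smul (of_nat (Suc k) * of_nat k) B + smul (2 * of_nat (Suc k)) B"
        by (simp only: scale_left_distrib)
      show ?thesis
        unfolding funpow_bracket_diff funpow_bracket_linear(2) A_def[symmetric] B_def[symmetric]
          scale_right_diff_distrib scale_scale A B
        by (simp only: add_diff_eq diff_add_eq diff_diff_eq)
    qed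
    finally show ?case .
  qed
  have Hw: "bracket H w = smul (of_nat m) w"
  proof (rule ccontr)
    define u where "u = bracket H w - smul (of_nat m) w"
    assume "bracket H w \<noteq> smul (of_nat m) w"
    then have "u \<noteq> 0" by (simp add: u_def)
    moreover have "u \<in> R"
      using w R_ideal R_subspace unfolding u_def lie_ideal_def by (simp add: subspace_diff subspace_scale)
    moreover have "bracket E u = 0"
    proof -
      have "bracket E H = - smul 2 E" using bracket_antisym[of E H] HE by simp
      then have "bracket E (bracket H w) = 0"
        using bracket_derivation[of E H w] w by (simp add: bracket_minus bracket_linear)
      then show ?thesis using w by (simp add: u_def bracket_diff bracket_linear)
    qed
    moreover have "(bracket F ^^ m) u = 0"
    proof -
      have "smul (of_nat (Suc m)) ((bracket F ^^ m) u) = 0"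
        using E_F[OF w(3), of m] FN unfolding u_def m by simp
      then show ?thesis using char_0[of "Suc m"] by (simp del: of_nat_Suc)
    qed
    ultimately have "Q m" unfolding Q_def by blast
    then show False using N_min[of m] m by simp
  qed
  define v where "v k = smul (fact (m - k) / fact m) ((bracket F ^^ k) w)" for k
  have v_R: "v k \<in> R" for k
    unfolding v_def using funpow_bracket_ideal[OF R_ideal w(1)] R_subspace by (simp add: subspace_scale)
  have v0: "v 0 = w" by (simp add: v_def)
  have Hv: "bracket H (v k) = smul (of_nat m - 2 * of_nat k) (v k)" for k
    unfolding v_def bracket_linear H_F Hw funpow_bracket_linear by (simp add: algebra_simps)
  have Fv: "bracket F (v k) = smul (of_nat m - of_nat k) (v (Suc k))" if k: "k \<le> m" for k
  proof (cases "k = m")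
    case True
    have "bracket F ((bracket F ^^ m) w) = 0" using FN by (simp add: m)
    then show ?thesis using True by (simp add: v_def bracket_linear)
  next
    case False
    then have "m - k = Suc (m - Suc k)" using k by simp
    then have "(fact (m - k) :: 'k) = (of_nat m - of_nat k) * fact (m - Suc k)"
      using k by (simp only: fact_Suc) (simp add: of_nat_diff)
    then show ?thesis by (simp add: v_def bracket_linear)
  qed
  have Ev: "bracket E (v k) = smul (of_nat k) (v (k - 1))" if k: "k \<le> m" for k
  proof (cases k)
    case 0
    then show ?thesis using w by (simp add: v0)
  next
    case (Suc l)
    have "(bracket F ^^ l) (bracket H w - smul (of_nat l) w) = smul (of_nat m - of_nat l) ((bracket F ^^ l) w)"
      by (simp add: Hw funpow_bracket_linear funpow_bracket_diff scale_left_diff_distrib)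
    then have "bracket E (v k) = smul (fact (m - k) / fact m * of_nat k * (of_nat m - of_nat l)) ((bracket F ^^ l) w)"
      using E_F[OF w(3), of l] Suc by (simp add: v_def bracket_linear mult_ac del: funpow.simps of_nat_Suc)
    moreover have "m - l = Suc (m - k)" using k Suc by simp
    then have "(fact (m - l) :: 'k) = (of_nat m - of_nat l) * fact (m - k)"
      using k Suc by (simp only: fact_Suc) (simp add: of_nat_diff)
    ultimately show ?thesis using Suc by (simp add: v_def mult_ac)
  qed
  have span_v: "span (v ` {..m}) = R"
  proof -
    have gen: "bracket s x \<in> span (v ` {..m})"
      if s: "s \<in> {E, H, F}" and x: "x \<in> span (v ` {..m})" for s x
      using x
    proof (induction rule: span_induct_alt)
      case base
      then show ?case by (simp add: span_zero)
    next
      case (step c y z)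
      then obtain k where k: "y = v k" "k \<le> m" by auto
      have "bracket s (v k) \<in> span (v ` {..m})"
      proof -
        consider "s = E" | "s = H" | "s = F" using s by blast
        then show ?thesis
        proof cases
          case 1
          show ?thesis
            unfolding 1 Ev[OF k(2)] by (intro span_scale span_base imageI) (use k in auto)
        next
          case 2
          show ?thesis
            unfolding 2 Hv by (intro span_scale span_base imageI) (use k in auto)
        next
          case 3
          show ?thesis
          proof (cases "k = m")
            case True
            then show ?thesis using 3 k Fv[of k] by (simp add: span_zero)
          next
            case False
            then show ?thesis
              unfolding 3 Fv[OF k(2)] by (intro span_scale span_base imageI) (use k in auto)
          qed
        qed
      qed
      then show ?case using step k by (simp add: bracket_linear span_add span_scale)
    qed
    have "bracket s x \<in> span (v ` {..m})" if "s \<in> S" "x \<in> span (v ` {..m})" for s x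
    proof -
      obtain \<alpha> \<beta> \<gamma> where "s = smul \<alpha> E + smul \<beta> H + smul \<gamma> F" using span_S[OF \<open>s \<in> S\<close>] by blast
      then show ?thesis using gen[OF _ that(2)] by (simp add: bracket_linear span_add span_scale)
    qed
    then consider "span (v ` {..m}) = {0}" | "span (v ` {..m}) = R"
      using invariant_subspace_trivial[of "span (v ` {..m})"] span_minimal[OF _ R_subspace] v_R by blast
    then show ?thesis
    proof cases
      case 1
      have "v 0 \<in> span (v ` {..m})" by (intro span_base) auto
      then show ?thesis using 1 v0 w by simp
    qed
  qed
  \<comment> \<open>\<open>E\<^sup>K\<close> isolates the coefficient of \<open>v\<^sub>K\<close> in a combination in which no later vector occurs.\<close>
  have E_powers: "k \<le> m \<Longrightarrow> (k < j \<longrightarrow> (bracket E ^^ j) (v k) = 0) \<and> (k = j \<longrightarrow> (bracket E ^^ j) (v k) = smul (fact j) w)" for j k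
  proof (induction j arbitrary: k)
    case 0
    then show ?case by (simp add: v0)
  next
    case (Suc j)
    have "(bracket E ^^ Suc j) (v k) = smul (of_nat k) ((bracket E ^^ j) (v (k - 1)))"
      unfolding funpow_Suc_right o_def using Ev[OF Suc.prems] by (simp add: funpow_bracket_linear)
    then show ?case using Suc.IH[of "k - 1"] Suc.prems by (cases k) auto
  qed
  have indep_v: "\<forall>k<Suc m. c k = 0" if c: "(\<Sum>k<Suc m. smul (c k) (v k)) = 0" for c
  proof (rule ccontr)
    assume "\<not> (\<forall>k<Suc m. c k = 0)"
    then obtain k0 where k0: "k0 < Suc m" "c k0 \<noteq> 0" by blast
    obtain K where K: "K < Suc m" "c K \<noteq> 0" and gt: "\<And>k. k < Suc m \<Longrightarrow> K < k \<Longrightarrow> c k = 0"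
      by (rule obtain_largest_nonzero_index[where c = c, OF k0]) blast
    have "0 = (bracket E ^^ K) (\<Sum>k<Suc m. smul (c k) (v k))" by (simp only: c funpow_bracket_linear)
    also have "\<dots> = (\<Sum>k<Suc m. smul (c k) ((bracket E ^^ K) (v k)))"
      unfolding funpow_bracket_sum funpow_bracket_linear ..
    also have "\<dots> = (\<Sum>k\<in>{K}. smul (c k) ((bracket E ^^ K) (v k)))"
    proof (rule sum.mono_neutral_right)
      show "\<forall>k\<in>{..<Suc m} - {K}. smul (c k) ((bracket E ^^ K) (v k)) = 0"
      proof
        fix k assume k: "k \<in> {..<Suc m} - {K}"
        then consider "k < K" | "K < k" by fastforce
        then show "smul (c k) ((bracket E ^^ K) (v k)) = 0"
          using k E_powers[of k K] gt[of k] by cases auto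
      qed
    qed (use K in auto)
    also have "\<dots> = smul (c K * fact K) w" using E_powers[of K K] K by simp
    finally show False using K w by simp
  qed
  define z where "z j = (case j of 0 \<Rightarrow> E | Suc 0 \<Rightarrow> H | Suc (Suc 0) \<Rightarrow> F | Suc (Suc (Suc k)) \<Rightarrow> v k)" for j
  have z_simps: "z 0 = E" "z (Suc 0) = H" "z (Suc (Suc 0)) = F" "z (Suc (Suc (Suc k))) = v k" for k
    by (simp_all add: z_def)
  have m4: "m + 4 = Suc (Suc (Suc (Suc m)))" by simp
  have indep_z: "\<forall>j<m + 4. c j = 0" if c: "(\<Sum>j<m + 4. smul (c j) (z j)) = 0" for c
  proof -
    define s r where "s = smul (c 0) E + smul (c (Suc 0)) H + smul (c (Suc (Suc 0))) F"
      and "r = (\<Sum>k<Suc m. smul (c (Suc (Suc (Suc k)))) (v k))"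
    have "s + r = 0"
      using c unfolding s_def r_def m4 by (simp only: sum.lessThan_Suc_shift z_simps add.assoc)
    then have "s = - r" by (simp add: eq_neg_iff_add_eq_0)
    have "s \<in> S"
      using S semidirect_sum unfolding s_def semidirect_sum_def lie_subalgebra_def
      by (simp add: subspace_add subspace_scale)
    moreover have "r \<in> R" unfolding r_def
      by (intro subspace_sum[OF R_subspace] subspace_scale[OF R_subspace] v_R)
    then have "s \<in> R" unfolding \<open>s = - r\<close> by (rule subspace_neg[OF R_subspace])
    moreover have "S \<inter> R = {0}" using semidirect_sum unfolding semidirect_sum_def by blast
    ultimately have "s = 0" by blast
    moreover from this have "r = 0" using \<open>s = - r\<close> by simp
    ultimately have "smul (c 0) E + smul (c (Suc 0)) H + smul (c (Suc (Suc 0))) F = 0"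
      "(\<Sum>k<Suc m. smul (c (Suc (Suc (Suc k)))) (v k)) = 0" by (simp_all only: s_def r_def)
    from indep_S[OF this(1)] indep_v[OF this(2)]
    have "c 0 = 0" "c (Suc 0) = 0" "c (Suc (Suc 0)) = 0" "\<forall>k<Suc m. c (Suc (Suc (Suc k))) = 0"
      by simp_all
    then show ?thesis by (auto simp: m4 less_Suc_eq_0_disj)
  qed
  have z_image: "z ` {..<m + 4} = {E, H, F} \<union> v ` {..m}"
    unfolding m4 by (auto simp: z_simps lessThan_Suc_eq_insert_0 image_image simp flip: lessThan_Suc_atMost)
  have span_all: "span ({E, H, F} \<union> v ` {..m}) = UNIV"
  proof -
    have "x \<in> span ({E, H, F} \<union> v ` {..m})" for x
    proof -
      have "\<exists>s\<in>S. \<exists>r\<in>R. x = s + r"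
        using semidirect_sum unfolding semidirect_sum_def by blast
      then obtain s r where x: "s \<in> S" "r \<in> R" "x = s + r" by blast
      have "r \<in> span ({E, H, F} \<union> v ` {..m})"
        using x(2) span_mono[of "v ` {..m}" "{E, H, F} \<union> v ` {..m}"] unfolding span_v[symmetric] by blast
      moreover obtain \<alpha> \<beta> \<gamma> where "s = smul \<alpha> E + smul \<beta> H + smul \<gamma> F" using span_S[OF x(1)] by blast
      then have "s \<in> span ({E, H, F} \<union> v ` {..m})"
        by (elim ssubst) (intro span_add span_scale span_base; blast)
      ultimately show ?thesis unfolding x(3) by (rule span_add[rotated])
    qed
    then show ?thesis by blast
  qed
  have indep: "independent (z ` {..<m + 4})" and inj: "inj_on z {..<m + 4}"
    using independent_image_family[OF indep_z] inj_on_independent_family[OF indep_z] by blast+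
  have "adapted_basis smul bracket e E H F v m"
  proof (unfold_locales; (rule basis HE HF EF Ev Hv Fv R_abelian[OF v_R v_R] span_all; assumption)?)
    fix \<alpha> \<beta> \<gamma> :: 'k and a :: "nat \<Rightarrow> 'k"
    define t where "t j = (case j of 0 \<Rightarrow> \<alpha> | Suc 0 \<Rightarrow> \<beta> | Suc (Suc 0) \<Rightarrow> \<gamma> | Suc (Suc (Suc k)) \<Rightarrow> a k)" for j
    interpret field_target: vector_space_pair smul "(*) :: 'k \<Rightarrow> 'k \<Rightarrow> 'k"
      by (intro vector_space_pair.intro vector_space_field) (rule vector_space_axioms)
    obtain g where g: "Vector_Spaces.linear smul (*) g" "\<And>x. x \<in> z ` {..<m + 4} \<Longrightarrow> g x = t (the_inv_into {..<m + 4} z x)"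
      using field_target.linear_independent_extend[OF indep, of "\<lambda>x. t (the_inv_into {..<m + 4} z x)"] by blast
    then have gz: "g (z j) = t j" if "j < m + 4" for j
      using that the_inv_into_f_f[OF inj, of j] by simp
    have "g E = \<alpha>" "g H = \<beta>" "g F = \<gamma>"
      using gz[of 0] gz[of "Suc 0"] gz[of "Suc (Suc 0)"] by (simp_all add: z_simps t_def)
    moreover have "\<forall>k\<le>m. g (v k) = a k"
      using gz[of "Suc (Suc (Suc k))" for k] by (simp add: z_simps t_def)
    ultimately show "\<exists>g. Vector_Spaces.linear smul (*) g \<and> g E = \<alpha> \<and> g H = \<beta> \<and> g F = \<gamma> \<and> (\<forall>k\<le>m. g (v k) = a k)"
      using g(1) by blast
  next
    have "dim UNIV = card (z ` {..<m + 4})"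
      using indep span_all unfolding z_image by (intro dim_eq_card) auto
    then show "CARD('n) = m + 4"
      by (simp add: dim_eq_card_basis[OF basis] card_image[OF inj])
  qed
  moreover have "dim R = m + 1"
    using dim_independent_family[OF indep_v] dim_span[of "v ` {..m}"] span_v by (simp add: lessThan_Suc_atMost)
  ultimately show ?thesis by blast
qed

end


section \<open>Moving frames\<close>

locale derivation =
  fixes D :: "'a::{idom, ring_char_0} \<Rightarrow> 'a"
  assumes D_add: "D (x + y) = D x + D y" and D_mult: "D (x * y) = x * D y + D x * y"
begin

lemma D_0 [simp]: "D 0 = 0" and D_1 [simp]: "D 1 = 0"
  using D_add[of 0 0] D_mult[of 1 1] by simp_all

lemma D_sum: "D (\<Sum>i\<in>I. f i) = (\<Sum>i\<in>I. D (f i))"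
  by (induction I rule: infinite_finite_induct) (simp_all add: D_add)

lemma D_minus: "D (- x) = - D x"
  using D_add[of x "- x"] by (simp add: eq_neg_iff_add_eq_0 add.commute)

lemma D_diff: "D (x - y) = D x - D y"
  unfolding diff_conv_add_uminus D_add D_minus ..

lemma map_poly_D_mult: "map_poly D (p * q) = p * map_poly D q + map_poly D p * q"
  by (rule poly_eqI) (simp add: coeff_map_poly coeff_mult D_sum D_mult sum.distrib)

end

text \<open>A polynomial \<open>q\<close> of degree at most \<open>m\<close> in \<open>y\<close> stands for the binary form of degree \<open>m\<close> in \<open>x, y\<close>
  that becomes \<open>q\<close> at \<open>x = 1\<close>; \<open>pairing m a\<close> is the functional on such forms with value \<open>a\<^sub>k\<close> on
  \<open>x\<^bsup>m-k\<^esup> y\<^sup>k\<close>.\<close>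

definition pairing :: "nat \<Rightarrow> (nat \<Rightarrow> 'a::comm_ring_1) \<Rightarrow> 'a poly \<Rightarrow> 'a" where
  "pairing m a q = (\<Sum>k\<le>m. coeff q k * a k)"

lemma pairing_add: "pairing m a (p + q) = pairing m a p + pairing m a q"
  and pairing_smult: "pairing m a (smult c q) = c * pairing m a q"
  and pairing_0 [simp]: "pairing m a 0 = 0"
  by (simp_all add: pairing_def distrib_right sum.distrib sum_distrib_left mult.assoc)

text \<open>With \<open>(\<epsilon>, \<eta>, \<phi>)\<close> equal to a unit vector the derivation acts on the coordinates \<open>a\<^sub>k\<close> like \<open>E\<close>,
  \<open>H\<close> or \<open>F\<close>, and with \<open>(0, 0, 0)\<close> like an element of the radical, so that one computation covers
  all basis elements.\<close>

locale sl2_derivation = derivation D for D :: "'a::{idom, ring_char_0} \<Rightarrow> 'a" +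
  fixes a :: "nat \<Rightarrow> 'a" and m :: nat and \<epsilon> \<eta> \<phi> :: 'a
  assumes D_a: "k \<le> m \<Longrightarrow> D (a k) = \<epsilon> * of_nat k * a (k - 1)
      + \<eta> * (of_nat m - 2 * of_nat k) * a k + \<phi> * (of_nat m - of_nat k) * a (Suc k)"
begin

text \<open>The action on forms of degree \<open>n\<close> that combines \<open>D\<close> on the coefficients with the vector field
  \<open>\<epsilon> x \<partial>\<^sub>y + \<eta> (x \<partial>\<^sub>x - y \<partial>\<^sub>y) + \<phi> y \<partial>\<^sub>x\<close>, written at \<open>x = 1\<close> by means of
  \<open>x \<partial>\<^sub>x = n - y \<partial>\<^sub>y\<close>. It obeys the Leibniz rule, degrees adding up, and is transported to \<open>D\<close> by
  the pairing.\<close>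

definition act :: "nat \<Rightarrow> 'a poly \<Rightarrow> 'a poly" where
  "act n q = map_poly D q + [:\<epsilon>, - 2 * \<eta>, - \<phi>:] * pderiv q + of_nat n * [:\<eta>, \<phi>:] * q"

lemma act_mult: "act (n + n') (p * q) = act n p * q + p * act n' q"
  unfolding act_def map_poly_D_mult pderiv_mult of_nat_add by algebra

lemma act_power: "act n (X ^ n) = of_nat n * X ^ (n - 1) * act 1 X"
proof (induction n)
  case 0
  then show ?case by (simp add: act_def one_pCons map_poly_pCons)
next
  case (Suc n)
  have "act (Suc n) (X ^ Suc n) = act 1 X * X ^ n + X * act n (X ^ n)"
    using act_mult[of 1 n X "X ^ n"] by simp
  also have "X * act n (X ^ n) = of_nat n * X ^ n * act 1 X"
    unfolding Suc by (cases n) simp_all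
  finally show ?case by (simp add: algebra_simps)
qed

lemma D_pairing:
  assumes "degree q \<le> m"
  shows "D (pairing m a q) = pairing m a (act m q)"
proof -
  have q0: "coeff q (Suc m) = 0" using assms by (simp add: coeff_eq_0)
  have c: "coeff (act m q) k = D (coeff q k) + \<epsilon> * of_nat (Suc k) * coeff q (Suc k)
      + \<eta> * (of_nat m - 2 * of_nat k) * coeff q k
      + (case k of 0 \<Rightarrow> 0 | Suc l \<Rightarrow> \<phi> * (of_nat m - of_nat l) * coeff q l)" for k
  proof -
    have "of_nat m * [:\<eta>, \<phi>:] * q = smult (of_nat m) (smult \<eta> q + pCons 0 (smult \<phi> q))"
      unfolding mult.assoc by (simp add: of_nat_poly)
    then have f1: "coeff (of_nat m * [:\<eta>, \<phi>:] * q) k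
        = of_nat m * (\<eta> * coeff q k + (case k of 0 \<Rightarrow> 0 | Suc l \<Rightarrow> \<phi> * coeff q l))"
      by (simp add: coeff_pCons split: nat.split)
    have f2: "coeff ([:\<epsilon>, - 2 * \<eta>, - \<phi>:] * pderiv q) k = \<epsilon> * of_nat (Suc k) * coeff q (Suc k)
        - 2 * \<eta> * of_nat k * coeff q k - (case k of 0 \<Rightarrow> 0 | Suc l \<Rightarrow> \<phi> * of_nat l * coeff q l)"
      by (simp add: coeff_pCons coeff_pderiv mult.assoc split: nat.split)
    show ?thesis
      unfolding act_def coeff_add f1 f2 by (cases k) (simp_all add: coeff_map_poly algebra_simps)
  qed
  define A B where "A k = \<epsilon> * of_nat k * coeff q k * a (k - 1)" and "B k = \<phi> * (of_nat m - of_nat k) * coeff q k * a (Suc k)" for k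
  have "(\<Sum>k\<le>m. \<epsilon> * of_nat (Suc k) * coeff q (Suc k) * a k) = (\<Sum>k\<le>Suc m. A k)"
    unfolding sum.atMost_Suc_shift by (simp add: A_def)
  also have "\<dots> = (\<Sum>k\<le>m. A k)" by (simp add: A_def q0)
  finally have 1: "(\<Sum>k\<le>m. \<epsilon> * of_nat (Suc k) * coeff q (Suc k) * a k) = (\<Sum>k\<le>m. A k)" .
  have 2: "(\<Sum>k\<le>m. (case k of 0 \<Rightarrow> 0 | Suc l \<Rightarrow> \<phi> * (of_nat m - of_nat l) * coeff q l) * a k) = (\<Sum>k\<le>m. B k)"
  proof (cases m)
    case (Suc l)
    have "(\<Sum>k\<le>m. (case k of 0 \<Rightarrow> 0 | Suc l \<Rightarrow> \<phi> * (of_nat m - of_nat l) * coeff q l) * a k) = (\<Sum>k\<le>l. B k)"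
      unfolding Suc sum.atMost_Suc_shift[of _ l] by (simp add: B_def Suc)
    also have "\<dots> = (\<Sum>k\<le>m. B k)" by (simp add: B_def Suc)
    finally show ?thesis .
  qed (simp add: B_def)
  have "D (pairing m a q) = (\<Sum>k\<le>m. coeff q k * D (a k) + D (coeff q k) * a k)"
    by (simp add: pairing_def D_sum D_mult)
  also have "\<dots> = (\<Sum>k\<le>m. A k) + (\<Sum>k\<le>m. B k) + (\<Sum>k\<le>m. (D (coeff q k) + \<eta> * (of_nat m - 2 * of_nat k) * coeff q k) * a k)"
    unfolding sum.distrib[symmetric] by (rule sum.cong) (simp_all add: D_a A_def B_def algebra_simps)
  also have "\<dots> = pairing m a (act m q)"
    unfolding pairing_def c 1[symmetric] 2[symmetric] sum.distrib[symmetric]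
    by (rule sum.cong) (simp_all add: algebra_simps)
  finally show ?thesis .
qed

text \<open>Write the action on the frame as \<open>X \<mapsto> p\<^bsub>11\<^esub> X + p\<^bsub>12\<^esub> Y\<close>, \<open>Y \<mapsto> p\<^bsub>21\<^esub> X + p\<^bsub>22\<^esub> Y\<close>; since the
  determinant of the frame is constant, \<open>p\<^bsub>22\<^esub> = - p\<^bsub>11\<^esub>\<close>. The derivatives of \<open>c\<^sub>0 = 0\<close>, \<open>c\<^sub>2 = 0\<close>
  and \<open>c\<^sub>1 = 1\<close> vanish, which reads \<open>m p\<^bsub>21\<^esub> = 0\<close>, \<open>2 p\<^bsub>12\<^esub> = 0\<close> and \<open>(m - 2) p\<^bsub>11\<^esub> = 0\<close>. So the
  frame is annihilated and with it every \<open>c\<^sub>j\<close>.\<close>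

lemma frame_invariants:
  fixes x0 x1 y0 y1 :: 'a
  defines "X \<equiv> [:x0, x1:]" and "Y \<equiv> [:y0, y1:]"
  defines "c \<equiv> \<lambda>j. pairing m a (X ^ j * Y ^ (m - j))"
  assumes det: "x0 * y1 - x1 * y0 = 1" and m: "3 \<le> m"
    and c0: "c 0 = 0" and c1: "c 1 = 1" and c2: "c 2 = 0" and j: "j \<le> m"
  shows "D (c j) = 0"
proof -
  \<comment> \<open>Cramer's rule expresses any linear form in the frame of determinant one.\<close>
  define decomp where "decomp p q = smult (p * y1 - q * y0) X + smult (x0 * q - x1 * p) Y" for p q
  have decomp: "[:p, q:] = decomp p q" for p q
  proof -
    have "(p * y1 - q * y0) * x0 + (x0 * q - x1 * p) * y0 = p * (x0 * y1 - x1 * y0)"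
      "(p * y1 - q * y0) * x1 + (x0 * q - x1 * p) * y1 = q * (x0 * y1 - x1 * y0)"
      by algebra+
    then show ?thesis by (simp add: decomp_def X_def Y_def det)
  qed
  have act1: "act 1 [:x, y:] = [:D x + \<epsilon> * y + \<eta> * x, D y - \<eta> * y + \<phi> * x:]" for x y
    by (simp add: act_def pderiv_pCons map_poly_pCons algebra_simps)
  define p11 p12 p21 p22 where
    "p11 = (D x0 + \<epsilon> * x1 + \<eta> * x0) * y1 - (D x1 - \<eta> * x1 + \<phi> * x0) * y0"
    and "p12 = x0 * (D x1 - \<eta> * x1 + \<phi> * x0) - x1 * (D x0 + \<epsilon> * x1 + \<eta> * x0)"
    and "p21 = (D y0 + \<epsilon> * y1 + \<eta> * y0) * y1 - (D y1 - \<eta> * y1 + \<phi> * y0) * y0"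
    and "p22 = x0 * (D y1 - \<eta> * y1 + \<phi> * y0) - x1 * (D y0 + \<epsilon> * y1 + \<eta> * y0)"
  have actX: "act 1 X = smult p11 X + smult p12 Y"
  proof -
    have "act 1 X = [:D x0 + \<epsilon> * x1 + \<eta> * x0, D x1 - \<eta> * x1 + \<phi> * x0:]"
      unfolding X_def by (rule act1)
    then show ?thesis by (simp only: decomp decomp_def p11_def p12_def)
  qed
  have actY: "act 1 Y = smult p21 X + smult p22 Y"
  proof -
    have "act 1 Y = [:D y0 + \<epsilon> * y1 + \<eta> * y0, D y1 - \<eta> * y1 + \<phi> * y0:]"
      unfolding Y_def by (rule act1)
    then show ?thesis by (simp only: decomp decomp_def p21_def p22_def)
  qed
  have "D (x0 * y1 - x1 * y0) = 0" unfolding det by simp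
  then have "p11 + p22 = 0"
    unfolding D_diff D_mult p11_def p22_def by algebra
  then have trace: "p22 = - p11" by (simp add: eq_neg_iff_add_eq_0 add.commute)
  have degX: "degree X \<le> 1" and degY: "degree Y \<le> 1"
    by (simp_all add: X_def Y_def)
  have D_c: "D (c j) = of_nat j * (p11 * c j + p12 * c (j - 1))
      + of_nat (m - j) * (p21 * c (Suc j) + p22 * c j)" if j: "j \<le> m" for j
  proof -
    have "degree (X ^ j * Y ^ (m - j)) \<le> degree X * j + degree Y * (m - j)"
      using degree_mult_le[of "X ^ j" "Y ^ (m - j)"] degree_power_le[of X j] degree_power_le[of Y "m - j"]
      by linarith
    also have "\<dots> \<le> 1 * j + 1 * (m - j)" using degX degY by (intro add_mono mult_right_mono) auto
    finally have "degree (X ^ j * Y ^ (m - j)) \<le> m" using j by simp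
    then have "D (c j) = pairing m a (act m (X ^ j * Y ^ (m - j)))" unfolding c_def by (rule D_pairing)
    also have "act m (X ^ j * Y ^ (m - j)) = act j (X ^ j) * Y ^ (m - j) + X ^ j * act (m - j) (Y ^ (m - j))"
      using act_mult[of j "m - j" "X ^ j" "Y ^ (m - j)"] j by simp
    also have "act j (X ^ j) * Y ^ (m - j) = smult (of_nat j * p11) (X ^ j * Y ^ (m - j))
        + smult (of_nat j * p12) (X ^ (j - 1) * Y ^ (m - (j - 1)))"
    proof (cases j)
      case (Suc l)
      have "m - l = Suc (m - Suc l)" using Suc j by simp
      then show ?thesis
        unfolding act_power actX Suc by (simp add: of_nat_poly algebra_simps smult_add_right del: of_nat_Suc)
    qed (simp add: act_power[of 0 X, simplified])
    also have "X ^ j * act (m - j) (Y ^ (m - j)) = smult (of_nat (m - j) * p21) (X ^ Suc j * Y ^ (m - Suc j))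
        + smult (of_nat (m - j) * p22) (X ^ j * Y ^ (m - j))"
    proof (cases "m - j")
      case (Suc l)
      have "m - Suc j = l" using Suc by simp
      then show ?thesis
        unfolding act_power actY Suc by (simp add: of_nat_poly algebra_simps smult_add_right del: of_nat_Suc)
    qed (simp add: act_power[of 0 X, simplified])
    finally show ?thesis
      by (simp add: pairing_add pairing_smult c_def algebra_simps del: power_Suc)
  qed
  have nz: "(of_nat n :: 'a) = 0 \<longleftrightarrow> n = 0" for n by simp
  have "of_nat m * p21 = 0" using D_c[of 0] c0 c1 by simp
  then have p21: "p21 = 0" using m nz[of m] by simp
  have "2 * p12 = 0" using D_c[of 2] c1 c2 p21 m by (simp add: numeral_2_eq_2)
  then have p12: "p12 = 0" by simp
  have "p11 - of_nat (m - 1) * p11 = 0" using D_c[of 1] c0 c1 p12 p21 m trace by simp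
  moreover have "m - 1 = Suc (m - 2)" using m by simp
  ultimately have "of_nat (m - 2) * p11 = 0" by (simp add: algebra_simps)
  then have "p11 = 0" using m nz[of "m - 2"] by simp
  then show ?thesis using D_c[OF j] p12 p21 trace by simp
qed

end

lemma pairing_linear_power:
  "pairing m a ([:y, 1:] ^ n) = (\<Sum>i\<le>n. of_nat (n choose i) * y ^ (n - i) * a i)" if "n \<le> m"
  for y :: "'b::idom"
proof -
  have "coeff ([:y, 1:] ^ n) k = of_nat (n choose k) * y ^ (n - k)" for k
    by (cases "k \<le> n") (simp_all add: coeff_linear_poly_power coeff_eq_0 degree_linear_power binomial_eq_0)
  then have "pairing m a ([:y, 1:] ^ n) = (\<Sum>i\<le>m. of_nat (n choose i) * y ^ (n - i) * a i)"
    by (simp add: pairing_def)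
  also have "\<dots> = (\<Sum>i\<le>n. of_nat (n choose i) * y ^ (n - i) * a i)"
    by (rule sum.mono_neutral_right) (use that in \<open>auto simp: binomial_eq_0\<close>)
  finally show ?thesis .
qed

text \<open>At the base point the form is already normalised by \<open>X = x\<close>, \<open>Y = y\<close>. Near it, \<open>Y\<close> is first
  tilted to \<open>r x + y\<close>, then \<open>X\<close> is sheared to \<open>x + \<sigma> Y\<close>, and finally \<open>Y\<close> is scaled by \<open>\<tau>\<close> and \<open>X\<close> by
  \<open>1 / \<tau>\<close>. Each step meets one of the three conditions, keeps the earlier ones, and amounts to
  finding a simple root: of a polynomial of degree \<open>m\<close>, of a linear one and of one of degree
  \<open>m - 2\<close>. The last requires \<open>m > 2\<close>.\<close>

lemma frame_exists:
  fixes a :: "nat \<Rightarrow> ('k::field_char_0, 'n::finite) mfps"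
  assumes C: "root_closed C" and a: "\<And>k. k \<le> m \<Longrightarrow> a k \<in> C" and m: "3 \<le> m"
    and base: "\<And>k. k \<le> m \<Longrightarrow> cst (a k) = (if k = m - 1 then 1 else 0)"
  obtains x0 x1 y0 y1 where "x0 \<in> C" "x1 \<in> C" "y0 \<in> C" "y1 \<in> C"
    "cst x0 = 1" "cst x1 = 0" "cst y0 = 0" "cst y1 = 1" "x0 * y1 - x1 * y0 = 1"
    "pairing m a ([:y0, y1:] ^ m) = 0" "pairing m a ([:x0, x1:] * [:y0, y1:] ^ (m - 1)) = 1"
    "pairing m a ([:x0, x1:] ^ 2 * [:y0, y1:] ^ (m - 2)) = 0"
proof -
  interpret root_closed C by (rule C)
  define L where "L = pairing m a"
  \<comment> \<open>The tilt: the functional vanishes on \<open>(r x + y)\<^sup>m\<close>, an equation of degree \<open>m\<close> in \<open>r\<close>.\<close>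
  define A where "A i = of_nat (m choose i) * a (m - i)" for i
  define r where "r = simple_root A m"
  have "cst (A 0) = 0" "cst (A 1) \<noteq> 0" using m base by (auto simp: A_def)
  note A = this
  have r: "cst r = 0" and r_root: "(\<Sum>k\<le>m. A k * r ^ k) = 0"
    unfolding r_def using simple_root[OF A, of m] m by auto
  have rC: "r \<in> C" unfolding r_def using A m a by (intro simple_root_closed) (auto simp: A_def)
  define Y where "Y = [:r, 1:]"
  have L_Y: "L (Y ^ n) = (\<Sum>i\<le>n. of_nat (n choose i) * r ^ (n - i) * a i)" if "n \<le> m" for n
    unfolding L_def Y_def by (rule pairing_linear_power[OF that])
  have L_YC: "L (Y ^ n) \<in> C" if "n \<le> m" for n
    unfolding L_Y[OF that] using that a rC by (intro sum_closed mult_closed power_closed) auto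
  have L_Y_cst: "cst (L (Y ^ n)) = cst (a n)" if "n \<le> m" for n
  proof -
    have "cst (L (Y ^ n)) = (\<Sum>i\<le>n. of_nat (n choose i) * 0 ^ (n - i) * cst (a i))"
      unfolding L_Y[OF that] by (simp add: r)
    also have "\<dots> = (\<Sum>i\<in>{n}. of_nat (n choose i) * 0 ^ (n - i) * cst (a i))"
      by (rule sum.mono_neutral_right) auto
    finally show ?thesis by simp
  qed
  have L_Ym: "L (Y ^ m) = 0"
  proof -
    have "L (Y ^ m) = (\<Sum>i\<le>m. A (m - i) * r ^ (m - i))"
      unfolding L_Y[OF order_refl] A_def
      by (rule sum.cong) (auto simp: binomial_symmetric[symmetric] mult_ac)
    also have "\<dots> = (\<Sum>k\<le>m. A k * r ^ k)"
      by (rule sum.reindex_bij_witness[where i = "\<lambda>k. m - k" and j = "\<lambda>k. m - k"]) auto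
    finally show ?thesis using r_root by simp
  qed
  \<comment> \<open>The shear: as \<open>Y\<^sup>m\<close> has value zero, the condition on \<open>(x + \<sigma> Y)\<^sup>2 Y\<^bsup>m-2\<^esup>\<close> is linear in \<open>\<sigma>\<close>.\<close>
  define B where "B i = (if i = 0 then L (Y ^ (m - 2)) else 2 * L (Y ^ (m - 1)))" for i :: nat
  define \<sigma> where "\<sigma> = simple_root B 1"
  have cst_2: "cst (2 :: ('k, 'n) mfps) = 2" by (metis cst_of_nat of_nat_numeral)
  have B: "cst (B 0) = 0" "cst (B 1) \<noteq> 0"
  proof -
    show "cst (B 0) = 0" using L_Y_cst[of "m - 2"] base[of "m - 2"] m by (simp add: B_def)
    show "cst (B 1) \<noteq> 0" using L_Y_cst[of "m - 1"] base[of "m - 1"] by (simp add: B_def cst_2)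
  qed
  have \<sigma>: "cst \<sigma> = 0" and \<sigma>_root: "B 0 + B 1 * \<sigma> = 0"
    unfolding \<sigma>_def using simple_root[OF B, of 1] by auto
  have "2 * L (Y ^ (m - 1)) \<in> C" unfolding mult_2 by (intro add_closed L_YC) auto
  then have \<sigma>C: "\<sigma> \<in> C"
    unfolding \<sigma>_def using B L_YC[of "m - 2"] by (intro simple_root_closed) (auto simp: B_def)
  define X where "X = [:1 + r * \<sigma>, \<sigma>:]"
  have X: "X = 1 + smult \<sigma> Y" by (simp add: X_def Y_def one_pCons mult.commute)
  have L_lin: "L (p + q) = L p + L q" "L (smult s q) = s * L q" for p q s
    by (simp_all add: L_def pairing_add pairing_smult)
  have L_XY: "L (X * Y ^ (m - 1)) = L (Y ^ (m - 1))"
  proof -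
    have "Y * Y ^ (m - 1) = Y ^ m" using m by (simp flip: power_Suc)
    then have "X * Y ^ (m - 1) = Y ^ (m - 1) + smult \<sigma> (Y ^ m)" by (simp add: X distrib_right)
    then show ?thesis by (simp add: L_lin L_Ym)
  qed
  have L_XXY: "L (X ^ 2 * Y ^ (m - 2)) = 0"
  proof -
    have "m - 1 = Suc (m - 2)" "m = Suc (Suc (m - 2))" using m by simp_all
    then have "Y * Y ^ (m - 2) = Y ^ (m - 1)" "Y * (Y * Y ^ (m - 2)) = Y ^ m" by (metis power_Suc)+
    moreover have "X ^ 2 * Z = Z + (smult \<sigma> (Y * Z) + smult \<sigma> (Y * Z)) + smult (\<sigma> * \<sigma>) (Y * (Y * Z))" for Z
      unfolding X power2_eq_square by (simp add: distrib_left distrib_right smult_add_right add.assoc mult.assoc)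
    ultimately have "L (X ^ 2 * Y ^ (m - 2)) = L (Y ^ (m - 2)) + (\<sigma> * L (Y ^ (m - 1)) + \<sigma> * L (Y ^ (m - 1)))"
      by (simp only: L_lin L_Ym) simp
    also have "\<dots> = B 0 + B 1 * \<sigma>" by (simp add: B_def mult_ac)
    finally show ?thesis using \<sigma>_root by simp
  qed
  \<comment> \<open>The scaling: \<open>\<tau>\<^bsup>m-2\<^esup> c = 1\<close> for \<open>\<tau> = 1 + z\<close>; then \<open>\<tau>\<^bsup>m-3\<^esup> c\<close> is the inverse of \<open>\<tau>\<close>.\<close>
  define c where "c = L (Y ^ (m - 1))"
  have c: "cst c = 1" "c \<in> C"
    unfolding c_def using L_Y_cst[of "m - 1"] base[of "m - 1"] L_YC[of "m - 1"] by simp_all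
  define G where "G i = (if i = 0 then c - 1 else of_nat ((m - 2) choose i) * c)" for i
  define z where "z = simple_root G (m - 2)"
  have G: "cst (G 0) = 0" "cst (G 1) \<noteq> 0"
  proof -
    show "cst (G 0) = 0" by (simp add: G_def c)
    have "cst (G 1) = cst (of_nat (m - 2) :: ('k, 'n) mfps) * cst c"
      by (simp add: G_def del: of_nat_diff)
    also have "\<dots> = of_nat (m - 2)" by (simp only: cst_of_nat c mult_1_right)
    finally show "cst (G 1) \<noteq> 0" using m by (simp only: of_nat_eq_0_iff)
  qed
  have z: "cst z = 0" and z_root: "(\<Sum>k\<le>m - 2. G k * z ^ k) = 0"
    unfolding z_def using simple_root[OF G, of "m - 2"] m by auto
  have zC: "z \<in> C"
    unfolding z_def using G c m by (intro simple_root_closed) (auto simp: G_def)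
  define \<tau> where "\<tau> = 1 + z"
  have \<tau>_root: "\<tau> ^ (m - 2) * c = 1"
  proof -
    have "\<tau> ^ (m - 2) * c = (\<Sum>k\<le>m - 2. of_nat ((m - 2) choose k) * z ^ k * c)"
      unfolding \<tau>_def add.commute[of 1 z] binomial_ring by (simp add: sum_distrib_right)
    also have "\<dots> = (\<Sum>k\<le>m - 2. G k * z ^ k + (if k = 0 then 1 else 0))"
      by (rule sum.cong) (auto simp: G_def mult_ac)
    also have "\<dots> = 1" by (simp add: sum.distrib z_root)
    finally show ?thesis .
  qed
  define t where "t = \<tau> ^ (m - 3) * c"
  have t\<tau>: "t * \<tau> = 1"
  proof -
    have "m - 2 = Suc (m - 3)" using m by simp
    then show ?thesis using \<tau>_root by (simp add: t_def mult_ac)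
  qed
  have tC: "t \<in> C" "\<tau> \<in> C" unfolding t_def \<tau>_def using c zC by auto
  have t_cst: "cst \<tau> = 1" "cst t = 1" using c z by (simp_all add: t_def \<tau>_def)
  show ?thesis
  proof (rule that[of "t * (1 + r * \<sigma>)" "t * \<sigma>" "\<tau> * r" \<tau>])
    have Xt: "[:t * (1 + r * \<sigma>), t * \<sigma>:] = smult t X" and Yt: "[:\<tau> * r, \<tau>:] = smult \<tau> Y"
      by (simp_all add: X_def Y_def)
    show "pairing m a ([:\<tau> * r, \<tau>:] ^ m) = 0"
      unfolding Yt smult_power L_def[symmetric] L_lin L_Ym by simp
    show "pairing m a ([:t * (1 + r * \<sigma>), t * \<sigma>:] * [:\<tau> * r, \<tau>:] ^ (m - 1)) = 1"
    proof -
      have "m - 1 = Suc (m - 2)" using m by simp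
      then have "t * \<tau> ^ (m - 1) * c = (t * \<tau>) * (\<tau> ^ (m - 2) * c)" by (simp add: mult_ac)
      then have "t * \<tau> ^ (m - 1) * c = 1" using t\<tau> \<tau>_root by simp
      moreover have "smult t X * smult \<tau> Y ^ (m - 1) = smult (t * \<tau> ^ (m - 1)) (X * Y ^ (m - 1))"
        by (simp add: smult_power mult.commute)
      ultimately show ?thesis
        unfolding Xt Yt L_def[symmetric] by (simp only: L_lin L_XY c_def[symmetric])
    qed
    show "pairing m a ([:t * (1 + r * \<sigma>), t * \<sigma>:] ^ 2 * [:\<tau> * r, \<tau>:] ^ (m - 2)) = 0"
    proof -
      have "smult t X ^ 2 * smult \<tau> Y ^ (m - 2) = smult (t ^ 2 * \<tau> ^ (m - 2)) (X ^ 2 * Y ^ (m - 2))"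
        by (simp add: smult_power mult.commute)
      then show ?thesis unfolding Xt Yt L_def[symmetric] by (simp only: L_lin L_XXY) simp
    qed
    have "t * (1 + r * \<sigma>) * \<tau> - t * \<sigma> * (\<tau> * r) = t * \<tau>" by (simp add: algebra_simps)
    then show "t * (1 + r * \<sigma>) * \<tau> - t * \<sigma> * (\<tau> * r) = 1" using t\<tau> by simp
  qed (use tC rC \<sigma>C t_cst r \<sigma> in auto)
qed

lemma map_poly_cst_mult: "map_poly cst (p * q) = map_poly cst p * map_poly cst q"
  for p q :: "('k::field, 'n::finite) mfps poly"
  by (rule poly_eqI) (simp add: coeff_map_poly coeff_mult)

lemma map_poly_cst_power: "map_poly cst (p ^ n) = map_poly cst p ^ n"
  for p :: "('k::field, 'n::finite) mfps poly"
  by (induction n) (simp_all add: map_poly_cst_mult map_poly_1')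

text \<open>Every power of \<open>y\<close> beyond the \<open>l\<close>-th has to come from a factor \<open>X\<close> and costs a coefficient \<open>x\<^sub>1\<close>,
  which vanishes at the base point.\<close>

lemma coeff_frame_monomial_order:
  fixes x0 x1 y0 y1 :: "('k::field, 'n::finite) mfps"
  assumes "cst x1 = 0"
  shows "order_ge (k - l) (coeff ([:x0, x1:] ^ j * [:y0, y1:] ^ l) k)"
proof -
  have X: "order_ge i (coeff ([:x0, x1:] ^ j) i)" for i
  proof (cases "i \<le> j")
    case True
    have "order_ge i (x1 ^ i)" using assms by (intro order_ge_power) (simp only: order_ge_1_iff)
    then have "order_ge i (of_nat (j choose i) * x0 ^ (j - i) * x1 ^ i)" by (rule order_ge_mult_left)
    then show ?thesis using True by (simp add: coeff_linear_poly_power mult_ac)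
  next
    case False
    have "degree ([:x0, x1:] ^ j) \<le> degree [:x0, x1:] * j" by (rule degree_power_le)
    also have "\<dots> \<le> j" by simp
    finally show ?thesis using False by (simp add: coeff_eq_0)
  qed
  have Y: "coeff ([:y0, y1:] ^ l) i = 0" if "l < i" for i
  proof -
    have "degree ([:y0, y1:] ^ l) \<le> degree [:y0, y1:] * l" by (rule degree_power_le)
    also have "\<dots> \<le> l" by simp
    finally show ?thesis using that by (simp add: coeff_eq_0)
  qed
  show ?thesis
    unfolding coeff_mult
  proof (rule order_ge_sum)
    fix i assume i: "i \<in> {..k}"
    show "order_ge (k - l) (coeff ([:x0, x1:] ^ j) i * coeff ([:y0, y1:] ^ l) (k - i))"
    proof (cases "l < k - i")
      case True
      then show ?thesis using Y[of "k - i"] by simp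
    next
      case False
      then have "k - l \<le> i" using i by auto
      have "order_ge (i + 0) (coeff ([:x0, x1:] ^ j) i * coeff ([:y0, y1:] ^ l) (k - i))"
        by (intro order_ge_mult X order_ge_0)
      then show ?thesis using \<open>k - l \<le> i\<close> order_ge_mono by simp
    qed
  qed
qed

text \<open>To first order only two things could change the pairing: the coordinate \<open>a\<^bsub>m-j\<^esub>\<close> itself, and the
  coefficient of \<open>y\<^bsup>m-1\<^esup>\<close> in \<open>X\<^sup>j Y\<^bsup>m-j\<^esup>\<close>, because \<open>a\<^bsub>m-1\<^esub>\<close> is the only coordinate that is nonzero at
  the base point. For \<open>j \<ge> 3\<close> that coefficient vanishes to order \<open>j - 1 \<ge> 2\<close>.\<close>

lemma cst_deriv_frame_invariant:
  fixes a :: "nat \<Rightarrow> ('k::field, 'n::finite) mfps"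
  assumes frame: "cst x0 = 1" "cst x1 = 0" "cst y0 = 0" "cst y1 = 1"
    and base: "\<And>k. k \<le> m \<Longrightarrow> cst (a k) = (if k = m - 1 then 1 else 0)"
    and j: "3 \<le> j" "j \<le> m"
  shows "cst (mfps_deriv i (pairing m a ([:x0, x1:] ^ j * [:y0, y1:] ^ (m - j)))) = cst (mfps_deriv i (a (m - j)))"
proof -
  define q where "q = [:x0, x1:] ^ j * [:y0, y1:] ^ (m - j)"
  have "map_poly cst q = [:1:] ^ j * [:0, 1:] ^ (m - j)"
    unfolding q_def map_poly_cst_mult map_poly_cst_power by (simp add: map_poly_pCons frame)
  also have "\<dots> = monom 1 (m - j)"
    by (simp add: monom_altdef pCons_one)
  finally have cst_q: "cst (coeff q k) = (if k = m - j then 1 else 0)" for k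
    using coeff_map_poly[of cst q k] by (simp add: eq_commute)
  have "order_ge (m - 1 - (m - j)) (coeff q (m - 1))"
    unfolding q_def by (rule coeff_frame_monomial_order) (rule frame)
  then have "order_ge 2 (coeff q (m - 1))" by (rule order_ge_mono) (use j in auto)
  then have deriv_q: "cst (mfps_deriv i (coeff q (m - 1))) = 0" by (rule cst_deriv_order_2)
  have "cst (mfps_deriv i (pairing m a q))
      = (\<Sum>k\<le>m. cst (coeff q k) * cst (mfps_deriv i (a k)) + cst (mfps_deriv i (coeff q k)) * cst (a k))"
    by (simp add: pairing_def mfps_deriv_sum mfps_deriv_mult)
  also have "\<dots> = (\<Sum>k\<le>m. if k = m - j then cst (mfps_deriv i (a k)) else 0)"
  proof (rule sum.cong[OF refl])
    fix k assume "k \<in> {..m}"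
    then have zero: "cst (mfps_deriv i (coeff q k)) * cst (a k) = 0"
      using base[of k] deriv_q by (cases "k = m - 1") simp_all
    show "cst (coeff q k) * cst (mfps_deriv i (a k)) + cst (mfps_deriv i (coeff q k)) * cst (a k)
        = (if k = m - j then cst (mfps_deriv i (a k)) else 0)"
      unfolding zero cst_q by simp
  qed
  also have "\<dots> = cst (mfps_deriv i (a (m - j)))" by simp
  finally show ?thesis by (simp add: q_def)
qed


section \<open>The coadjoint action in coordinates\<close>

lemma cst_2 [simp]: "cst (2 :: ('a::comm_ring_1, 'n::finite) mfps) = 2"
  by (metis cst_of_nat of_nat_numeral)

context adapted_basis
begin

abbreviation coord :: "'l \<Rightarrow> 'n \<Rightarrow> 'k" where
  "coord y i \<equiv> representation (range e) y (e i)"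

abbreviation struct :: "'n \<Rightarrow> 'n \<Rightarrow> 'n \<Rightarrow> 'k" where
  "struct \<equiv> structure_constant e"

lemma coord_linear: "coord (x + y) i = coord x i + coord y i" "coord (smul a x) i = a * coord x i" "coord 0 i = 0"
  by (rule representation_linear[OF basis])+

lemma coord_sum: "x = (\<Sum>i\<in>UNIV. smul (coord x i) (e i))"
  by (rule basis_sum[OF basis])

text \<open>The linear function on \<open>L\<^sup>*\<close> given by \<open>y\<close>, expanded around the point \<open>p\<close>.\<close>

definition lin :: "'k ^ 'n \<Rightarrow> 'l \<Rightarrow> ('k, 'n) mfps" where
  "lin p y = (\<Sum>k\<in>UNIV. mfps_const (coord y k) * (mfps_const (p $ k) + mfps_var k))"

lemma lin_add: "lin p (x + y) = lin p x + lin p y"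
  and lin_smul: "lin p (smul a x) = mfps_const a * lin p x"
  by (simp_all add: lin_def coord_linear mfps_const_add mfps_const_mult distrib_right sum.distrib
      sum_distrib_left mult.assoc)

lemma lin_0 [simp]: "lin p 0 = 0"
  using lin_smul[of p 0 0] by simp

lemma lin_minus: "lin p (- x) = - lin p x"
  using lin_add[of p x "- x"] by (simp add: eq_neg_iff_add_eq_0 add.commute)

lemma lin_sum: "lin p (\<Sum>i\<in>I. f i) = (\<Sum>i\<in>I. lin p (f i))"
  by (induction I rule: infinite_finite_induct) (simp_all add: lin_add)

lemma deriv_lin: "mfps_deriv j (lin p y) = mfps_const (coord y j)"
proof -
  have "mfps_deriv j (lin p y) = (\<Sum>k\<in>UNIV. mfps_const (coord y k) * mfps_const (if j = k then 1 else 0))"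
    by (simp add: lin_def mfps_deriv_sum mfps_deriv_mult mfps_deriv_add mfps_deriv_var)
  also have "\<dots> = (\<Sum>k\<in>UNIV. if k = j then mfps_const (coord y k) else 0)"
    by (rule sum.cong) auto
  finally show ?thesis by simp
qed

text \<open>The coadjoint vector field of \<open>z\<close>. It is the derivation that maps the linear function of \<open>y\<close> to
  that of \<open>[z, y]\<close>; in this way everything is expressed in the
  adapted basis although the variables belong to the basis \<open>e\<close>.\<close>

definition coadj :: "'k ^ 'n \<Rightarrow> 'l \<Rightarrow> ('k, 'n) mfps \<Rightarrow> ('k, 'n) mfps" where
  "coadj p z G = (\<Sum>j\<in>UNIV. lin p (bracket z (e j)) * mfps_deriv j G)"

lemma coadj_add: "coadj p z (G + G') = coadj p z G + coadj p z G'"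
  and coadj_mult: "coadj p z (G * G') = G * coadj p z G' + coadj p z G * G'"
  by (simp_all add: coadj_def mfps_deriv_add mfps_deriv_mult distrib_left sum.distrib
      sum_distrib_left sum_distrib_right mult.assoc mult.left_commute)

sublocale coadj: derivation "coadj p z" for p z
  by unfold_locales (rule coadj_add coadj_mult)+

lemma coadj_const: "coadj p z (mfps_const c) = 0"
  by (simp add: coadj_def)

lemma coadj_lin: "coadj p z (lin p y) = lin p (bracket z y)"
proof -
  have "lin p (bracket z y) = lin p (bracket z (\<Sum>j\<in>UNIV. smul (coord y j) (e j)))"
    by (subst coord_sum[of y]) simp
  also have "\<dots> = (\<Sum>j\<in>UNIV. mfps_const (coord y j) * lin p (bracket z (e j)))"
    by (simp add: bracket_sum_right bracket_linear lin_sum lin_smul)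
  finally show ?thesis by (simp add: coadj_def deriv_lin mult.commute)
qed

lemma formal_invariant_iff: "formal_invariant struct p G \<longleftrightarrow> (\<forall>i. coadj p (e i) G = 0)"
  unfolding formal_invariant_def coadj_def lin_def structure_constant_def sum_distrib_right ..

lemma formal_invariantI:
  assumes "coadj p E G = 0" "coadj p H G = 0" "coadj p F G = 0" "\<And>k. k \<le> m \<Longrightarrow> coadj p (v k) G = 0"
  shows "formal_invariant struct p G"
proof -
  have "coadj p z G = 0" if "z \<in> span ({E, H, F} \<union> v ` {..m})" for z
    using that
  proof (induction rule: span_induct_alt)
    case base
    then show ?case by (simp add: coadj_def)
  next
    case (step c x y)
    have "coadj p (smul c x + y) G = mfps_const c * coadj p x G + coadj p y G"
      by (simp add: coadj_def bracket_linear lin_add lin_smul distrib_right sum.distrib sum_distrib_left mult.assoc)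
    moreover have "coadj p x G = 0" using step(1) assms by auto
    ultimately show ?case using step by simp
  qed
  then show ?thesis unfolding formal_invariant_iff span_eq by simp
qed

text \<open>The derivative in the direction \<open>g\<close>, a functional on \<open>L\<close> being a constant vector field on \<open>L\<^sup>*\<close>.\<close>

definition along :: "('l \<Rightarrow> 'k) \<Rightarrow> ('k, 'n) mfps \<Rightarrow> ('k, 'n) mfps" where
  "along g G = (\<Sum>j\<in>UNIV. mfps_const (g (e j)) * mfps_deriv j G)"

lemma along_add: "along g (G + G') = along g G + along g G'"
  and along_mult: "along g (G * G') = G * along g G' + along g G * G'"
  by (simp_all add: along_def mfps_deriv_add mfps_deriv_mult distrib_left sum.distrib
      sum_distrib_left sum_distrib_right mult.assoc mult.left_commute)

sublocale along: derivation "along g" for g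
  by unfold_locales (rule along_add along_mult)+

lemma along_const: "along g (mfps_const c) = 0"
  by (simp add: along_def)

lemma linear_coord_sum:
  assumes "Vector_Spaces.linear smul (*) g"
  shows "g y = (\<Sum>i\<in>UNIV. coord y i * g (e i))"
proof -
  have g: "g (x + y) = g x + g y" "g (smul a x) = a * g x" for x y a
    using assms by (simp_all add: Vector_Spaces.linear_iff)
  have g0: "g 0 = 0" using g(2)[of 0 0] by simp
  have "g (\<Sum>i\<in>I. smul (coord y i) (e i)) = (\<Sum>i\<in>I. coord y i * g (e i))" for I
    by (induction I rule: infinite_finite_induct) (simp_all add: g g0)
  from this[of UNIV] show ?thesis by (simp flip: coord_sum)
qed

lemma along_lin:
  assumes "Vector_Spaces.linear smul (*) g"
  shows "along g (lin p y) = mfps_const (g y)"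
proof -
  have "along g (lin p y) = (\<Sum>j\<in>UNIV. mfps_const (coord y j * g (e j)))"
    by (simp add: along_def deriv_lin mfps_const_mult mult.commute)
  also have "\<dots> = mfps_const (\<Sum>j\<in>UNIV. coord y j * g (e j))"
    by (rule mfps_eqI) (simp add: mcoeff_const)
  finally show ?thesis by (simp flip: linear_coord_sum[OF assms])
qed

lemma cst_lin:
  assumes "Vector_Spaces.linear smul (*) g"
  shows "cst (lin (\<chi> i. g (e i)) y) = g y"
  by (simp add: lin_def linear_coord_sum[OF assms, of y])

section \<open>Explicit invariants\<close>

definition invariant_count :: nat where
  "invariant_count = (if m = 0 then 2 else if m = 1 then 1 else if m = 2 then 2 else m - 2)"

text \<open>Independence is recorded by vectors dual to the gradients at the base point, the common hypothesis
  of the criteria for formal and for analytic independence.\<close>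

definition enough_invariants :: "('k, 'n) mfps set \<Rightarrow> bool" where
  "enough_invariants C \<longleftrightarrow> (\<exists>p G y. \<forall>a<invariant_count. formal_invariant struct p (G a) \<and> G a \<in> C \<and>
     (\<forall>b<invariant_count. (\<Sum>j\<in>UNIV. y b j * cst (mfps_deriv j (G a))) = (if a = b then 1 else 0)))"

lemma enough_invariantsI:
  assumes "\<And>a. a < invariant_count \<Longrightarrow> formal_invariant struct p (G a)"
    and "\<And>a. a < invariant_count \<Longrightarrow> G a \<in> C"
    and "\<And>a b. a < invariant_count \<Longrightarrow> b < invariant_count \<Longrightarrow> cst (along (g b) (G a)) = (if a = b then 1 else 0)"
  shows "enough_invariants C"
  unfolding enough_invariants_def
proof (rule exI[of _ p], rule exI[of _ G], rule exI[of _ "\<lambda>b j. g b (e j)"], intro allI impI conjI assms)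
  fix a b assume "a < invariant_count" "b < invariant_count"
  from assms(3)[OF this]
  show "(\<Sum>j\<in>UNIV. g b (e j) * cst (mfps_deriv j (G a))) = (if a = b then 1 else 0)"
    by (simp add: along_def)
qed

lemma brackets:
  "bracket E H = smul (- 2) E" "bracket F H = smul 2 F" "bracket F E = - H"
  "bracket E E = 0" "bracket H H = 0" "bracket F F = 0"
  using bracket_antisym[of E H] bracket_antisym[of F H] bracket_antisym[of F E]
  by (simp_all add: HE HF EF alternating)

lemma brackets_v:
  assumes "k \<le> m"
  shows "bracket (v k) E = smul (- of_nat k) (v (k - 1))"
    and "bracket (v k) H = smul (2 * of_nat k - of_nat m) (v k)"
    and "bracket (v k) F = smul (of_nat k - of_nat m) (v (Suc k))"
  using bracket_antisym[of "v k" E] bracket_antisym[of "v k" H] bracket_antisym[of "v k" F]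
  by (simp_all add: Ev[OF assms] Hv[OF assms] Fv[OF assms] flip: scale_minus_left)

lemmas lie_simps = brackets HE HF EF

lemma lin_closed: "root_closed C \<Longrightarrow> lin p y \<in> C"
  unfolding lin_def
  by (intro root_closed.sum_closed root_closed.mult_closed root_closed.add_closed
      root_closed.const_closed root_closed.var_closed)

definition functional :: "'k \<Rightarrow> 'k \<Rightarrow> 'k \<Rightarrow> (nat \<Rightarrow> 'k) \<Rightarrow> 'l \<Rightarrow> 'k" where
  "functional \<alpha> \<beta> \<gamma> a = (SOME g. Vector_Spaces.linear smul (*) g \<and>
      g E = \<alpha> \<and> g H = \<beta> \<and> g F = \<gamma> \<and> (\<forall>k\<le>m. g (v k) = a k))"

lemma functional:
  "Vector_Spaces.linear smul (*) (functional \<alpha> \<beta> \<gamma> a)"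
  "functional \<alpha> \<beta> \<gamma> a E = \<alpha>" "functional \<alpha> \<beta> \<gamma> a H = \<beta>" "functional \<alpha> \<beta> \<gamma> a F = \<gamma>"
  "k \<le> m \<Longrightarrow> functional \<alpha> \<beta> \<gamma> a (v k) = a k"
  using someI_ex[OF functional_with_values[of \<alpha> \<beta> \<gamma> a]] unfolding functional_def by blast+

text \<open>Here \<open>L\<close> is the direct sum of \<open>sl(2)\<close> with its centre: the central coordinate and the Casimir
  function \<open>H\<^sup>2 + 4 E F\<close>, at the base point \<open>H = 1\<close>.\<close>

lemma enough_invariants_0:
  assumes C: "root_closed C" and m: "m = 0"
  shows "enough_invariants C"
proof -
  interpret root_closed C by (rule C)
  define p :: "'k ^ 'n" where "p = (\<chi> i. functional 0 1 0 (\<lambda>_. 0) (e i))"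
  have cst_p: "cst (lin p y) = functional 0 1 0 (\<lambda>_. 0) y" for y unfolding p_def by (rule cst_lin[OF functional(1)])
  define x y z where "x = lin p E" and "y = lin p H" and "z = lin p F"
  define G where "G a = (if a = 0 then lin p (v 0) else y * y + mfps_const 4 * (x * z))" for a :: nat
  define f where "f b = (if b = 0 then functional 0 0 0 (\<lambda>_. 1) else functional 0 (1/2) 0 (\<lambda>_. 0))" for b :: nat
  have z0: "bracket E (v 0) = 0" "bracket H (v 0) = 0" "bracket F (v 0) = 0"
    "bracket (v 0) E = 0" "bracket (v 0) H = 0" "bracket (v 0) F = 0" "bracket (v 0) (v 0) = 0"
    using Ev[of 0] Hv[of 0] Fv[of 0] brackets_v[of 0] by (simp_all add: m alternating)
  have num: "mfps_const 2 = (2 :: ('k, 'n) mfps)" "mfps_const 4 = (4 :: ('k, 'n) mfps)"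
    using mfps_const_of_nat[of 2, where 'a = 'k and 'n = 'n] mfps_const_of_nat[of 4, where 'a = 'k and 'n = 'n] by simp_all
  have coadj_4: "coadj p w 4 = 0" for w using coadj_const[of p w 4] by (simp add: num)
  have inv: "formal_invariant struct p (G a)" for a
    by (rule formal_invariantI)
      (auto simp: G_def x_def y_def z_def m z0 coadj_lin coadj_add coadj_mult coadj_4 coadj_const lie_simps
        lin_smul lin_minus mfps_const_minus num algebra_simps)
  show ?thesis
  proof (rule enough_invariantsI[where g = f and G = G, OF inv])
    show "G a \<in> C" for a
      using lin_closed[OF C] by (auto simp: G_def x_def y_def z_def)
    have count: "invariant_count = 2" unfolding invariant_count_def using m by simp
    fix a b assume "a < invariant_count" "b < invariant_count"
    then have "a < 2" "b < 2" unfolding count .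
    then show "cst (along (f b) (G a)) = (if a = b then 1 else 0)"
      by (auto simp: G_def f_def x_def y_def z_def less_2_cases_iff along_lin[OF functional(1)] along_add along_mult along_const cst_p functional)
  qed
qed

text \<open>The invariant is the value of the point on \<open>a\<^sub>1\<^sup>2 E + a\<^sub>0 a\<^sub>1 H - a\<^sub>0\<^sup>2 F\<close>, the element of \<open>sl(2)\<close>
  that the coordinates \<open>a\<close> of the point determine equivariantly (the moment map of the plane).\<close>

lemma enough_invariants_1:
  assumes C: "root_closed C" and m: "m = 1"
  shows "enough_invariants C"
proof -
  interpret root_closed C by (rule C)
  have le: "Suc 0 \<le> m" using m by simp
  define base where "base = functional 0 0 0 (\<lambda>k. if k = 1 then 1 else 0)"
  define p :: "'k ^ 'n" where "p = (\<chi> i. base (e i))"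
  have cst_p: "cst (lin p y) = base y" for y unfolding p_def base_def by (rule cst_lin[OF functional(1)])
  define x y z a0 a1 where "x = lin p E" and "y = lin p H" and "z = lin p F" and "a0 = lin p (v 0)" and "a1 = lin p (v 1)"
  define G where "G = x * (a1 * a1) + y * (a0 * a1) - z * (a0 * a0)"
  have z0: "bracket E (v 0) = 0" "bracket H (v 0) = v 0" "bracket F (v 0) = v 1"
    "bracket (v 0) E = 0" "bracket (v 0) H = - v 0" "bracket (v 0) F = - v 1"
    "bracket E (v 1) = v 0" "bracket H (v 1) = - v 1" "bracket F (v 1) = 0"
    "bracket (v 1) E = - v 0" "bracket (v 1) H = v 1" "bracket (v 1) F = 0"
    "bracket (v 0) (v 0) = 0" "bracket (v 1) (v 1) = 0" "bracket (v 0) (v 1) = 0" "bracket (v 1) (v 0) = 0"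
    using Ev[of 0] Hv[of 0] Fv[of 0] brackets_v[of 0] Ev[of 1] Hv[of 1] Fv[of 1] brackets_v[of 1]
    by (simp_all add: m alternating vv)
  have num: "mfps_const 2 = (2 :: ('k, 'n) mfps)"
    using mfps_const_of_nat[of 2, where 'a = 'k and 'n = 'n] by simp
  have inv: "formal_invariant struct p G"
  proof (rule formal_invariantI)
    fix k assume "k \<le> m"
    then consider "k = 0" | "k = 1" using m by linarith
    then show "coadj p (v k) G = 0"
      by cases (simp_all add: G_def x_def y_def z_def a0_def a1_def coadj_lin coadj_add coadj.D_diff coadj_mult
        z0[simplified] lin_minus algebra_simps)
  qed (simp_all add: G_def x_def y_def z_def a0_def a1_def coadj_lin coadj_add coadj.D_diff coadj_mult
        z0[simplified] lie_simps lin_minus lin_smul mfps_const_minus num algebra_simps)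
  show ?thesis
  proof (rule enough_invariantsI[where g = "\<lambda>_. functional 1 0 0 (\<lambda>_. 0)" and G = "\<lambda>_. G", OF inv])
    show "G \<in> C"
      using lin_closed[OF C] by (auto simp: G_def x_def y_def z_def a0_def a1_def)
    have count: "invariant_count = 1" unfolding invariant_count_def using m by simp
    fix a b assume "a < invariant_count" "b < invariant_count"
    then have "a = 0" "b = 0" unfolding count by simp_all
    then show "cst (along (functional 1 0 0 (\<lambda>_. 0)) G) = (if a = b then 1 else 0)"
      by (simp add: G_def x_def y_def z_def a0_def a1_def along_lin[OF functional(1)] along_add along.D_diff along_mult
          along_const cst_p base_def functional le)
  qed
qed

text \<open>Here \<open>R\<close> is the adjoint module. Up to scalar factors the invariants are the Killing form on the
  \<open>R\<close>-part of a point and the Killing pairing of its \<open>R\<close>-part with its \<open>S\<close>-part.\<close>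

lemma enough_invariants_2:
  assumes C: "root_closed C" and m: "m = 2"
  shows "enough_invariants C"
proof -
  interpret root_closed C by (rule C)
  have le: "Suc 0 \<le> m" "2 \<le> m" using m by simp_all
  define base where "base = functional 0 0 0 (\<lambda>k. if k = 1 then 1 else 0)"
  define p :: "'k ^ 'n" where "p = (\<chi> i. base (e i))"
  have cst_p: "cst (lin p y) = base y" for y unfolding p_def base_def by (rule cst_lin[OF functional(1)])
  define x y z a0 a1 a2 where "x = lin p E" and "y = lin p H" and "z = lin p F"
    and "a0 = lin p (v 0)" and "a1 = lin p (v 1)" and "a2 = lin p (v 2)"
  define G where "G a = (if a = 0 then a0 * a2 - a1 * a1 else x * a2 + y * a1 - z * a0)" for a :: nat
  define f where "f b = (if b = 0 then functional 0 0 0 (\<lambda>k. if k = 1 then - (1/2) else 0) else functional 0 1 0 (\<lambda>_. 0))" for b :: nat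
  have minus_one: "smul (- 1) w = - w" for w by simp
  have z0: "bracket E (v 0) = 0" "bracket H (v 0) = smul 2 (v 0)" "bracket F (v 0) = smul 2 (v 1)"
    "bracket (v 0) E = 0" "bracket (v 0) H = smul (- 2) (v 0)" "bracket (v 0) F = smul (- 2) (v 1)"
    "bracket E (v 1) = v 0" "bracket H (v 1) = 0" "bracket F (v 1) = v 2"
    "bracket (v 1) E = - v 0" "bracket (v 1) H = 0" "bracket (v 1) F = - v 2"
    "bracket E (v 2) = smul 2 (v 1)" "bracket H (v 2) = smul (- 2) (v 2)" "bracket F (v 2) = 0"
    "bracket (v 2) E = smul (- 2) (v 1)" "bracket (v 2) H = smul 2 (v 2)" "bracket (v 2) F = 0"
    using Ev[of 0] Hv[of 0] Fv[of 0] brackets_v[of 0] Ev[of 1] Hv[of 1] Fv[of 1] brackets_v[of 1]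
      Ev[of 2] Hv[of 2] Fv[of 2] brackets_v[of 2]
    by (simp_all add: m numeral_2_eq_2 minus_one del: scale_minus_left)
  have num: "mfps_const 2 = (2 :: ('k, 'n) mfps)"
    using mfps_const_of_nat[of 2, where 'a = 'k and 'n = 'n] by simp
  have lin_2: "lin p (smul 2 w) = 2 * lin p w" "lin p (smul (- 2) w) = - (2 * lin p w)" for w
    by (simp_all only: lin_smul mfps_const_minus num mult_minus_left)
  have coadj_a: "coadj p E x = 0" "coadj p E y = - (2 * x)" "coadj p E z = y"
    "coadj p H x = 2 * x" "coadj p H y = 0" "coadj p H z = - (2 * z)"
    "coadj p F x = - y" "coadj p F y = 2 * z" "coadj p F z = 0"
    "coadj p E a0 = 0" "coadj p E a1 = a0" "coadj p E a2 = 2 * a1"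
    "coadj p H a0 = 2 * a0" "coadj p H a1 = 0" "coadj p H a2 = - (2 * a2)"
    "coadj p F a0 = 2 * a1" "coadj p F a1 = a2" "coadj p F a2 = 0"
    "coadj p (v 0) x = 0" "coadj p (v 0) y = - (2 * a0)" "coadj p (v 0) z = - (2 * a1)"
    "coadj p (v 1) x = - a0" "coadj p (v 1) y = 0" "coadj p (v 1) z = - a2"
    "coadj p (v 2) x = - (2 * a1)" "coadj p (v 2) y = 2 * a2" "coadj p (v 2) z = 0"
    unfolding x_def y_def z_def a0_def a1_def a2_def coadj_lin lie_simps z0 lin_2 lin_minus lin_0
    by (rule refl)+
  have coadj_v: "coadj p (v k) a0 = 0" "coadj p (v k) a1 = 0" "coadj p (v k) a2 = 0" if "k \<le> m" for k
    using that vv[of k 0] vv[of k 1] vv[of k 2] by (simp_all add: a0_def a1_def a2_def coadj_lin m)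
  have inv: "formal_invariant struct p (G a)" for a
  proof (rule formal_invariantI)
    fix k assume k: "k \<le> m"
    then consider "k = 0" | "k = 1" | "k = 2" using m by linarith
    then show "coadj p (v k) (G a) = 0"
    proof cases
      case 1
      then show ?thesis using coadj_v[OF k]
        by (simp add: G_def coadj_add coadj.D_diff coadj_mult coadj_a algebra_simps)
    next
      case 2
      then show ?thesis using coadj_v[OF k]
        by (simp add: G_def coadj_add coadj.D_diff coadj_mult coadj_a[simplified] algebra_simps)
    next
      case 3
      then show ?thesis using coadj_v[OF k]
        by (simp add: G_def coadj_add coadj.D_diff coadj_mult coadj_a algebra_simps)
    qed
  qed (simp_all add: G_def coadj_add coadj.D_diff coadj_mult coadj_a algebra_simps)
  show ?thesis
  proof (rule enough_invariantsI[where g = f and G = G, OF inv])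
    show "G a \<in> C" for a
      using lin_closed[OF C] by (auto simp: G_def x_def y_def z_def a0_def a1_def a2_def)
    have count: "invariant_count = 2" unfolding invariant_count_def using m by simp
    fix a b assume "a < invariant_count" "b < invariant_count"
    then have "a < 2" "b < 2" unfolding count .
    then show "cst (along (f b) (G a)) = (if a = b then 1 else 0)"
      by (auto simp: G_def f_def x_def y_def z_def a0_def a1_def a2_def less_2_cases_iff along_lin[OF functional(1)]
          along_add along.D_diff along_mult along_const cst_p base_def functional le)
  qed
qed

lemma coeff_closed_mult:
  assumes "root_closed C" "\<And>k. coeff p k \<in> C" "\<And>k. coeff q k \<in> C"
  shows "coeff (p * q) k \<in> C"
  unfolding coeff_mult
  by (intro root_closed.sum_closed[OF assms(1)] root_closed.mult_closed[OF assms(1)] assms(2,3))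

lemma coeff_closed_power:
  assumes C: "root_closed C" and p: "\<And>k. coeff p k \<in> C"
  shows "coeff (p ^ l) k \<in> C"
proof (induction l arbitrary: k)
  case 0
  then show ?case
    using root_closed.zero_closed[OF C] root_closed.one_closed[OF C] by simp
next
  case (Suc l)
  then show ?case unfolding power_Suc by (intro coeff_closed_mult C p)
qed

lemma enough_invariants_ge_3:
  assumes C: "root_closed C" and m: "3 \<le> m"
  shows "enough_invariants C"
proof -
  interpret root_closed C by (rule C)
  define base where "base = functional 0 0 0 (\<lambda>k. if k = m - 1 then 1 else 0)"
  define p :: "'k ^ 'n" where "p = (\<chi> i. base (e i))"
  define a where "a k = lin p (v k)" for k
  have cst_a: "cst (a k) = (if k = m - 1 then 1 else 0)" if "k \<le> m" for k
    unfolding a_def p_def base_def using cst_lin[OF functional(1)] functional(5) that by simp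
  have aC: "a k \<in> C" for k unfolding a_def by (rule lin_closed[OF C])
  obtain x0 x1 y0 y1 where frame: "x0 \<in> C" "x1 \<in> C" "y0 \<in> C" "y1 \<in> C"
    "cst x0 = 1" "cst x1 = 0" "cst y0 = 0" "cst y1 = 1" "x0 * y1 - x1 * y0 = 1"
    "pairing m a ([:y0, y1:] ^ m) = 0" "pairing m a ([:x0, x1:] * [:y0, y1:] ^ (m - 1)) = 1"
    "pairing m a ([:x0, x1:] ^ 2 * [:y0, y1:] ^ (m - 2)) = 0"
    using frame_exists[OF C aC m cst_a] by blast
  define c where "c j = pairing m a ([:x0, x1:] ^ j * [:y0, y1:] ^ (m - j))" for j
  have cC: "c j \<in> C" for j
  proof -
    have "coeff [:s, t:] k \<in> C" if "s \<in> C" "t \<in> C" for s t k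
      using that by (simp add: coeff_pCons split: nat.split)
    then show ?thesis
      unfolding c_def pairing_def using frame aC
      by (intro sum_closed mult_closed coeff_closed_mult[OF C] coeff_closed_power[OF C]) auto
  qed
  have D_c: "coadj p z (c j) = 0"
    if "sl2_derivation (coadj p z) a m \<epsilon> \<eta> \<phi>" "j \<le> m" for z \<epsilon> \<eta> \<phi> j
    unfolding c_def
    by (rule sl2_derivation.frame_invariants[OF that(1)]) (use frame m that(2) in simp_all)
  have lin_coeff: "lin p (smul (of_nat k) w) = of_nat k * lin p w"
    "lin p (smul (of_nat m - of_nat k) w) = (of_nat m - of_nat k) * lin p w"
    "lin p (smul (of_nat m - 2 * of_nat k) w) = (of_nat m - 2 * of_nat k) * lin p w" for k w
  proof -
    have const: "mfps_const (of_nat m - of_nat l) = (of_nat m - of_nat l :: ('k, 'n) mfps)" for l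
      by (simp only: diff_conv_add_uminus mfps_const_add mfps_const_minus mfps_const_of_nat)
    show "lin p (smul (of_nat k) w) = of_nat k * lin p w"
      "lin p (smul (of_nat m - of_nat k) w) = (of_nat m - of_nat k) * lin p w"
      by (simp_all only: lin_smul mfps_const_of_nat const)
    show "lin p (smul (of_nat m - 2 * of_nat k) w) = (of_nat m - 2 * of_nat k) * lin p w"
      using const[of "2 * k"] by (simp add: lin_smul)
  qed
  have inv: "formal_invariant struct p (c j)" if j: "j \<le> m" for j
  proof (rule formal_invariantI)
    have "sl2_derivation (coadj p E) a m 1 0 0"
      by unfold_locales (simp add: a_def coadj_lin Ev lin_coeff)
    then show "coadj p E (c j) = 0" using j by (rule D_c)
    have "sl2_derivation (coadj p H) a m 0 1 0"
      by unfold_locales (simp add: a_def coadj_lin Hv lin_coeff)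
    then show "coadj p H (c j) = 0" using j by (rule D_c)
    have "sl2_derivation (coadj p F) a m 0 0 1"
      by unfold_locales (simp add: a_def coadj_lin Fv lin_coeff)
    then show "coadj p F (c j) = 0" using j by (rule D_c)
    fix l assume "l \<le> m"
    then have "sl2_derivation (coadj p (v l)) a m 0 0 0"
      by unfold_locales (simp add: a_def coadj_lin vv)
    then show "coadj p (v l) (c j) = 0" using j by (rule D_c)
  qed
  have count: "invariant_count = m - 2" using m by (simp add: invariant_count_def)
  define f where "f b = functional 0 0 0 (\<lambda>k. if k = m - (b + 3) then 1 else 0)" for b
  show ?thesis
  proof (rule enough_invariantsI[where p = p and g = f and G = "\<lambda>i. c (i + 3)"])
    show "formal_invariant struct p (c (i + 3))" if "i < invariant_count" for i
      using that count by (intro inv) simp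
    show "c (i + 3) \<in> C" for i by (rule cC)
    fix i b assume ib: "i < invariant_count" "b < invariant_count"
    have "cst (along (f b) (c (i + 3))) = cst (along (f b) (a (m - (i + 3))))"
      using ib count m cst_deriv_frame_invariant[OF frame(5-8), of m a "i + 3"] cst_a
      by (simp add: along_def c_def)
    also have "\<dots> = f b (v (m - (i + 3)))"
      unfolding a_def by (simp add: along_lin[OF functional(1)] f_def)
    also have "\<dots> = (if i = b then 1 else 0)"
      using ib count by (auto simp: f_def functional(5))
    finally show "cst (along (f b) (c (i + 3))) = (if i = b then 1 else 0)" .
  qed
qed

lemma enough_invariants: "root_closed C \<Longrightarrow> enough_invariants C"
  using enough_invariants_0 enough_invariants_1 enough_invariants_2 enough_invariants_ge_3
  by (metis One_nat_def Suc_1 eval_nat_numeral(3) not_less_eq_eq le_Suc_eq le_zero_eq nat_le_linear)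

lemma number_of_formal_invariants_lower: "invariant_count \<le> number_of_formal_invariants struct"
proof -
  obtain p G y where "\<forall>a<invariant_count. formal_invariant struct p (G a) \<and> G a \<in> UNIV \<and>
     (\<forall>b<invariant_count. (\<Sum>j\<in>UNIV. y b j * cst (mfps_deriv j (G a))) = (if a = b then 1 else 0))"
    using enough_invariants[OF formal.root_closed_axioms] unfolding enough_invariants_def by blast
  then show ?thesis
    using formally_independent_if_dual[of invariant_count y G]
    by (intro number_of_formal_invariants_ge[of _ struct p G]) auto
qed

end

lemma number_of_analytic_invariants_lower:
  fixes smul :: "'k::{real_normed_field, banach} \<Rightarrow> 'l::ab_group_add \<Rightarrow> 'l" and e :: "'n::finite \<Rightarrow> 'l"
  assumes "adapted_basis smul bracket e E H F v m"
  shows "adapted_basis.invariant_count m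
    \<le> number_of_analytic_invariants (lie_algebra.structure_constant smul bracket e)"
proof -
  interpret adapted_basis smul bracket e E H F v m by (rule assms)
  obtain p and G :: "nat \<Rightarrow> ('k, 'n) mfps" and y where
    G: "\<forall>a<invariant_count. formal_invariant struct p (G a) \<and> G a \<in> {G. convergent_series G} \<and>
     (\<forall>b<invariant_count. (\<Sum>j\<in>UNIV. y b j * cst (mfps_deriv j (G a))) = (if a = b then 1 else 0))"
    using enough_invariants[OF analytic.root_closed_axioms] unfolding enough_invariants_def by blast
  then show ?thesis
    by (intro number_of_analytic_invariants_ge[of _ struct p G y]) auto
qed


section \<open>The gradients of invariants at a generic point\<close>

lemma det3_kernel:
  fixes x y z :: "'a::idom"
  assumes "a * x + b * y + c * z = 0" "d * x + f * y + g * z = 0" "h * x + i * y + j * z = 0"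
    and det: "a * (f * j - g * i) - b * (d * j - g * h) + c * (d * i - f * h) \<noteq> 0"
  shows "x = 0 \<and> y = 0 \<and> z = 0"
proof -
  have "(a * (f * j - g * i) - b * (d * j - g * h) + c * (d * i - f * h)) * x = 0"
    "(a * (f * j - g * i) - b * (d * j - g * h) + c * (d * i - f * h)) * y = 0"
    "(a * (f * j - g * i) - b * (d * j - g * h) + c * (d * i - f * h)) * z = 0"
    using assms(1-3) by algebra+
  then show ?thesis using det by simp
qed

text \<open>The determinant of the equations \<open>\<alpha> E a + \<beta> H a + \<gamma> F a = 0\<close> for the stabiliser of \<open>a\<close> in \<open>sl(2)\<close>,
  restricted to the coordinates \<open>0, 1, 2\<close>. The parameters \<open>c\<^sub>i\<close> stand for \<open>m - i\<close>. It is affine in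
  \<open>a\<^sub>3\<close> with leading coefficient \<open>- m (m - 2) a\<^sub>0\<^sup>2\<close>, which shows that it does not vanish generically.\<close>

definition stabilizer_det :: "'a::comm_ring_1 \<Rightarrow> 'a \<Rightarrow> 'a \<Rightarrow> 'a \<Rightarrow> 'a \<Rightarrow> 'a \<Rightarrow> 'a \<Rightarrow> 'a \<Rightarrow> 'a" where
  "stabilizer_det c0 c1 c2 c4 a0 a1 a2 a3 =
     c0 * a1 * (a0 * (c4 * a2) - (c2 * a1) * (2 * a1)) - c0 * a0 * (a0 * (c2 * a3) - (c1 * a2) * (2 * a1))"

lemma sum_lessThan_2_4_6:
  "(\<Sum>j<2. f j) = f 0 + f 1" "(\<Sum>j<4. f j) = f 0 + f 1 + f 2 + f 3"
  "(\<Sum>j<6. f j) = f 0 + f 1 + f 2 + f 3 + f 4 + f 5" for f :: "nat \<Rightarrow> 'c::comm_monoid_add"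
  by (simp_all add: eval_nat_numeral)

text \<open>A point \<open>\<Lambda>\<close> of \<open>L\<^sup>*\<close> with coordinates in an extension field: the field of fractions of the power
  series ring for the generic point, the field itself for an ordinary point.\<close>

locale extended_functional = adapted_basis smul bracket e E H F v m
  for smul :: "'k::field_char_0 \<Rightarrow> 'l::ab_group_add \<Rightarrow> 'l" and bracket and e :: "'n::finite \<Rightarrow> 'l"
    and E H F v m +
  fixes \<iota> :: "'k \<Rightarrow> 'f::field" and \<Lambda> :: "'l \<Rightarrow> 'f"
  assumes \<iota>_add: "\<iota> (a + b) = \<iota> a + \<iota> b" and \<iota>_mult: "\<iota> (a * b) = \<iota> a * \<iota> b" and \<iota>_1: "\<iota> 1 = 1"
    and \<Lambda>_add: "\<Lambda> (x + y) = \<Lambda> x + \<Lambda> y" and \<Lambda>_smul: "\<Lambda> (smul a x) = \<iota> a * \<Lambda> x"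
begin

lemma \<iota>_0 [simp]: "\<iota> 0 = 0"
  by (metis \<iota>_add add_0_right add_left_cancel)

lemma \<iota>_minus: "\<iota> (- a) = - \<iota> a"
  using \<iota>_add[of a "- a"] by (simp add: eq_neg_iff_add_eq_0 add.commute)

lemma \<iota>_eq_0_iff: "\<iota> a = 0 \<longleftrightarrow> a = 0"
proof
  assume "\<iota> a = 0"
  show "a = 0"
  proof (rule ccontr)
    assume "a \<noteq> 0"
    then have "\<iota> (a * inverse a) = 1" by (simp add: \<iota>_1)
    with \<open>\<iota> a = 0\<close> show False by (simp add: \<iota>_mult)
  qed
qed simp

lemma \<Lambda>_0 [simp]: "\<Lambda> 0 = 0"
  by (metis \<Lambda>_add add_0_right add_left_cancel)

lemma \<Lambda>_minus: "\<Lambda> (- x) = - \<Lambda> x"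
  using \<Lambda>_add[of x "- x"] by (simp add: eq_neg_iff_add_eq_0 add.commute)

lemma \<Lambda>_sum: "\<Lambda> (\<Sum>i\<in>I. f i) = (\<Sum>i\<in>I. \<Lambda> (f i))"
  by (induction I rule: infinite_finite_induct) (simp_all add: \<Lambda>_add)

text \<open>The null space of the commutator matrix at \<open>\<Lambda>\<close>, which contains the gradients of all invariants.\<close>

definition annihilator :: "('f ^ 'n) set" where
  "annihilator = {w. \<forall>i. (\<Sum>j\<in>UNIV. w $ j * \<Lambda> (bracket (e i) (e j))) = 0}"

lemma dim_annihilator_le:
  assumes W: "W \<subseteq> annihilator"
    and indep: "\<And>\<nu>. (\<And>x. (\<Sum>j<r. \<nu> j * \<Lambda> (bracket x (z j))) = 0) \<Longrightarrow> \<forall>j<r. \<nu> j = 0"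
  shows "vec.dim W + r \<le> CARD('n)"
proof (rule vec_dim_plus_complement_le)
  show "vec.subspace annihilator"
    unfolding vec.subspace_def annihilator_def
    by (auto simp: distrib_right sum.distrib mult.assoc simp flip: sum_distrib_left)
  show "W \<subseteq> annihilator" by (rule W)
  fix \<nu> assume \<nu>: "(\<Sum>j<r. \<nu> j *s (\<chi> l. \<iota> (coord (z j) l))) \<in> annihilator"
  have expand: "\<Lambda> (bracket x y) = (\<Sum>l\<in>UNIV. \<iota> (coord y l) * \<Lambda> (bracket x (e l)))" for x y
  proof -
    have "\<Lambda> (bracket x y) = \<Lambda> (bracket x (\<Sum>l\<in>UNIV. smul (coord y l) (e l)))"
      by (subst coord_sum[of y]) simp
    then show ?thesis by (simp add: bracket_sum_right bracket_linear \<Lambda>_sum \<Lambda>_smul)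
  qed
  have on_basis: "(\<Sum>j<r. \<nu> j * \<Lambda> (bracket (e i) (z j))) = 0" for i
  proof -
    have "(\<Sum>j<r. \<nu> j * \<Lambda> (bracket (e i) (z j)))
        = (\<Sum>l\<in>UNIV. (\<Sum>j<r. \<nu> j *s (\<chi> l. \<iota> (coord (z j) l))) $ l * \<Lambda> (bracket (e i) (e l)))"
      unfolding expand[of "e i" "z _"] sum_distrib_left sum_component sum_distrib_right
      by (subst sum.swap) (simp add: mult.assoc)
    then show ?thesis using \<nu> by (simp add: annihilator_def)
  qed
  show "\<forall>j<r. \<nu> j = 0"
  proof (rule indep)
    fix x
    have "\<Lambda> (bracket x y) = (\<Sum>i\<in>UNIV. \<iota> (coord x i) * \<Lambda> (bracket (e i) y))" for y
    proof -
      have "\<Lambda> (bracket x y) = \<Lambda> (bracket (\<Sum>i\<in>UNIV. smul (coord x i) (e i)) y)"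
        by (subst coord_sum[of x]) simp
      then show ?thesis by (simp add: bracket_sum_left bracket_linear \<Lambda>_sum \<Lambda>_smul)
    qed
    then have "(\<Sum>j<r. \<nu> j * \<Lambda> (bracket x (z j)))
        = (\<Sum>i\<in>UNIV. \<iota> (coord x i) * (\<Sum>j<r. \<nu> j * \<Lambda> (bracket (e i) (z j))))"
      unfolding sum_distrib_left by (subst sum.swap) (simp add: sum_distrib_left mult_ac)
    then show "(\<Sum>j<r. \<nu> j * \<Lambda> (bracket x (z j))) = 0" by (simp add: on_basis)
  qed
qed

text \<open>Each inequation is imposed only for those \<open>m\<close> for which it holds at some point of \<open>L\<^sup>*\<close> and
  enters the bound.\<close>

definition regular :: bool where
  "regular \<longleftrightarrow> (m = 0 \<longrightarrow> \<Lambda> H \<noteq> 0) \<and> (1 \<le> m \<longrightarrow> \<Lambda> (v 0) \<noteq> 0) \<and>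
     (3 \<le> m \<longrightarrow> stabilizer_det (\<iota> (of_nat m)) (\<iota> (of_nat m - 1)) (\<iota> (of_nat m - 2)) (\<iota> (of_nat m - 4))
        (\<Lambda> (v 0)) (\<Lambda> (v 1)) (\<Lambda> (v 2)) (\<Lambda> (v 3)) \<noteq> 0)"

text \<open>For \<open>m \<ge> 3\<close> the bracket of a combination of \<open>E, H, F, v\<^sub>0, v\<^sub>1, v\<^sub>2\<close> with the \<open>v\<^sub>k\<close> sees only its
  \<open>sl(2)\<close>-part, which the determinant of the stabiliser equations forces to be zero; its bracket with
  \<open>E, H, F\<close> then gives the transposed equations for the remaining part. For \<open>m = 1, 2\<close> the same
  two steps are done with \<open>E, H\<close> and \<open>v\<^sub>0, v\<^sub>1\<close>.\<close>

lemma dim_annihilator_regular: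
  assumes W: "W \<subseteq> annihilator" and regular
  shows "vec.dim W \<le> invariant_count"
proof -
  consider "m = 0" | "m = 1 \<or> m = 2" | "3 \<le> m" by linarith
  then show ?thesis
  proof cases
    case 1
    define z where "z = (\<lambda>j::nat. if j = 0 then E else F)"
    have "vec.dim W + 2 \<le> CARD('n)"
    proof (rule dim_annihilator_le[OF W])
      fix \<nu> :: "nat \<Rightarrow> 'f" assume *: "\<And>x. (\<Sum>j<2. \<nu> j * \<Lambda> (bracket x (z j))) = 0"
      have "\<nu> 1 * \<Lambda> H = 0" using *[of E] by (simp add: sum_lessThan_2_4_6 z_def lie_simps)
      moreover have "\<nu> 0 * \<Lambda> H = 0" using *[of F] by (simp add: sum_lessThan_2_4_6 z_def lie_simps \<Lambda>_minus)
      moreover have "\<Lambda> H \<noteq> 0" using \<open>regular\<close> 1 unfolding regular_def by blast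
      ultimately show "\<forall>j<2. \<nu> j = 0" by (auto simp: less_2_cases_iff)
    qed
    moreover have "invariant_count = 2" using 1 unfolding invariant_count_def by simp
    ultimately show ?thesis using card_eq 1 by simp
  next
    case 2
    define z where "z = (\<lambda>j::nat. if j = 0 then E else if j = 1 then H else if j = 2 then v 0 else v 1)"
    have m: "1 \<le> m" using 2 by auto
    have \<Lambda>0: "\<Lambda> (v 0) \<noteq> 0" using \<open>regular\<close> m by (simp add: regular_def)
    have \<iota>m: "\<iota> (of_nat m) \<noteq> 0" using m by (simp add: \<iota>_eq_0_iff)
    have "vec.dim W + 4 \<le> CARD('n)"
    proof (rule dim_annihilator_le[OF W])
      fix \<nu> :: "nat \<Rightarrow> 'f" assume "\<And>x. (\<Sum>j<4. \<nu> j * \<Lambda> (bracket x (z j))) = 0"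
      then have *: "\<nu> 0 * \<Lambda> (bracket x E) + \<nu> 1 * \<Lambda> (bracket x H) + \<nu> 2 * \<Lambda> (bracket x (v 0)) + \<nu> 3 * \<Lambda> (bracket x (v 1)) = 0" for x
        by (simp add: sum_lessThan_2_4_6 z_def)
      have \<nu>1: "\<nu> 1 = 0"
        using *[of "v 0"] m \<Lambda>0 \<iota>m by (simp add: brackets_v vv \<Lambda>_smul \<Lambda>_minus)
      then have \<nu>0: "\<nu> 0 = 0"
        using *[of "v 1"] m \<Lambda>0 by (simp add: brackets_v vv \<Lambda>_smul \<Lambda>_minus)
      have \<nu>3: "\<nu> 3 = 0"
        using *[of E] m \<Lambda>0 \<nu>0 \<nu>1 by (simp add: Ev)
      then have "\<nu> 2 = 0"
        using *[of H] m \<Lambda>0 \<iota>m \<nu>0 \<nu>1 by (simp add: Hv \<Lambda>_smul)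
      then show "\<forall>j<4. \<nu> j = 0" using \<nu>0 \<nu>1 \<nu>3 by (auto simp: eval_nat_numeral less_Suc_eq)
    qed
    moreover have "invariant_count = 1" if "m = 1"
      using that unfolding invariant_count_def by simp
    moreover have "invariant_count = 2" if "m = 2"
      using that unfolding invariant_count_def by simp
    ultimately show ?thesis using card_eq 2 by auto
  next
    case 3
    define z where "z = (\<lambda>j::nat. if j = 0 then E else if j = 1 then H else if j = 2 then F
      else if j = 3 then v 0 else if j = 4 then v 1 else v 2)"
    define c0 c1 c2 c4 where "c0 = \<iota> (of_nat m)" and "c1 = \<iota> (of_nat m - 1)" and "c2 = \<iota> (of_nat m - 2)" and "c4 = \<iota> (of_nat m - 4)"
    define a0 a1 a2 a3 where "a0 = \<Lambda> (v 0)" and "a1 = \<Lambda> (v 1)" and "a2 = \<Lambda> (v 2)" and "a3 = \<Lambda> (v 3)"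
    have det: "stabilizer_det c0 c1 c2 c4 a0 a1 a2 a3 \<noteq> 0"
      using \<open>regular\<close> 3 by (simp add: regular_def c0_def c1_def c2_def c4_def a0_def a1_def a2_def a3_def)
    have \<iota>2: "\<iota> 2 = 2" using \<iota>_add[of 1 1] by (simp add: \<iota>_1)
    have le: "1 \<le> m" "2 \<le> m" using 3 by simp_all
    have val: "\<Lambda> (bracket E (v 0)) = 0" "\<Lambda> (bracket E (v 1)) = a0" "\<Lambda> (bracket E (v 2)) = 2 * a1"
      "\<Lambda> (bracket H (v 0)) = c0 * a0" "\<Lambda> (bracket H (v 1)) = c2 * a1" "\<Lambda> (bracket H (v 2)) = c4 * a2"
      "\<Lambda> (bracket F (v 0)) = c0 * a1" "\<Lambda> (bracket F (v 1)) = c1 * a2" "\<Lambda> (bracket F (v 2)) = c2 * a3"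
      using Ev[OF le0] Ev[OF le(1)] Ev[OF le(2)] Hv[OF le0] Hv[OF le(1)] Hv[OF le(2)] Fv[OF le0] Fv[OF le(1)] Fv[OF le(2)]
      by (simp_all add: \<Lambda>_smul a0_def a1_def a2_def a3_def c0_def c1_def c2_def c4_def \<iota>2 numeral_2_eq_2 numeral_3_eq_3)
    have val': "\<Lambda> (bracket (v k) x) = - \<Lambda> (bracket x (v k))" for k x
      using bracket_antisym[of "v k" x] by (simp add: \<Lambda>_minus)
    have vv0: "\<Lambda> (bracket (v k) (v l)) = 0" if "k \<le> 2" "l \<le> 2" for k l
      using vv[of k l] that le by simp
    have "vec.dim W + 6 \<le> CARD('n)"
    proof (rule dim_annihilator_le[OF W])
      fix \<nu> :: "nat \<Rightarrow> 'f" assume "\<And>x. (\<Sum>j<6. \<nu> j * \<Lambda> (bracket x (z j))) = 0"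
      then have *: "\<nu> 0 * \<Lambda> (bracket x E) + \<nu> 1 * \<Lambda> (bracket x H) + \<nu> 2 * \<Lambda> (bracket x F)
          + \<nu> 3 * \<Lambda> (bracket x (v 0)) + \<nu> 4 * \<Lambda> (bracket x (v 1)) + \<nu> 5 * \<Lambda> (bracket x (v 2)) = 0" for x
        by (simp add: sum_lessThan_2_4_6 z_def)
      have on_v: "\<nu> 0 * \<Lambda> (bracket E (v k)) + \<nu> 1 * \<Lambda> (bracket H (v k)) + \<nu> 2 * \<Lambda> (bracket F (v k)) = 0"
        if "k \<le> 2" for k
      proof -
        have "\<nu> 0 * \<Lambda> (bracket (v k) E) + \<nu> 1 * \<Lambda> (bracket (v k) H) + \<nu> 2 * \<Lambda> (bracket (v k) F) = 0"
          using *[of "v k"] that by (simp add: vv0)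
        then show ?thesis unfolding val' by algebra
      qed
      have "\<nu> 0 = 0 \<and> \<nu> 1 = 0 \<and> \<nu> 2 = 0"
      proof (rule det3_kernel)
        show "0 * \<nu> 0 + (c0 * a0) * \<nu> 1 + (c0 * a1) * \<nu> 2 = 0"
          "a0 * \<nu> 0 + (c2 * a1) * \<nu> 1 + (c1 * a2) * \<nu> 2 = 0"
          "(2 * a1) * \<nu> 0 + (c4 * a2) * \<nu> 1 + (c2 * a3) * \<nu> 2 = 0"
          using on_v[of 0] on_v[of 1] on_v[of 2] unfolding val by (simp_all add: mult_ac)
        show "0 * ((c2 * a1) * (c2 * a3) - (c1 * a2) * (c4 * a2)) - (c0 * a0) * (a0 * (c2 * a3) - (c1 * a2) * (2 * a1))
            + (c0 * a1) * (a0 * (c4 * a2) - (c2 * a1) * (2 * a1)) \<noteq> 0"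
          using det by (simp add: stabilizer_det_def)
      qed
      then have \<nu>: "\<nu> 0 = 0" "\<nu> 1 = 0" "\<nu> 2 = 0" by auto
      have "\<nu> 3 = 0 \<and> \<nu> 4 = 0 \<and> \<nu> 5 = 0"
      proof (rule det3_kernel)
        show "0 * \<nu> 3 + a0 * \<nu> 4 + (2 * a1) * \<nu> 5 = 0"
          "(c0 * a0) * \<nu> 3 + (c2 * a1) * \<nu> 4 + (c4 * a2) * \<nu> 5 = 0"
          "(c0 * a1) * \<nu> 3 + (c1 * a2) * \<nu> 4 + (c2 * a3) * \<nu> 5 = 0"
          using *[of E] *[of H] *[of F] unfolding val \<nu> by (simp_all add: mult_ac)
        have "0 * ((c2 * a1) * (c2 * a3) - (c4 * a2) * (c1 * a2)) - a0 * ((c0 * a0) * (c2 * a3) - (c4 * a2) * (c0 * a1))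
            + (2 * a1) * ((c0 * a0) * (c1 * a2) - (c2 * a1) * (c0 * a1)) = stabilizer_det c0 c1 c2 c4 a0 a1 a2 a3"
          unfolding stabilizer_det_def by algebra
        then show "0 * ((c2 * a1) * (c2 * a3) - (c4 * a2) * (c1 * a2)) - a0 * ((c0 * a0) * (c2 * a3) - (c4 * a2) * (c0 * a1))
            + (2 * a1) * ((c0 * a0) * (c1 * a2) - (c2 * a1) * (c0 * a1)) \<noteq> 0"
          using det by simp
      qed
      then show "\<forall>j<6. \<nu> j = 0" using \<nu> by (auto simp: eval_nat_numeral less_Suc_eq)
    qed
    moreover have "invariant_count = m - 2" using 3 unfolding invariant_count_def by simp
    ultimately show ?thesis using card_eq 3 by simp
  qed
qed

end

context adapted_basis
begin

lemma lin_ne_0: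
  assumes "Vector_Spaces.linear smul (*) g" "g y \<noteq> 0"
  shows "lin p y \<noteq> 0"
  using along_lin[OF assms(1), of p y] assms(2) by auto

text \<open>The point with coordinates \<open>p\<^sub>k + t\<^sub>k\<close> is regular: the determinant is nonzero because its derivative
  in the direction of \<open>a\<^sub>3\<close> is.\<close>

lemma number_of_formal_invariants_upper: "number_of_formal_invariants struct \<le> invariant_count"
proof -
  obtain p G where G: "\<forall>a<number_of_formal_invariants struct. formal_invariant struct p (G a)"
    "formally_independent (number_of_formal_invariants struct) G"
    using number_of_formal_invariants_attained by blast
  define c :: "'k \<Rightarrow> ('k, 'n) mfps fract" where "c a = Fract (mfps_const a) 1" for a
  define L where "L y = Fract (lin p y) 1" for y
  interpret extended_functional smul bracket e E H F v m c L
    by unfold_locales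
      (simp_all add: c_def L_def mfps_const_add mfps_const_mult lin_add lin_smul One_fract_def)
  define d0 d1 d2 d4 where "d0 = (mfps_const (of_nat m) :: ('k, 'n) mfps)" and "d1 = (mfps_const (of_nat m - 1) :: ('k, 'n) mfps)"
    and "d2 = (mfps_const (of_nat m - 2) :: ('k, 'n) mfps)" and "d4 = (mfps_const (of_nat m - 4) :: ('k, 'n) mfps)"
  define a where "a k = lin p (v k)" for k
  have two: "2 = Fract (2 :: ('k, 'n) mfps) 1"
  proof -
    have "Fract (1 + 1 :: ('k, 'n) mfps) 1 = 1 + 1" unfolding Fract_hom ..
    then show ?thesis by simp
  qed
  have det_eq: "stabilizer_det (c (of_nat m)) (c (of_nat m - 1)) (c (of_nat m - 2)) (c (of_nat m - 4))
        (L (v 0)) (L (v 1)) (L (v 2)) (L (v 3)) = Fract (stabilizer_det d0 d1 d2 d4 (a 0) (a 1) (a 2) (a 3)) 1"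
    by (simp add: stabilizer_det_def c_def L_def d0_def d1_def d2_def d4_def a_def two)
  have "stabilizer_det d0 d1 d2 d4 (a 0) (a 1) (a 2) (a 3) \<noteq> 0" if m: "3 \<le> m"
  proof
    define g where "g = functional 0 0 0 (\<lambda>k. if k = 3 then 1 else 0)"
    have g: "Vector_Spaces.linear smul (*) g" unfolding g_def by (rule functional)
    have along_a: "along g (a 0) = 0" "along g (a 1) = 0" "along g (a 2) = 0" "along g (a 3) = 1"
      unfolding a_def along_lin[OF g] using m by (simp_all add: g_def functional(5))
    have along_2: "along g 2 = 0"
      using along_add[of g 1 1] by simp
    have along_d: "along g d0 = 0" "along g d1 = 0" "along g d2 = 0" "along g d4 = 0"
      unfolding d0_def d1_def d2_def d4_def by (rule along_const)+
    assume "stabilizer_det d0 d1 d2 d4 (a 0) (a 1) (a 2) (a 3) = 0"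
    then have "along g (stabilizer_det d0 d1 d2 d4 (a 0) (a 1) (a 2) (a 3)) = 0" by simp
    then have "d0 * a 0 * (a 0 * d2) = 0"
      unfolding stabilizer_det_def
      by (simp only: along.D_diff along_mult along_a along_2 along_d mult_zero_left mult_zero_right
          add_0_left add_0_right diff_0 diff_0_right mult_1_right neg_equal_0_iff_equal)
    moreover have "a 0 \<noteq> 0"
      unfolding a_def
      by (rule lin_ne_0[OF functional(1)[of 0 0 0 "\<lambda>_. 1"]]) (simp add: functional(5))
    moreover have "d0 \<noteq> 0" using m by (simp add: d0_def)
    moreover have "(of_nat m - 2 :: 'k) \<noteq> 0"
    proof -
      have "(of_nat m - 2 :: 'k) = of_nat (m - 2)" using m by (simp add: of_nat_diff)
      then show ?thesis using m by (simp only: of_nat_eq_0_iff)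
    qed
    then have "d2 \<noteq> 0" by (simp add: d2_def)
    ultimately show False by simp
  qed
  moreover have "L y \<noteq> 0" if "functional \<alpha> \<beta> \<gamma> b y = 1" for \<alpha> \<beta> \<gamma> b y
    unfolding L_def using that by (intro Fract_ne_0 lin_ne_0[OF functional(1)[of \<alpha> \<beta> \<gamma> b]]) simp
  then have "L H \<noteq> 0" "L (v 0) \<noteq> 0"
    using functional(3)[of 0 1 0 "\<lambda>_. 0"] functional(5)[of 0 0 0 0 "\<lambda>_. 1"] by blast+
  ultimately have regular
    unfolding regular_def det_eq using Fract_ne_0 by blast
  moreover define W where "W = (\<lambda>a. \<chi> j. Fract (mfps_deriv j (G a)) 1) ` {..<number_of_formal_invariants struct}"
  have "W \<subseteq> annihilator"
  proof
    fix w assume "w \<in> W"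
    then obtain b where b: "b < number_of_formal_invariants struct" "w = (\<chi> j. Fract (mfps_deriv j (G b)) 1)"
      by (auto simp: W_def)
    have "(\<Sum>j\<in>UNIV. w $ j * L (bracket (e i) (e j))) = Fract (coadj p (e i) (G b)) 1" for i
      by (simp add: b L_def coadj_def Fract_sum mult.commute)
    moreover have "coadj p (e i) (G b) = 0" for i
      using G(1) b(1) by (simp add: formal_invariant_iff)
    ultimately show "w \<in> annihilator" by (simp add: annihilator_def Fract_hom)
  qed
  ultimately have "vec.dim W \<le> invariant_count" by (rule dim_annihilator_regular[rotated])
  then show ?thesis using G(2) unfolding formally_independent_def W_def by simp
qed

end

lemma open_contains_translate:
  fixes x q :: "'k::real_normed_field ^ 'n::finite"
  assumes "open V" "x \<in> V"
  obtains s where "s \<noteq> 0" "x + s *s q \<in> V"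
proof -
  obtain \<epsilon> where \<epsilon>: "\<epsilon> > 0" "ball x \<epsilon> \<subseteq> V" using assms open_contains_ball by blast
  define c where "c = norm q + 1"
  have c: "c > 0" "norm q \<le> c" by (simp_all add: c_def add_nonneg_pos)
  define t where "t = \<epsilon> / (2 * c)"
  have t: "t > 0" using \<epsilon> c by (simp add: t_def)
  have eq: "of_real t *s q = t *\<^sub>R q"
    by (simp add: vec_eq_iff) (simp add: scaleR_conv_of_real)
  have "norm (t *\<^sub>R q) \<le> t * c" using t c by simp
  also have "\<dots> = \<epsilon> / 2" using c by (simp add: t_def)
  also have "\<dots> < \<epsilon>" using \<epsilon> by simp
  finally have "x + of_real t *s q \<in> ball x \<epsilon>" unfolding eq by (simp add: dist_norm)
  then show ?thesis using that[of "of_real t"] t \<epsilon> by auto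
qed

text \<open>A regular point exists in every nonempty open set: first move until the coordinate \<open>a\<^sub>0\<close> (or \<open>H\<close>) is
  nonzero, then move in the direction of \<open>a\<^sub>3\<close>, where the determinant is a nonconstant affine function.\<close>

lemma number_of_analytic_invariants_upper:
  fixes smul :: "'k::{real_normed_field, banach} \<Rightarrow> 'l::ab_group_add \<Rightarrow> 'l" and e :: "'n::finite \<Rightarrow> 'l"
  assumes "adapted_basis smul bracket e E H F v m"
  shows "number_of_analytic_invariants (lie_algebra.structure_constant smul bracket e)
    \<le> adapted_basis.invariant_count m"
proof -
  interpret adapted_basis smul bracket e E H F v m by (rule assms)
  define N where "N = number_of_analytic_invariants struct"
  obtain U G where U: "open U" "U \<noteq> {}" and inv: "\<forall>a<N. analytic_invariant struct U (G a)"
    and indep: "functionally_independent N U G"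
    using number_of_analytic_invariants_attained[of struct] unfolding N_def by blast
  obtain V where V: "open V" "V \<subseteq> U" "U \<subseteq> closure V"
    and dim: "\<forall>x\<in>V. vec.dim ((\<lambda>a. \<chi> j. partial_deriv j (G a) x) ` {..<N}) = N"
    using indep unfolding functionally_independent_def by blast
  have "V \<noteq> {}" using V U by auto
  define L where "L x y = (\<Sum>k\<in>UNIV. coord y k * x $ k)" for x :: "'k ^ 'n" and y
  have ext: "extended_functional smul bracket e E H F v m (\<lambda>a. a) (L x)" for x
    by unfold_locales (simp_all add: L_def coord_linear distrib_right sum.distrib sum_distrib_left mult.assoc)
  have L_shift: "L (x + s *s (\<chi> i. functional \<alpha> \<beta> \<gamma> b (e i))) y = L x y + s * functional \<alpha> \<beta> \<gamma> b y" for x s \<alpha> \<beta> \<gamma> b y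
    by (simp add: L_def linear_coord_sum[OF functional(1), of _ _ _ _ y] distrib_left sum.distrib sum_distrib_left mult_ac)
  have move: "\<exists>x\<in>V. L x y \<noteq> 0" if "functional \<alpha> \<beta> \<gamma> b y = 1" for \<alpha> \<beta> \<gamma> b y
  proof -
    obtain x where x: "x \<in> V" using \<open>V \<noteq> {}\<close> by blast
    obtain s where "s \<noteq> 0" "x + s *s (\<chi> i. functional \<alpha> \<beta> \<gamma> b (e i)) \<in> V"
      by (rule open_contains_translate[OF V(1) x])
    then show ?thesis using x L_shift[of x s \<alpha> \<beta> \<gamma> b y] that by (metis add_0 mult_1_right)
  qed
  have "\<exists>x\<in>V. extended_functional.regular H v m (\<lambda>a. a) (L x)"
  proof -
    consider "m = 0" | "1 \<le> m" "m < 3" | "3 \<le> m" by linarith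
    then show ?thesis
    proof cases
      case 1
      obtain x where "x \<in> V" "L x H \<noteq> 0" using move[OF functional(3)[of 0 1 0 "\<lambda>_. 0"]] by blast
      then show ?thesis
        using 1 unfolding extended_functional.regular_def[OF ext] by (intro bexI[of _ x]) auto
    next
      case 2
      obtain x where "x \<in> V" "L x (v 0) \<noteq> 0"
        using move[OF functional(5)[of 0 0 0 0 "\<lambda>_. 1"]] by blast
      then show ?thesis
        using 2 unfolding extended_functional.regular_def[OF ext] by (intro bexI[of _ x]) auto
    next
      case 3
      obtain x where x: "x \<in> V" "L x (v 0) \<noteq> 0"
        using move[of 0 0 0 "\<lambda>_. 1" "v 0"] by (auto simp: functional)
      define q where "q = (\<chi> i. functional 0 0 0 (\<lambda>k. if k = 3 then 1 else 0) (e i))"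
      define S where "S x = stabilizer_det (of_nat m) (of_nat m - 1) (of_nat m - 2) (of_nat m - 4)
        (L x (v 0)) (L x (v 1)) (L x (v 2)) (L x (v 3))" for x
      have shift: "L (x + s *s q) (v 0) = L x (v 0)" "L (x + s *s q) (v 1) = L x (v 1)"
        "L (x + s *s q) (v 2) = L x (v 2)" "L (x + s *s q) (v 3) = L x (v 3) + s" for s
        unfolding q_def L_shift using 3 by (simp_all add: functional(5))
      have S_shift: "S (x + s *s q) = S x - s * (of_nat m * (of_nat m - 2) * L x (v 0) * L x (v 0))" for s
        unfolding S_def shift stabilizer_det_def by (simp add: algebra_simps)
      have "(of_nat m - 2 :: 'k) = of_nat (m - 2)" using 3 by (simp add: of_nat_diff)
      then have ne: "(of_nat m - 2 :: 'k) \<noteq> 0" "(of_nat m :: 'k) \<noteq> 0" using 3 by (simp_all only: of_nat_eq_0_iff)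
      obtain s where s: "s \<noteq> 0" "x + s *s q \<in> V" by (rule open_contains_translate[OF V(1) x(1)])
      have "S x \<noteq> 0 \<or> S (x + s *s q) \<noteq> 0"
        using S_shift[of s] s(1) ne x(2) by auto
      then obtain x' where "x' \<in> V" "L x' (v 0) \<noteq> 0" "S x' \<noteq> 0"
        using x s shift(1)[of s] by metis
      then show ?thesis
        using 3 unfolding extended_functional.regular_def[OF ext] S_def by (intro bexI[of _ x']) auto
    qed
  qed
  then obtain x where x: "x \<in> V" "extended_functional.regular H v m (\<lambda>a. a) (L x)" by blast
  define W where "W = (\<lambda>a. \<chi> j. partial_deriv j (G a) x) ` {..<N}"
  have "W \<subseteq> extended_functional.annihilator bracket e (L x)"
  proof
    fix w assume "w \<in> W"
    then obtain a where a: "a < N" "w = (\<chi> j. partial_deriv j (G a) x)" by (auto simp: W_def)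
    have "(\<Sum>j\<in>UNIV. w $ j * L x (bracket (e i) (e j)))
        = (\<Sum>j\<in>UNIV. \<Sum>k\<in>UNIV. struct i j k * x $ k * partial_deriv j (G a) x)" for i
      by (simp add: a L_def structure_constant_def sum_distrib_left mult_ac)
    moreover have "(\<Sum>j\<in>UNIV. \<Sum>k\<in>UNIV. struct i j k * x $ k * partial_deriv j (G a) x) = 0" for i
      using inv a(1) x(1) V(2) unfolding analytic_invariant_def by blast
    ultimately show "w \<in> extended_functional.annihilator bracket e (L x)"
      by (simp add: extended_functional.annihilator_def[OF ext])
  qed
  from extended_functional.dim_annihilator_regular[OF ext this x(2)]
  show ?thesis using dim x(1) unfolding W_def N_def by simp
qed


lemma adapted_basis_invariant_count:
  assumes "adapted_basis smul bracket e E H F v m" "d = m + 1" "N = adapted_basis.invariant_count m"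
  shows "(d = 1 \<longrightarrow> N = 2) \<and> (d = 2 \<longrightarrow> N = 1) \<and> (d = 3 \<longrightarrow> N = 2) \<and> (d \<ge> 4 \<longrightarrow> N = d - 3)"
  using assms(2,3) unfolding adapted_basis.invariant_count_def[OF assms(1)] by auto

lemma number_of_formal_invariants_sl2_semidirect_sum:
  assumes sum: "sl2_semidirect_sum smul bracket S R \<pi>" and d: "vector_space.dim smul R = d"
    and basis: "lie_algebra.is_basis smul (e :: 'n::finite \<Rightarrow> 'l::ab_group_add)"
    and N: "N = number_of_formal_invariants (lie_algebra.structure_constant smul bracket e)"
  shows "(d = 1 \<longrightarrow> N = 2) \<and> (d = 2 \<longrightarrow> N = 1) \<and> (d = 3 \<longrightarrow> N = 2) \<and> (d \<ge> 4 \<longrightarrow> N = d - 3)"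
proof -
  obtain E H F v m where ab: "adapted_basis smul bracket e E H F v m" and "d = m + 1"
    using sl2_semidirect_sum.adapted_basis_exists[OF sum basis] d by blast
  moreover have "N = adapted_basis.invariant_count m"
    using adapted_basis.number_of_formal_invariants_lower[OF ab]
      adapted_basis.number_of_formal_invariants_upper[OF ab] N by simp
  ultimately show ?thesis by (rule adapted_basis_invariant_count)
qed

lemma number_of_analytic_invariants_sl2_semidirect_sum:
  fixes smul :: "'k::{real_normed_field, banach} \<Rightarrow> 'l::ab_group_add \<Rightarrow> 'l"
  assumes sum: "sl2_semidirect_sum smul bracket S R \<pi>" and d: "vector_space.dim smul R = d"
    and basis: "lie_algebra.is_basis smul (e :: 'n::finite \<Rightarrow> 'l)"
    and N: "N = number_of_analytic_invariants (lie_algebra.structure_constant smul bracket e)"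
  shows "(d = 1 \<longrightarrow> N = 2) \<and> (d = 2 \<longrightarrow> N = 1) \<and> (d = 3 \<longrightarrow> N = 2) \<and> (d \<ge> 4 \<longrightarrow> N = d - 3)"
proof -
  obtain E H F v m where ab: "adapted_basis smul bracket e E H F v m" and "d = m + 1"
    using sl2_semidirect_sum.adapted_basis_exists[OF sum basis] d by blast
  moreover have "N = adapted_basis.invariant_count m"
    using number_of_analytic_invariants_lower[OF ab] number_of_analytic_invariants_upper[OF ab] N by simp
  ultimately show ?thesis by (rule adapted_basis_invariant_count)
qed

theorem theorem4:
  fixes smul :: "'k::field_char_0 \<Rightarrow> 'l::ab_group_add \<Rightarrow> 'l"
    and smul_real :: "real \<Rightarrow> 'l \<Rightarrow> 'l"
    and smul_complex :: "complex \<Rightarrow> 'l \<Rightarrow> 'l"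
    and bracket :: "'l \<Rightarrow> 'l \<Rightarrow> 'l"
    and S R :: "'l set"
    and \<pi> :: "'l \<Rightarrow> 'l \<Rightarrow> 'l"
    and e :: "'n::finite \<Rightarrow> 'l"
    and d :: nat
  assumes "d \<ge> 1"
  shows
    "(sl2_semidirect_sum smul bracket S R \<pi> \<and> vector_space.dim smul R = d \<and>
        lie_algebra.is_basis smul e \<longrightarrow>
      (let N = number_of_formal_invariants (lie_algebra.structure_constant smul bracket e) in
        (d = 1 \<longrightarrow> N = 2) \<and> (d = 2 \<longrightarrow> N = 1) \<and> (d = 3 \<longrightarrow> N = 2) \<and> (d \<ge> 4 \<longrightarrow> N = d - 3))) \<and>
     (sl2_semidirect_sum smul_real bracket S R \<pi> \<and> vector_space.dim smul_real R = d \<and>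
        lie_algebra.is_basis smul_real e \<longrightarrow>
      (let N = number_of_analytic_invariants (lie_algebra.structure_constant smul_real bracket e) in
        (d = 1 \<longrightarrow> N = 2) \<and> (d = 2 \<longrightarrow> N = 1) \<and> (d = 3 \<longrightarrow> N = 2) \<and> (d \<ge> 4 \<longrightarrow> N = d - 3))) \<and>
     (sl2_semidirect_sum smul_complex bracket S R \<pi> \<and> vector_space.dim smul_complex R = d \<and>
        lie_algebra.is_basis smul_complex e \<longrightarrow>
      (let N = number_of_analytic_invariants (lie_algebra.structure_constant smul_complex bracket e) in
        (d = 1 \<longrightarrow> N = 2) \<and> (d = 2 \<longrightarrow> N = 1) \<and> (d = 3 \<longrightarrow> N = 2) \<and> (d \<ge> 4 \<longrightarrow> N = d - 3)))"
  unfolding Let_def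
  by (rule conjI[OF impI conjI[OF impI impI]]; elim conjE;
      rule number_of_formal_invariants_sl2_semidirect_sum[OF _ _ _ refl]
        number_of_analytic_invariants_sl2_semidirect_sum[OF _ _ _ refl];
      assumption)

end
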